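(* Let $\mathbb H$ be the graded affine Hecke algebra attached to a real root system $\Phi$ with Weyl group $W$ and a $W$-invariant parameter function $k:\Phi\to\mathbb C$. Let $(\pi,M)$ be an $\mathbb H$-module with a central character and with a nondegenerate $*$-invariant hermitian form $\langle\,,\,\rangle_M$, and let $\sigma$ be an irreducible $W$-representation. If $x\in M(\sigma)\otimes\mathcal P$, then $$\langle D^+x,D^+x\rangle_{M\otimes\mathcal P}-\langle D^-x,D^-x\rangle_{M\otimes\mathcal P}=\big(-\pi(\Omega)+\sigma(\Omega_W)\big)\langle x,x\rangle_{M\otimes\mathcal P}+\langle\mathcal E_{\sigma,\mathcal P}x,x\rangle_{M\otimes\mathcal P}.$$
   Context: $(V_0^*,\Phi,V_0,\Phi^\vee)$ is a real root system with coroots $\alpha^\vee\in V_0$, reflections $s_\alpha(v)=v-\alpha(v)\alpha^\vee$, finite Weyl group $W$, and $B$ a positive-definite $W$-invariant symmetric bilinear form on $V_0$; $V=\mathbb C\otimes_{\mathbb R}V_0$, $B$ is extended complex-bilinearly, and $B$ also denotes the dual form on $V^*$. Fix positive roots $\Phi^+$ with simple roots $\Pi$; $\Phi_2^+$ is the set of unordered pairs of distinct positive roots. $\mathbb H$ is the associative unital algebra generated by $\mathbb C[W]$ and $V$, with elements of $V$ commuting with each other and $v\cdot s_\alpha-s_\alpha\cdot s_\alpha(v)=k_\alpha\alpha(v)$ for $v\in V,\alpha\in\Pi$. Put $\widetilde v=v-\frac12\sum_{\alpha>0}k_\alpha\alpha(v)s_\alpha$. The star operation $*$ on $\mathbb H$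 is the conjugate-linear anti-involution defined on generators by $w^*=w^{-1}$ ($w\in W$), $\widetilde v^*=-\widetilde v$ ($v\in V_0$); $*$-invariance means $\langle\pi(h)m,m'\rangle_M=\langle m,\pi(h^* )m'\rangle_M$. $\mathcal W=\mathcal W(V\oplus V^*,\omega)$ is the Weyl algebra: the quotient of the tensor algebra of $V\oplus V^*$ by $vw-wv=\omega(v,w)$, where $V,V^*$ are isotropic and $\omega(\lambda,v)=\lambda(v)$. It acts on $\mathcal P=S(V)$: $v\in V$ by multiplication, $\lambda\in V^*$ by the derivation $\partial_\lambda$ with $v\mapsto\lambda(v)$. The hermitian form on $\mathcal P$ is $\langle P_1,P_2\rangle_{\mathcal P}=\partial_{P_2}(\overline{P_1})$ evaluated at $0$, where the bar is conjugation with real points $S(V_0)$ and $\partial_P$ is the constant-coefficient differential operator defined by $P$ via $v_i\mapsto v_i^*$ for a $B$-orthonormal basis $\{v_i\}$ of $V_0$. Hermitian forms are conjugate-linear in the first and linear in the second variable; $\langle\,,\,\rangle_{M\otimes\mathcal P}=\langle\,,\,\rangle_M\langle\,,\,\rangle_{\mathcal P}$ is the product form. For a basis $\{v_i\}$ of $V$ with $B$-dual basis $\{v^i\}\subset V$ and dual basis $\{v_i^*\}\subset V^*$: $D^-=\sum_i\widetilde v_i\otimes v_i^*$, $D^+=\sum_i\widetilde v_i\otimes v^i$ in $\mathbb H\otimes\mathcal W$, acting on $M\otimes\mathcal P$. $M(\sigma)$ is the $\sigma$-isotypic component of $M|_W$. $\pi(\Omega)$ is the scalar by which the central element $\Omega=\sum_iv_iv^i\in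 Z(\mathbb H)$ acts on $M$, and $\sigma(\Omega_W)$ the scalar by which the central element $\Omega_W=\frac14\sum_{\alpha,\beta>0}k_\alpha k_\beta B(\alpha,\beta)s_\alpha s_\beta$ of $\mathbb C[W]$ acts on $\sigma$. Finally $$\mathcal E_{\sigma,\mathcal P}=\frac14\sum_{\{\alpha,\beta\}\in\Phi_2^+}k_\alpha k_\beta\,\sigma([s_\alpha,s_\beta])\otimes\big(\iota(\alpha)\partial_\beta-\iota(\beta)\partial_\alpha\big)$$ acting on $M(\sigma)\otimes\mathcal P$, where $\sigma([s_\alpha,s_\beta])$ is the action of $s_\alpha s_\beta-s_\beta s_\alpha$ on $M(\sigma)$ and $\iota(\alpha)\in V$ is defined by $\alpha(v)=B(\iota(\alpha),v)$.
   Formalization: The last term is proved with a minus sign, −⟨E x,x⟩ instead of +⟨E x,x⟩: with the stated conventions D⁺D⁻−D⁻D⁺ = −Ω+Ω_W−E, so the printed sign fails, e.g. for A₂ with σ the reflection representation. The root system is taken to be reduced. *)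

theory Defs
  imports
    "HOL-Analysis.Analysis"
    "HOL-Library.Poly_Mapping"
    "HOL-Algebra.QuotRing"
begin

section \<open>Root data\<close>

text \<open>
  \<open>V\<^sub>0\<close> is \<^typ>\<open>real^'n\<close>; the coordinates are with respect to an arbitrary basis, unrelated to the
  form \<open>B\<close> (field \<open>form\<close>), and the canonical inner product of the type is never used.
  The dual \<open>V\<^sub>0\<^sup>*\<close> is \<^typ>\<open>(real^'n) \<Rightarrow>\<^sub>L real\<close> (boundedness is automatic), and
  \<open>V\<close>, the complexification of \<open>V\<^sub>0\<close>, is \<^typ>\<open>complex^'n\<close>.
\<close>

record (overloaded) ('n::finite) hecke_datum =
  roots :: "((real^'n) \<Rightarrow>\<^sub>L real) set"
  coroot :: "((real^'n) \<Rightarrow>\<^sub>L real) \<Rightarrow> real^'n"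
  pos :: "((real^'n) \<Rightarrow>\<^sub>L real) set"
  simple :: "((real^'n) \<Rightarrow>\<^sub>L real) set"
  par :: "((real^'n) \<Rightarrow>\<^sub>L real) \<Rightarrow> complex"
  form :: "real^'n \<Rightarrow> real^'n \<Rightarrow> real"

definition refl :: "('n::finite) hecke_datum \<Rightarrow> ((real^'n) \<Rightarrow>\<^sub>L real) \<Rightarrow> real^'n \<Rightarrow> real^'n" where
  "refl D \<alpha> v = v - blinfun_apply \<alpha> v *\<^sub>R coroot D \<alpha>"

inductive_set weyl :: "('n::finite) hecke_datum \<Rightarrow> (real^'n \<Rightarrow> real^'n) set" for D where
  weyl_id: "id \<in> weyl D"
| weyl_refl: "w \<in> weyl D \<Longrightarrow> \<alpha> \<in> roots D \<Longrightarrow> refl D \<alpha> \<circ> w \<in> weyl D"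

text \<open>
  The roots need neither span the dual space nor be crystallographic, but the system is reduced.
  On the dual space the reflection is \<open>\<beta> \<mapsto> \<beta> \<circ> s\<^sub>\<alpha> = \<beta> - \<beta>(\<alpha>\<^sup>\<or>) \<alpha>\<close>.
\<close>

definition root_system :: "('n::finite) hecke_datum \<Rightarrow> bool" where
  "root_system D \<longleftrightarrow>
     finite (roots D) \<and> 0 \<notin> roots D \<and> inj_on (coroot D) (roots D) \<and>
     (\<forall>\<alpha>\<in>roots D. blinfun_apply \<alpha> (coroot D \<alpha>) = 2) \<and>
     (\<forall>\<alpha>\<in>roots D. \<forall>\<beta>\<in>roots D. \<beta> - blinfun_apply \<beta> (coroot D \<alpha>) *\<^sub>R \<alpha> \<in> roots D) \<and>
     (\<forall>\<alpha>\<in>roots D. \<forall>\<beta>\<in>roots D. refl D \<alpha> (coroot D \<beta>) \<in> coroot D ` roots D) \<and>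
     (\<forall>\<alpha>\<in>roots D. \<forall>c. c *\<^sub>R \<alpha> \<in> roots D \<longrightarrow> c = 1 \<or> c = -1)"

definition positive_system :: "('n::finite) hecke_datum \<Rightarrow> bool" where
  "positive_system D \<longleftrightarrow>
     roots D = pos D \<union> uminus ` pos D \<and> pos D \<inter> uminus ` pos D = {} \<and>
     simple D \<subseteq> pos D \<and> independent (simple D) \<and>
     (\<forall>\<alpha>\<in>pos D. \<exists>c. (\<forall>\<beta>\<in>simple D. 0 \<le> c \<beta>) \<and> \<alpha> = (\<Sum>\<beta>\<in>simple D. c \<beta> *\<^sub>R \<beta>))"

text \<open>\<open>\<beta> = w \<alpha>\<close> in the dual space means \<open>\<beta>(w v) = \<alpha>(v)\<close> for all \<open>v\<close>.\<close>

definition invariant_parameter :: "('n::finite) hecke_datum \<Rightarrow> bool" where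
  "invariant_parameter D \<longleftrightarrow>
     (\<forall>w\<in>weyl D. \<forall>\<alpha>\<in>roots D. \<forall>\<beta>\<in>roots D.
        (\<forall>v. blinfun_apply \<beta> (w v) = blinfun_apply \<alpha> v) \<longrightarrow> par D \<beta> = par D \<alpha>)"

definition invariant_form :: "('n::finite) hecke_datum \<Rightarrow> bool" where
  "invariant_form D \<longleftrightarrow>
     bilinear (form D) \<and> (\<forall>u v. form D u v = form D v u) \<and> (\<forall>v. v \<noteq> 0 \<longrightarrow> 0 < form D v v) \<and>
     (\<forall>w\<in>weyl D. \<forall>u v. form D (w u) (w v) = form D u v)"

definition valid_datum :: "('n::finite) hecke_datum \<Rightarrow> bool" where
  "valid_datum D \<longleftrightarrow>
     root_system D \<and> positive_system D \<and> invariant_parameter D \<and> invariant_form D"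

definition iota :: "('n::finite) hecke_datum \<Rightarrow> ((real^'n) \<Rightarrow>\<^sub>L real) \<Rightarrow> real^'n" where
  "iota D \<alpha> = (THE u. \<forall>v. blinfun_apply \<alpha> v = form D u v)"

definition dual_form ::
    "('n::finite) hecke_datum \<Rightarrow> ((real^'n) \<Rightarrow>\<^sub>L real) \<Rightarrow> ((real^'n) \<Rightarrow>\<^sub>L real) \<Rightarrow> real" where
  "dual_form D \<alpha> \<beta> = form D (iota D \<alpha>) (iota D \<beta>)"


section \<open>Complexification\<close>

definition cvec :: "real^'n \<Rightarrow> complex^('n::finite)" where
  "cvec v = (\<chi> i. complex_of_real (v $ i))"

definition cfun :: "((real^'n) \<Rightarrow>\<^sub>L real) \<Rightarrow> complex^('n::finite) \<Rightarrow> complex" where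
  "cfun \<alpha> v = (\<Sum>i\<in>UNIV. v $ i * complex_of_real (blinfun_apply \<alpha> (axis i 1)))"

definition cform ::
    "('n::finite) hecke_datum \<Rightarrow> complex^'n \<Rightarrow> complex^'n \<Rightarrow> complex" where
  "cform D u v =
     (\<Sum>i\<in>UNIV. \<Sum>j\<in>UNIV. u $ i * v $ j * complex_of_real (form D (axis i 1) (axis j 1)))"

definition crefl ::
    "('n::finite) hecke_datum \<Rightarrow> ((real^'n) \<Rightarrow>\<^sub>L real) \<Rightarrow> complex^'n \<Rightarrow> complex^'n" where
  "crefl D \<alpha> v = v - cfun \<alpha> v *s cvec (coroot D \<alpha>)"

text \<open>\<open>b\<close> is a basis of \<open>V\<close>, \<open>b'\<close> its \<open>B\<close>-dual basis in \<open>V\<close>, \<open>bs\<close> its dual basis in \<open>V\<^sup>*\<close>.\<close>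

definition dual_bases ::
    "('n::finite) hecke_datum \<Rightarrow> ('n \<Rightarrow> complex^'n) \<Rightarrow> ('n \<Rightarrow> complex^'n) \<Rightarrow>
     ('n \<Rightarrow> complex^'n \<Rightarrow> complex) \<Rightarrow> bool" where
  "dual_bases D b b' bs \<longleftrightarrow>
     inj b \<and> vec.independent (range b) \<and> vec.span (range b) = UNIV \<and>
     (\<forall>i j. cform D (b i) (b' j) = (if i = j then 1 else 0)) \<and>
     (\<forall>i. Vector_Spaces.linear (*s) (*) (bs i)) \<and>
     (\<forall>i j. bs i (b j) = (if i = j then 1 else 0))"


section \<open>The graded affine Hecke algebra\<close>

text \<open>
  The free algebra over the complex numbers on generators of type \<open>'g\<close> is the monoid algebra
  of words; multiplication of poly-mappings is convolution along the monoid operation, which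
  has to be written additively.
\<close>

datatype 'g word = Word "'g list"

instantiation word :: (type) monoid_add
begin

definition zero_word :: "'a word" where "zero_word = Word []"

fun plus_word :: "'a word \<Rightarrow> 'a word \<Rightarrow> 'a word" where
  "plus_word (Word xs) (Word ys) = Word (xs @ ys)"

instance
proof
  fix a b c :: "'a word"
  show "a + b + c = a + (b + c)" by (cases a; cases b; cases c) simp
  show "0 + a = a" by (cases a) (simp add: zero_word_def)
  show "a + 0 = a" by (cases a) (simp add: zero_word_def)
qed

end

type_synonym 'g free_algebra = "'g word \<Rightarrow>\<^sub>0 complex"

definition free_ring :: "'g free_algebra ring" where
  "free_ring = \<lparr>carrier = UNIV, monoid.mult = (*), one = 1, ring.zero = 0, ring.add = (+)\<rparr>"

definition gen :: "'g \<Rightarrow> 'g free_algebra" where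
  "gen g = Poly_Mapping.single (Word [g]) 1"

definition scal :: "complex \<Rightarrow> 'g free_algebra" where
  "scal c = Poly_Mapping.single 0 c"

datatype ('w, 'v) hecke_gen = GW 'w | GV 'v

type_synonym 'n hecke_free = "(real^'n \<Rightarrow> real^'n, complex^'n) hecke_gen free_algebra"

text \<open>
  The generators \<open>GW f\<close> with \<open>f\<close> outside the Weyl group exist only for typing reasons
  and are killed by the first family of relations.
\<close>

definition hecke_relations :: "('n::finite) hecke_datum \<Rightarrow> 'n hecke_free set" where
  "hecke_relations D =
     {gen (GW f) | f. f \<notin> weyl D} \<union>
     {gen (GW id) - 1} \<union>
     {gen (GW w) * gen (GW w') - gen (GW (w \<circ> w')) | w w'. w \<in> weyl D \<and> w' \<in> weyl D} \<union>
     {gen (GV (u + v)) - (gen (GV u) + gen (GV v)) | u v. True} \<union>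
     {gen (GV (c *s v)) - scal c * gen (GV v) | c v. True} \<union>
     {gen (GV u) * gen (GV v) - gen (GV v) * gen (GV u) | u v. True} \<union>
     {gen (GV v) * gen (GW (refl D \<alpha>)) - gen (GW (refl D \<alpha>)) * gen (GV (crefl D \<alpha> v))
        - scal (par D \<alpha> * cfun \<alpha> v) | v \<alpha>. \<alpha> \<in> simple D}"

definition hecke_ideal :: "('n::finite) hecke_datum \<Rightarrow> 'n hecke_free set" where
  "hecke_ideal D = genideal free_ring (hecke_relations D)"

definition hecke :: "('n::finite) hecke_datum \<Rightarrow> 'n hecke_free set ring" where
  "hecke D = free_ring Quot (hecke_ideal D)"

definition hcls :: "('n::finite) hecke_datum \<Rightarrow> 'n hecke_free \<Rightarrow> 'n hecke_free set" where
  "hcls D x = a_r_coset free_ring (hecke_ideal D) x"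

definition hW :: "('n::finite) hecke_datum \<Rightarrow> (real^'n \<Rightarrow> real^'n) \<Rightarrow> 'n hecke_free set" where
  "hW D w = hcls D (gen (GW w))"

definition htilde :: "('n::finite) hecke_datum \<Rightarrow> complex^'n \<Rightarrow> 'n hecke_free set" where
  "htilde D v = hcls D (gen (GV v)
     - scal (1/2) * (\<Sum>\<alpha>\<in>pos D. scal (par D \<alpha> * cfun \<alpha> v) * gen (GW (refl D \<alpha>))))"

definition hOmega ::
    "('n::finite) hecke_datum \<Rightarrow> ('n \<Rightarrow> complex^'n) \<Rightarrow> ('n \<Rightarrow> complex^'n) \<Rightarrow> 'n hecke_free set" where
  "hOmega D b b' = hcls D (\<Sum>i\<in>UNIV. gen (GV (b i)) * gen (GV (b' i)))"

definition hecke_center :: "('n::finite) hecke_datum \<Rightarrow> 'n hecke_free set set" where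
  "hecke_center D =
     {z \<in> carrier (hecke D). \<forall>h\<in>carrier (hecke D). z \<otimes>\<^bsub>hecke D\<^esub> h = h \<otimes>\<^bsub>hecke D\<^esub> z}"

text \<open>
  The star operation is a conjugate-linear anti-involution of the quotient with prescribed values
  on generators, hence unique. For non-real parameters it need not exist, so it enters the
  theorem as a variable satisfying this predicate.
\<close>

definition hecke_star ::
    "('n::finite) hecke_datum \<Rightarrow> ('n hecke_free set \<Rightarrow> 'n hecke_free set) \<Rightarrow> bool" where
  "hecke_star D st \<longleftrightarrow>
     (\<forall>h\<in>carrier (hecke D). st h \<in> carrier (hecke D) \<and> st (st h) = h) \<and>
     (\<forall>h\<in>carrier (hecke D). \<forall>h'\<in>carrier (hecke D).
        st (h \<oplus>\<^bsub>hecke D\<^esub> h') = st h \<oplus>\<^bsub>hecke D\<^esub> st h' \<and>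
        st (h \<otimes>\<^bsub>hecke D\<^esub> h') = st h' \<otimes>\<^bsub>hecke D\<^esub> st h) \<and>
     (\<forall>c. \<forall>h\<in>carrier (hecke D).
        st (hcls D (scal c) \<otimes>\<^bsub>hecke D\<^esub> h) = hcls D (scal (cnj c)) \<otimes>\<^bsub>hecke D\<^esub> st h) \<and>
     (\<forall>w\<in>weyl D. st (hW D w) = hW D (the_inv w)) \<and>
     (\<forall>v. st (htilde D (cvec v)) = \<ominus>\<^bsub>hecke D\<^esub> htilde D (cvec v))"


section \<open>Modules, hermitian forms, representations of the Weyl group\<close>

definition hecke_module ::
    "('n::finite) hecke_datum \<Rightarrow> (complex \<Rightarrow> 'm \<Rightarrow> 'm) \<Rightarrow>
     ('n hecke_free set \<Rightarrow> 'm \<Rightarrow> 'm::ab_group_add) \<Rightarrow> bool" where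
  "hecke_module D sM \<pi> \<longleftrightarrow>
     vector_space sM \<and>
     (\<forall>h\<in>carrier (hecke D). Vector_Spaces.linear sM sM (\<pi> h)) \<and>
     (\<forall>h\<in>carrier (hecke D). \<forall>h'\<in>carrier (hecke D). \<forall>m.
        \<pi> (h \<oplus>\<^bsub>hecke D\<^esub> h') m = \<pi> h m + \<pi> h' m \<and>
        \<pi> (h \<otimes>\<^bsub>hecke D\<^esub> h') m = \<pi> h (\<pi> h' m)) \<and>
     (\<forall>c m. \<pi> (hcls D (scal c)) m = sM c m)"

definition has_central_character ::
    "('n::finite) hecke_datum \<Rightarrow> (complex \<Rightarrow> 'm \<Rightarrow> 'm) \<Rightarrow>
     ('n hecke_free set \<Rightarrow> 'm \<Rightarrow> 'm) \<Rightarrow> bool" where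
  "has_central_character D sM \<pi> \<longleftrightarrow>
     (\<exists>ch. \<forall>z\<in>hecke_center D. \<forall>m. \<pi> z m = sM (ch z) m)"

definition nondegenerate_hermitian ::
    "(complex \<Rightarrow> 'm \<Rightarrow> 'm) \<Rightarrow> ('m \<Rightarrow> 'm::ab_group_add \<Rightarrow> complex) \<Rightarrow> bool" where
  "nondegenerate_hermitian sM f \<longleftrightarrow>
     (\<forall>m. Vector_Spaces.linear sM (*) (f m)) \<and>
     (\<forall>m m'. f m' m = cnj (f m m')) \<and>
     (\<forall>m. (\<forall>m'. f m m' = 0) \<longrightarrow> m = 0)"

definition star_invariant ::
    "('n::finite) hecke_datum \<Rightarrow> ('n hecke_free set \<Rightarrow> 'n hecke_free set) \<Rightarrow>
     ('n hecke_free set \<Rightarrow> 'm \<Rightarrow> 'm) \<Rightarrow> ('m \<Rightarrow> 'm \<Rightarrow> complex) \<Rightarrow> bool" where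
  "star_invariant D st \<pi> f \<longleftrightarrow>
     (\<forall>h\<in>carrier (hecke D). \<forall>m m'. f (\<pi> h m) m' = f m (\<pi> (st h) m'))"

definition irreducible_rep ::
    "('n::finite) hecke_datum \<Rightarrow> (complex \<Rightarrow> 'u \<Rightarrow> 'u) \<Rightarrow>
     ((real^'n \<Rightarrow> real^'n) \<Rightarrow> 'u \<Rightarrow> 'u::ab_group_add) \<Rightarrow> bool" where
  "irreducible_rep D sU \<sigma> \<longleftrightarrow>
     vector_space sU \<and>
     (\<forall>w\<in>weyl D. Vector_Spaces.linear sU sU (\<sigma> w)) \<and>
     \<sigma> id = id \<and>
     (\<forall>w\<in>weyl D. \<forall>w'\<in>weyl D. \<sigma> (w \<circ> w') = \<sigma> w \<circ> \<sigma> w') \<and>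
     (\<exists>u::'u. u \<noteq> 0) \<and>
     (\<forall>S. module.subspace sU S \<and> (\<forall>w\<in>weyl D. \<forall>u\<in>S. \<sigma> w u \<in> S) \<longrightarrow> S = {0} \<or> S = UNIV)"

text \<open>The sum of all \<open>W\<close>-subrepresentations of \<open>M\<close> isomorphic to \<open>\<sigma>\<close>.\<close>

definition isotypic ::
    "('n::finite) hecke_datum \<Rightarrow> (complex \<Rightarrow> 'm \<Rightarrow> 'm) \<Rightarrow>
     ('n hecke_free set \<Rightarrow> 'm \<Rightarrow> 'm::ab_group_add) \<Rightarrow> (complex \<Rightarrow> 'u \<Rightarrow> 'u) \<Rightarrow>
     ((real^'n \<Rightarrow> real^'n) \<Rightarrow> 'u \<Rightarrow> 'u::ab_group_add) \<Rightarrow> 'm set" where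
  "isotypic D sM \<pi> sU \<sigma> = module.span sM (\<Union> {range f | f.
     Vector_Spaces.linear sU sM f \<and> inj f \<and>
     (\<forall>w\<in>weyl D. \<forall>u. f (\<sigma> w u) = \<pi> (hW D w) (f u))})"

definition Omega_W ::
    "('n::finite) hecke_datum \<Rightarrow> (complex \<Rightarrow> 'u \<Rightarrow> 'u) \<Rightarrow>
     ((real^'n \<Rightarrow> real^'n) \<Rightarrow> 'u \<Rightarrow> 'u::ab_group_add) \<Rightarrow> 'u \<Rightarrow> 'u" where
  "Omega_W D sU \<sigma> u = (\<Sum>\<alpha>\<in>pos D. \<Sum>\<beta>\<in>pos D.
     sU (1/4 * par D \<alpha> * par D \<beta> * complex_of_real (dual_form D \<alpha> \<beta>))
        (\<sigma> (refl D \<alpha> \<circ> refl D \<beta>) u))"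

definition scalar_of :: "(complex \<Rightarrow> 'm \<Rightarrow> 'm) \<Rightarrow> ('m \<Rightarrow> 'm) \<Rightarrow> complex" where
  "scalar_of s T = (THE c. \<forall>m. T m = s c m)"


section \<open>The polynomial module of the Weyl algebra\<close>

type_synonym 'n cpoly = "('n \<Rightarrow>\<^sub>0 nat) \<Rightarrow>\<^sub>0 complex"

definition vec_poly :: "complex^('n::finite) \<Rightarrow> 'n cpoly" where
  "vec_poly v = (\<Sum>i\<in>UNIV. Poly_Mapping.single (Poly_Mapping.single i 1) (v $ i))"

definition pdiff :: "'n \<Rightarrow> 'n cpoly \<Rightarrow> 'n cpoly" where
  "pdiff i P = (\<Sum>\<mu>\<in>Poly_Mapping.keys P. Poly_Mapping.single (\<mu> - Poly_Mapping.single i 1)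
     (of_nat (Poly_Mapping.lookup \<mu> i) * Poly_Mapping.lookup P \<mu>))"

text \<open>The derivation \<open>\<partial>\<^sub>\<lambda>\<close> for a complex-linear functional \<open>\<lambda>\<close> on \<open>V\<close>.\<close>

definition deriv_fun :: "(complex^('n::finite) \<Rightarrow> complex) \<Rightarrow> 'n cpoly \<Rightarrow> 'n cpoly" where
  "deriv_fun l P = (\<Sum>i\<in>UNIV. Poly_Mapping.single 0 (l (axis i 1)) * pdiff i P)"

text \<open>
  Sending a \<open>B\<close>-orthonormal basis \<open>{v\<^sub>i}\<close> of \<open>V\<^sub>0\<close> to its dual basis \<open>{v\<^sub>i\<^sup>*}\<close> is the linear map
  \<open>v \<mapsto> B(v,\<cdot>)\<close>, because \<open>v\<^sub>i\<^sup>* = B(v\<^sub>i,\<cdot>)\<close>. So the operator of a polynomial is obtained by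
  replacing the \<open>i\<close>-th coordinate vector \<open>e\<^sub>i\<close> by \<open>\<partial>\<close> of \<open>B(e\<^sub>i,\<cdot>)\<close>; these operators commute, so
  the fold over the finite index type is their product.
\<close>

definition diff_op :: "('n::finite) hecke_datum \<Rightarrow> 'n cpoly \<Rightarrow> 'n cpoly \<Rightarrow> 'n cpoly" where
  "diff_op D P Q = (\<Sum>\<mu>\<in>Poly_Mapping.keys P. Poly_Mapping.single 0 (Poly_Mapping.lookup P \<mu>) *
     Finite_Set.fold
       (\<lambda>i. deriv_fun (cform D (axis i 1)) ^^ Poly_Mapping.lookup \<mu> i) Q UNIV)"

definition poly_form :: "('n::finite) hecke_datum \<Rightarrow> 'n cpoly \<Rightarrow> 'n cpoly \<Rightarrow> complex" where
  "poly_form D P Q = Poly_Mapping.lookup (diff_op D Q (Poly_Mapping.map cnj P)) 0"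


section \<open>The tensor product of a module with the polynomials\<close>

text \<open>
  \<open>M \<otimes> \<P>\<close> is the space of polynomials with coefficients in \<open>M\<close>: the element
  \<open>\<Sum>\<^sub>\<mu> m\<^sub>\<mu> \<otimes> x\<^sup>\<mu>\<close> is the finitely supported function \<open>\<mu> \<mapsto> m\<^sub>\<mu>\<close>. Accordingly
  \<open>N \<otimes> \<P>\<close> for a subspace \<open>N\<close> consists of the elements with all coefficients in \<open>N\<close>.
\<close>

type_synonym ('n, 'm) tens = "('n \<Rightarrow>\<^sub>0 nat) \<Rightarrow>\<^sub>0 'm"

definition pure_tensor :: "(complex \<Rightarrow> 'm \<Rightarrow> 'm) \<Rightarrow> 'm \<Rightarrow> 'n cpoly \<Rightarrow> ('n, 'm::zero) tens" where
  "pure_tensor sM m P = Poly_Mapping.map (\<lambda>c. sM c m) P"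

definition monom_poly :: "('n \<Rightarrow>\<^sub>0 nat) \<Rightarrow> 'n cpoly" where
  "monom_poly \<mu> = Poly_Mapping.single \<mu> 1"

definition tensor_op ::
    "(complex \<Rightarrow> 'm \<Rightarrow> 'm) \<Rightarrow> ('m \<Rightarrow> 'm) \<Rightarrow> ('n cpoly \<Rightarrow> 'n cpoly) \<Rightarrow>
     ('n, 'm) tens \<Rightarrow> ('n, 'm::ab_group_add) tens" where
  "tensor_op sM A L x = (\<Sum>\<mu>\<in>Poly_Mapping.keys x.
     pure_tensor sM (A (Poly_Mapping.lookup x \<mu>)) (L (monom_poly \<mu>)))"

definition tensor_form ::
    "('n::finite) hecke_datum \<Rightarrow> ('m \<Rightarrow> 'm \<Rightarrow> complex) \<Rightarrow>
     ('n, 'm::zero) tens \<Rightarrow> ('n, 'm) tens \<Rightarrow> complex" where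
  "tensor_form D f x y = (\<Sum>\<mu>\<in>Poly_Mapping.keys x. \<Sum>\<nu>\<in>Poly_Mapping.keys y.
     f (Poly_Mapping.lookup x \<mu>) (Poly_Mapping.lookup y \<nu>) *
     poly_form D (monom_poly \<mu>) (monom_poly \<nu>))"

definition tensor_sub :: "'m set \<Rightarrow> ('n, 'm::zero) tens set" where
  "tensor_sub N = {x. \<forall>\<mu>. Poly_Mapping.lookup x \<mu> \<in> N}"

text \<open>
  Elements of \<open>\<H> \<otimes> \<W>\<close> for the Weyl algebra \<open>\<W>\<close> enter only through their action: in
  \<open>\<W>\<close>, an element of \<open>V\<close> acts by multiplication and an element \<open>\<lambda>\<close> of the dual by \<open>\<partial>\<^sub>\<lambda>\<close>.
\<close>

definition D_minus ::
    "('n::finite) hecke_datum \<Rightarrow> (complex \<Rightarrow> 'm \<Rightarrow> 'm) \<Rightarrow> ('n hecke_free set \<Rightarrow> 'm \<Rightarrow> 'm) \<Rightarrow>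
     ('n \<Rightarrow> complex^'n) \<Rightarrow> ('n \<Rightarrow> complex^'n \<Rightarrow> complex) \<Rightarrow>
     ('n, 'm) tens \<Rightarrow> ('n, 'm::ab_group_add) tens" where
  "D_minus D sM \<pi> b bs x =
     (\<Sum>i\<in>UNIV. tensor_op sM (\<pi> (htilde D (b i))) (deriv_fun (bs i)) x)"

definition D_plus ::
    "('n::finite) hecke_datum \<Rightarrow> (complex \<Rightarrow> 'm \<Rightarrow> 'm) \<Rightarrow> ('n hecke_free set \<Rightarrow> 'm \<Rightarrow> 'm) \<Rightarrow>
     ('n \<Rightarrow> complex^'n) \<Rightarrow> ('n \<Rightarrow> complex^'n) \<Rightarrow>
     ('n, 'm) tens \<Rightarrow> ('n, 'm::ab_group_add) tens" where
  "D_plus D sM \<pi> b b' x =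
     (\<Sum>i\<in>UNIV. tensor_op sM (\<pi> (htilde D (b i))) (\<lambda>P. vec_poly (b' i) * P) x)"

text \<open>
  The sum below runs over ordered pairs of distinct positive roots. Its summand is symmetric in
  \<open>\<alpha>\<close> and \<open>\<beta>\<close>, so each unordered pair is counted twice, whence \<open>1/8\<close> instead of \<open>1/4\<close>.

  Sign: since \<open>[v~, w~] = - [T\<^sub>v, T\<^sub>w]\<close> with \<open>T\<^sub>v = v - v~\<close>, this operator satisfies
  \<open>D\<^sup>+ D\<^sup>- - D\<^sup>- D\<^sup>+ = - \<Omega> + \<Omega>\<^sub>W - \<E>\<close>.
\<close>

definition E_op ::
    "('n::finite) hecke_datum \<Rightarrow> (complex \<Rightarrow> 'm \<Rightarrow> 'm) \<Rightarrow> ('n hecke_free set \<Rightarrow> 'm \<Rightarrow> 'm) \<Rightarrow>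
     ('n, 'm) tens \<Rightarrow> ('n, 'm::ab_group_add) tens" where
  "E_op D sM \<pi> x = (\<Sum>(\<alpha>, \<beta>)\<in>{(\<alpha>, \<beta>). \<alpha> \<in> pos D \<and> \<beta> \<in> pos D \<and> \<alpha> \<noteq> \<beta>}.
     tensor_op sM
       (\<lambda>m. sM (1/8 * par D \<alpha> * par D \<beta>)
          (\<pi> (hW D (refl D \<alpha> \<circ> refl D \<beta>)) m - \<pi> (hW D (refl D \<beta> \<circ> refl D \<alpha>)) m))
       (\<lambda>P. vec_poly (cvec (iota D \<alpha>)) * deriv_fun (cfun \<beta>) P
          - vec_poly (cvec (iota D \<beta>)) * deriv_fun (cfun \<alpha>) P)
       x)"

end

theory Submission
  imports Defs "HOL-Computational_Algebra.Fundamental_Theorem_Algebra"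
begin

text \<open>
  For real \<open>v\<close> the adjoint of multiplication by \<open>v\<close> on polynomials is \<open>\<partial>\<close> of \<open>B(v,\<cdot>)\<close>, and the
  adjoint of \<open>v~\<close> on \<open>M\<close> is \<open>-v~\<close>. Hence \<open>D\<^sup>-\<close> is minus the adjoint of \<open>D\<^sup>+\<close>, and the left-hand side is
  the form of the commutator \<open>D\<^sup>+ D\<^sup>- - D\<^sup>- D\<^sup>+ = - \<Sum>\<^sub>i v\<^sub>i~ v\<^sup>i~ \<otimes> 1 + \<Sum>\<^sub>i\<^sub>j [v\<^sub>i~, v\<^sub>j~] \<otimes> v\<^sup>i \<partial>\<^sub>j\<close>.
  Both terms follow from \<open>v~ s\<^sub>\<beta> = s\<^sub>\<beta> (s\<^sub>\<beta> v)~\<close>, which is checked for simple \<open>\<beta>\<close> and extends to all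
  positive \<open>\<beta>\<close>: with \<open>T\<^sub>v = v - v~\<close> it makes \<open>[v~, T\<^sub>u]\<close> symmetric in \<open>u\<close> and \<open>v\<close>, so that
  \<open>[u~, v~] = - [T\<^sub>u, T\<^sub>v]\<close>, and it makes the mixed terms of \<open>\<Sum>\<^sub>i (v\<^sub>i~ + T\<^bsub>v\<^sub>i\<^esub>) (v\<^sup>i~ + T\<^bsub>v\<^sup>i\<^esub>)\<close> vanish,
  so that \<open>\<Sum>\<^sub>i v\<^sub>i~ v\<^sup>i~ = \<Omega> - \<Omega>\<^sub>W\<close>. The element \<open>\<Omega>\<close> is central, and \<open>\<Omega>\<^sub>W\<close> acts on \<open>\<sigma>\<close> by a scalar by
  Schur's lemma. These scalars need not be real, so \<open>\<Omega>\<close> and \<open>\<Omega>\<^sub>W\<close> are moved to the second, linear slot of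
  the form, but \<open>\<E>\<close> to the first one.
\<close>

section \<open>Polynomials and the pairing by differential operators\<close>

text \<open>Adjointness is available for real vectors only: the adjoint belonging to a complex v
  involves its conjugate, while the basis \<open>b\<close> of the statement is an arbitrary complex
  one. The double sums giving the two norms are therefore shown not to depend on the chosen dual
  bases, although they are conjugate-linear in one index and linear in the other, and are then
  evaluated on a real dual pair. Tensors are sums over monomials, so no commutator of operators on
  the whole space is formed: the identity is polarized to two pure tensors x \<otimes> P and y
  \<otimes> Q and summed at the end. The factor 1/2 in v~ is what makes it equivariant. Conjugation
  by a simple reflection permutes the positive roots other than \<alpha>, so the correction to T
  comes from the \<alpha>-summand alone, and its two halves add up to the constant
  \<open>par D \<alpha> * cfun \<alpha> v\<close> of the cross relation. Roots need not be
  crystallographic, so heights are real numbers and induction over positive roots has to count roots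
  instead. Neither M nor \<sigma> is assumed finite-dimensional; the eigenvector for Schur's lemma
  is found in the span of a single W-orbit.\<close>

lemma poly_mapping_sum_keys_add:
  assumes "\<And>k. F k 0 = 0" and "\<And>k a b. F k (a + b) = F k a + F k b"
  shows "(\<Sum>k\<in>Poly_Mapping.keys (p + q). F k (Poly_Mapping.lookup (p + q) k)) =
    (\<Sum>k\<in>Poly_Mapping.keys p. F k (Poly_Mapping.lookup p k)) +
    (\<Sum>k\<in>Poly_Mapping.keys q. F k (Poly_Mapping.lookup q k))"
  by (rule setsum_keys_plus_distrib) (use assms in auto)

lemma poly_mapping_sum_singles: "p = (\<Sum>k\<in>Poly_Mapping.keys p. Poly_Mapping.single k (Poly_Mapping.lookup p k))"
proof (rule poly_mapping_eqI)
  fix k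
  have "(\<Sum>j\<in>Poly_Mapping.keys p. Poly_Mapping.lookup (Poly_Mapping.single j (Poly_Mapping.lookup p j)) k)
     = (\<Sum>j\<in>Poly_Mapping.keys p. if j = k then Poly_Mapping.lookup p k else 0)"
    by (intro sum.cong) (auto simp: lookup_single when_def)
  then show "Poly_Mapping.lookup p k =
    Poly_Mapping.lookup (\<Sum>k\<in>Poly_Mapping.keys p. Poly_Mapping.single k (Poly_Mapping.lookup p k)) k"
    by (simp add: lookup_sum in_keys_iff)
qed

lemma poly_mapping_induct_single:
  fixes p :: "'a \<Rightarrow>\<^sub>0 'b::comm_monoid_add"
  assumes "P 0" and "\<And>k c. P (Poly_Mapping.single k c)" and "\<And>p q. P p \<Longrightarrow> P q \<Longrightarrow> P (p + q)"
  shows "P p"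
proof -
  have "P (\<Sum>k\<in>K. Poly_Mapping.single k (Poly_Mapping.lookup p k))" if "finite K" for K
    using that by (induction K) (auto intro: assms)
  then show ?thesis using poly_mapping_sum_singles[of p] finite_keys[of p] by metis
qed

abbreviation const :: "complex \<Rightarrow> 'n cpoly" where "const c \<equiv> Poly_Mapping.single 0 c"

definition var :: "'n \<Rightarrow> 'n cpoly" where "var i = Poly_Mapping.single (Poly_Mapping.single i 1) 1"

lemma const_mult_const: "const a * const b = const (a * b)"
  by (simp add: mult_single)

lemma const_mult_single: "const a * Poly_Mapping.single \<mu> b = Poly_Mapping.single \<mu> (a * b)"
  by (simp add: mult_single)

lemma lookup_const_mult: "Poly_Mapping.lookup (const c * P) \<mu> = c * Poly_Mapping.lookup P \<mu>"
proof (induction P rule: poly_mapping_induct_single)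
  case (2 k d)
  then show ?case by (simp add: mult_single lookup_single mult_when)
qed (auto simp: lookup_add ring_distribs)

lemma lookup_var_mult_0: "Poly_Mapping.lookup (var i * P) 0 = 0"
proof (induction P rule: poly_mapping_induct_single)
  case (2 k c)
  have "Poly_Mapping.single i 1 + k \<noteq> (0 :: 'a \<Rightarrow>\<^sub>0 nat)"
  proof
    assume "Poly_Mapping.single i 1 + k = (0 :: 'a \<Rightarrow>\<^sub>0 nat)"
    then have "Poly_Mapping.lookup (Poly_Mapping.single i 1 + k) i = (0::nat)" by simp
    then show False by (simp add: lookup_add)
  qed
  then show ?case by (simp add: var_def mult_single lookup_single)
qed (auto simp: lookup_add ring_distribs)

lemma monomial_induct:
  assumes "P 0" and "\<And>i \<mu>. P \<mu> \<Longrightarrow> P (Poly_Mapping.single i 1 + \<mu>)"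
  shows "P (\<mu> :: 'n \<Rightarrow>\<^sub>0 nat)"
proof (induction \<mu> rule: poly_mapping_induct_single)
  case (3 p q)
  have *: "P (Poly_Mapping.single i m + \<nu>)" if "P \<nu>" for i m \<nu>
  proof (induction m)
    case (Suc m)
    have "Poly_Mapping.single i (Suc m) = Poly_Mapping.single i 1 + Poly_Mapping.single i m"
      by (simp flip: single_add)
    then show ?case using Suc assms(2) by (simp add: add.assoc)
  qed (use that in simp)
  have "P (r + \<nu>)" if "P \<nu>" for r \<nu>
    using that by (induction r arbitrary: \<nu> rule: poly_mapping_induct_single) (auto simp: * add.assoc)
  then show ?case using 3 by simp
next
  case (2 k c)
  have "P (Poly_Mapping.single k c)" for k c
  proof (induction c)
    case (Suc c)
    have "Poly_Mapping.single k (Suc c) = Poly_Mapping.single k 1 + Poly_Mapping.single k c"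
      by (simp flip: single_add)
    then show ?case using Suc assms(2) by simp
  qed (use assms in simp)
  then show ?case .
qed (use assms in auto)

text \<open>Operators built from derivations are known on constants and through their commutation
  rule with a variable, so most identities below follow from this induction without explicit
  exponents.\<close>

lemma cpoly_induct [case_names const add var]:
  fixes P :: "'n cpoly"
  assumes const: "\<And>c. Q (const c)" and add: "\<And>P P'. Q P \<Longrightarrow> Q P' \<Longrightarrow> Q (P + P')"
    and var: "\<And>i P. Q P \<Longrightarrow> Q (var i * P)"
  shows "Q P"
proof (induction P rule: poly_mapping_induct_single)
  case 1 show ?case using const[of 0] by simp
next
  case (2 \<mu> c)
  show ?case
  proof (induction \<mu> rule: monomial_induct)
    case 1 show ?case by (rule const)
  next
    case (2 i \<mu>)
    then show ?case using var[of "Poly_Mapping.single \<mu> c" i] by (simp add: var_def mult_single)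
  qed
qed (rule add)

section \<open>Partial derivatives and the derivations of linear functionals\<close>

lemma pdiff_single:
  "pdiff i (Poly_Mapping.single \<mu> c) =
    Poly_Mapping.single (\<mu> - Poly_Mapping.single i 1) (of_nat (Poly_Mapping.lookup \<mu> i) * c)"
  by (cases "c = 0") (simp_all add: pdiff_def)

lemma pdiff_add: "pdiff i (P + Q) = pdiff i P + pdiff i Q"
  unfolding pdiff_def by (rule poly_mapping_sum_keys_add) (auto simp: ring_distribs single_add)

lemma pdiff_const: "pdiff i (const c) = 0"
  by (simp add: pdiff_single)

lemma pdiff_0: "pdiff i 0 = 0"
  by (simp add: pdiff_def)

lemma pdiff_const_mult: "pdiff i (const c * P) = const c * pdiff i P"
  by (induction P rule: poly_mapping_induct_single)
    (auto simp: pdiff_single const_mult_single pdiff_add ring_distribs pdiff_0 mult.left_commute)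

lemma pdiff_var_mult: "pdiff i (var j * P) = (if i = j then P else 0) + var j * pdiff i P"
proof (induction P rule: poly_mapping_induct_single)
  case (2 \<mu> c)
  show ?case
  \<comment> \<open>Subtraction of exponents is truncated, so lowering the exponent of
    \<open>i\<close> and raising it again restores the monomial only if \<open>i\<close> occurs in
    it. If it does not, the vanishing coefficient removes the affected term.\<close>
  proof (cases "Poly_Mapping.lookup \<mu> i = 0")
    case True
    then show ?thesis
      by (auto simp: var_def mult_single pdiff_single lookup_add lookup_single)
  next
    case False
    have "Poly_Mapping.single j 1 + \<mu> - Poly_Mapping.single i 1 =
      Poly_Mapping.single j 1 + (\<mu> - Poly_Mapping.single i 1)"
      using False by (intro poly_mapping_eqI) (auto simp: lookup_add lookup_minus lookup_single when_def)
    moreover have "Poly_Mapping.single i 1 + (\<mu> - Poly_Mapping.single i 1) = \<mu>"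
      using False by (intro poly_mapping_eqI) (auto simp: lookup_add lookup_minus lookup_single when_def)
    ultimately show ?thesis
      by (auto simp: var_def mult_single pdiff_single lookup_add lookup_single ring_distribs single_add)
  qed
qed (auto simp: pdiff_add ring_distribs pdiff_0)

lemma deriv_fun_0 [simp]: "deriv_fun l 0 = 0"
  by (simp add: deriv_fun_def pdiff_0)

lemma deriv_fun_add: "deriv_fun l (P + Q) = deriv_fun l P + deriv_fun l Q"
  by (simp add: deriv_fun_def pdiff_add ring_distribs sum.distrib)

lemma deriv_fun_const [simp]: "deriv_fun l (const c) = 0"
  by (simp add: deriv_fun_def pdiff_const)

lemma deriv_fun_const_mult: "deriv_fun l (const c * P) = const c * deriv_fun l P"
  by (simp add: deriv_fun_def pdiff_const_mult sum_distrib_left mult.left_commute)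

lemma deriv_fun_sum: "deriv_fun l (\<Sum>i\<in>A. f i) = (\<Sum>i\<in>A. deriv_fun l (f i))"
  by (induction A rule: infinite_finite_induct) (auto simp: deriv_fun_add)

lemma deriv_fun_var_mult:
  "deriv_fun l (var j * P) = const (l (axis j 1)) * P + var j * deriv_fun l P"
proof -
  have "deriv_fun l (var j * P) =
    (\<Sum>i\<in>UNIV. (if i = j then const (l (axis i 1)) * P else 0) + var j * (const (l (axis i 1)) * pdiff i P))"
    unfolding deriv_fun_def pdiff_var_mult by (intro sum.cong) (auto simp: ring_distribs mult.left_commute)
  then show ?thesis by (simp add: sum.distrib deriv_fun_def sum_distrib_left)
qed

lemma deriv_fun_commute: "deriv_fun l (deriv_fun l' P) = deriv_fun l' (deriv_fun l P)"
  by (induction P rule: cpoly_induct)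
    (auto simp: deriv_fun_add deriv_fun_var_mult deriv_fun_const_mult)

lemma vec_poly_eq: "vec_poly v = (\<Sum>i\<in>UNIV. const (v $ i) * var i)"
  by (simp add: vec_poly_def var_def const_mult_single)

lemma vec_poly_add: "vec_poly (u + v) = vec_poly u + vec_poly v"
  by (simp add: vec_poly_def sum.distrib single_add)

lemma vec_poly_scale: "vec_poly (c *s v) = const c * vec_poly v"
  by (simp add: vec_poly_def sum_distrib_left const_mult_single)

lemma const_sum: "const (\<Sum>i\<in>A. f i) = (\<Sum>i\<in>A. const (f i))"
  by (induction A rule: infinite_finite_induct) (auto simp: single_add)

text \<open>The defining relation of the Weyl algebra in its action on polynomials. Linearity of
  \<open>l\<close> reassembles its values on the coordinate vectors into \<open>l v\<close>.\<close>

lemma deriv_fun_vec_poly_mult: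
  assumes "Vector_Spaces.linear (*s) (*) l"
  shows "deriv_fun l (vec_poly v * P) = const (l v) * P + vec_poly v * deriv_fun l P"
proof -
  interpret Vector_Spaces.linear "(*s)" "(*)" l by fact
  have "l v = l (\<Sum>i\<in>UNIV. v $ i *s axis i 1)"
    by (simp add: basis_expansion)
  then have "(const (l v) :: 'a cpoly) = (\<Sum>i\<in>UNIV. const (v $ i * l (axis i 1)))"
    by (simp add: sum scale const_sum)
  moreover have "deriv_fun l (vec_poly v * P) =
    (\<Sum>i\<in>UNIV. const (v $ i * l (axis i 1)) * P + const (v $ i) * (var i * deriv_fun l P))"
    by (simp add: vec_poly_eq sum_distrib_right mult.assoc deriv_fun_sum deriv_fun_const_mult
        deriv_fun_var_mult ring_distribs const_mult_const flip: mult.assoc[of "const _" "const _"])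
  ultimately show ?thesis
    by (simp only: sum.distrib sum_distrib_right vec_poly_eq mult.assoc)
qed

section \<open>Polynomials as constant-coefficient differential operators\<close>

lemma fold_insert_commute:
  assumes "comp_fun_commute g" and "finite A" and "x \<notin> A"
  shows "Finite_Set.fold g z (insert x A) = g x (Finite_Set.fold g z A)"
proof -
  interpret comp_fun_commute g by fact
  show ?thesis by (rule fold_insert) (use assms in auto)
qed

lemma fold_commute_left:
  assumes "finite A" and "comp_fun_commute g" and "\<And>i z. h (g i z) = g i (h z)"
  shows "h (Finite_Set.fold g z A) = Finite_Set.fold g (h z) A"
  using assms(1)
  by (induction A) (simp_all add: assms fold_insert_commute[OF assms(2)])

text \<open>The bilinear pairing behind \<open>poly_form\<close>. Leaving out the conjugation makes
  symmetry and adjointness accessible to induction over all complex polynomials;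
  \<open>poly_form_eq\<close> puts it back.\<close>

definition cpair :: "('n::finite) hecke_datum \<Rightarrow> 'n cpoly \<Rightarrow> 'n cpoly \<Rightarrow> complex" where
  "cpair D P Q = Poly_Mapping.lookup (diff_op D Q P) 0"

abbreviation dform :: "('n::finite) hecke_datum \<Rightarrow> complex^'n \<Rightarrow> 'n cpoly \<Rightarrow> 'n cpoly" where
  "dform D v \<equiv> deriv_fun (cform D v)"

lemma diff_op_add: "diff_op D (P + P') Q = diff_op D P Q + diff_op D P' Q"
  unfolding diff_op_def by (rule poly_mapping_sum_keys_add) (auto simp: single_add ring_distribs)

lemma diff_op_single:
  "diff_op D (Poly_Mapping.single \<mu> c) Q =
    const c * Finite_Set.fold (\<lambda>i. dform D (axis i 1) ^^ Poly_Mapping.lookup \<mu> i) Q UNIV"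
  by (cases "c = 0") (simp_all add: diff_op_def)

lemma funpow_commute_pointwise:
  assumes "\<And>x. g (h x) = h (g x)"
  shows "g ((h ^^ n) x) = (h ^^ n) (g x)"
  by (induction n) (simp_all add: assms)

lemma comp_fun_commute_dform: "comp_fun_commute (\<lambda>i. dform D (axis i 1) ^^ Poly_Mapping.lookup \<mu> i)"
  by unfold_locales
    (auto simp: fun_eq_iff intro!: funpow_commute_pointwise funpow_commute_pointwise[symmetric] deriv_fun_commute)

lemma dform_fold:
  "dform D v (Finite_Set.fold (\<lambda>i. dform D (axis i 1) ^^ Poly_Mapping.lookup \<mu> i) Q A) =
    Finite_Set.fold (\<lambda>i. dform D (axis i 1) ^^ Poly_Mapping.lookup \<mu> i) (dform D v Q) A"
  by (rule fold_commute_left)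
    (auto simp: comp_fun_commute_dform intro: funpow_commute_pointwise deriv_fun_commute)

text \<open>In the commuting product of derivations only the factor with index \<open>i\<close>
  gains a power. Peeling this factor off the fold exposes the extra derivation, which then moves
  through the product to act on \<open>Q\<close> first.\<close>

lemma diff_op_var_mult: "diff_op D (var i * P) Q = diff_op D P (dform D (axis i 1) Q)"
proof (induction P rule: poly_mapping_induct_single)
  case (2 \<mu> c)
  let ?g = "\<lambda>\<mu> i. dform D (axis i 1) ^^ Poly_Mapping.lookup \<mu> i"
  let ?\<nu> = "Poly_Mapping.single i 1 + \<mu>"
  have U: "UNIV = insert i (UNIV - {i})" by auto
  have \<nu>: "Poly_Mapping.lookup ?\<nu> i = Suc (Poly_Mapping.lookup \<mu> i)"
    by (simp add: lookup_add)
  have g: "Finite_Set.fold (?g \<nu>) z UNIV = ?g \<nu> i (Finite_Set.fold (?g \<nu>) z (UNIV - {i}))" for \<nu> z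
    by (subst U, rule fold_insert_commute[OF comp_fun_commute_dform]) auto
  have "Finite_Set.fold (?g ?\<nu>) Q (UNIV - {i}) = Finite_Set.fold (?g \<mu>) Q (UNIV - {i})"
    by (rule Finite_Set.fold_cong[OF comp_fun_commute_dform[unfolded comp_fun_commute_def']
          comp_fun_commute_dform[unfolded comp_fun_commute_def']])
      (auto simp: lookup_add lookup_single)
  then have "Finite_Set.fold (?g ?\<nu>) Q UNIV = dform D (axis i 1) (Finite_Set.fold (?g \<mu>) Q UNIV)"
    unfolding g[of ?\<nu>] g[of \<mu>] by (simp only: \<nu> funpow.simps comp_apply)
  then show ?case
    by (simp add: var_def mult_single diff_op_single dform_fold)
qed (auto simp: diff_op_add ring_distribs diff_op_def[of _ 0])

lemma fold_ident: "finite A \<Longrightarrow> Finite_Set.fold (\<lambda>i a. a) z A = z"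
  by (induction A rule: finite_induct) (simp_all add: fold_insert_commute comp_fun_commute_def)

lemma cpair_const [simp]: "cpair D P (const c) = c * Poly_Mapping.lookup P 0"
  by (simp add: cpair_def diff_op_single fold_ident lookup_const_mult id_def)

lemma cpair_add_right: "cpair D P (Q + Q') = cpair D P Q + cpair D P Q'"
  by (simp add: cpair_def diff_op_add lookup_add)

lemma cpair_var_right: "cpair D P (var i * Q) = cpair D (dform D (axis i 1) P) Q"
  by (simp add: cpair_def diff_op_var_mult)

lemma cpair_add_left: "cpair D (P + P') Q = cpair D P Q + cpair D P' Q"
  by (induction Q arbitrary: P P' rule: cpoly_induct)
    (simp_all add: lookup_add ring_distribs cpair_add_right cpair_var_right deriv_fun_add)

lemma cpair_const_mult_left: "cpair D (const c * P) Q = c * cpair D P Q"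
  by (induction Q arbitrary: P rule: cpoly_induct)
    (simp_all add: lookup_const_mult ring_distribs cpair_add_right cpair_var_right deriv_fun_const_mult)

lemma cpair_const_mult_right: "cpair D P (const c * Q) = c * cpair D P Q"
  by (induction Q arbitrary: P rule: cpoly_induct)
    (simp_all add: const_mult_const ring_distribs cpair_add_right cpair_var_right mult.left_commute[of "const _"])

lemma cpair_0_left [simp]: "cpair D 0 Q = 0"
  using cpair_const_mult_left[of D 0 0 Q] by simp

lemma cpair_0_right [simp]: "cpair D P 0 = 0"
  using cpair_const[of D P 0] by simp

lemma cform_axis: "cform D (axis i 1) (axis j 1) = complex_of_real (form D (axis i 1) (axis j 1))"
proof -
  have "cform D (axis i 1) (axis j 1) = (\<Sum>k\<in>UNIV. \<Sum>l\<in>UNIV. if l = j then (if k = i then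
     complex_of_real (form D (axis k 1) (axis l 1)) else 0) else 0)"
    unfolding cform_def by (intro sum.cong) (auto simp: axis_def)
  then show ?thesis by simp
qed

lemma cform_add_left: "cform D (u + v) w = cform D u w + cform D v w"
  by (simp add: cform_def ring_distribs sum.distrib)

lemma cform_scale_left: "cform D (c *s u) w = c * cform D u w"
  by (simp add: cform_def sum_distrib_left mult.assoc)

lemma cform_add_right: "cform D w (u + v) = cform D w u + cform D w v"
  by (simp add: cform_def ring_distribs sum.distrib)

lemma cform_scale_right: "cform D w (c *s u) = c * cform D w u"
  by (simp add: cform_def sum_distrib_left mult_ac)

lemma dform_eq: "dform D v P = (\<Sum>i\<in>UNIV. const (v $ i) * dform D (axis i 1) P)"
proof -
  have "cform D v w = (\<Sum>i\<in>UNIV. v $ i * cform D (axis i 1) w)" for w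
  proof -
    have "cform D v w = cform D (\<Sum>i\<in>UNIV. v $ i *s axis i 1) w"
      by (simp add: basis_expansion)
    also have "\<dots> = (\<Sum>i\<in>UNIV. v $ i * cform D (axis i 1) w)"
    proof -
      have "cform D (\<Sum>i\<in>A. v $ i *s axis i 1) w = (\<Sum>i\<in>A. v $ i * cform D (axis i 1) w)" for A
        by (induction A rule: infinite_finite_induct)
          (simp_all add: cform_add_left cform_scale_left, simp_all add: cform_def)
      then show ?thesis .
    qed
    finally show ?thesis .
  qed
  then show ?thesis
    unfolding deriv_fun_def
    by (simp add: const_sum sum_distrib_left sum_distrib_right mult.assoc flip: const_mult_const)
      (rule sum.swap)
qed

context
  fixes D :: "('n::finite) hecke_datum"
  assumes form_sym: "\<And>u v. form D u v = form D v u"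
begin

lemma cform_commute: "cform D u v = cform D v u"
  unfolding cform_def by (subst sum.swap) (simp add: form_sym mult_ac)

text \<open>Constants agree because \<open>var i * P\<close> has no constant term. In the induction
  step each side produces one commutator, B(e_j, e_i) on the left and B(e_i, e_j) on the right, and
  symmetry of the form makes them equal.\<close>

lemma cpair_var_left: "cpair D (var i * P) Q = cpair D P (dform D (axis i 1) Q)"
proof (induction Q arbitrary: P rule: cpoly_induct)
  case (const c)
  then show ?case by (simp add: lookup_var_mult_0)
next
  case (var j Q)
  have "cpair D (var i * P) (var j * Q) =
    cform D (axis j 1) (axis i 1) * cpair D P Q + cpair D (var i * dform D (axis j 1) P) Q"
    by (simp add: cpair_var_right deriv_fun_var_mult cpair_add_left cpair_const_mult_left)
  also have "cpair D (var i * dform D (axis j 1) P) Q = cpair D P (var j * dform D (axis i 1) Q)"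
    by (simp add: var cpair_var_right)
  finally show ?case
    by (simp add: deriv_fun_var_mult cpair_add_right cpair_const_mult_right cform_commute[of "axis i 1" "axis j 1"])
qed (simp add: deriv_fun_add cpair_add_right)

lemma cpair_commute: "cpair D P Q = cpair D Q P"
proof (induction Q arbitrary: P rule: cpoly_induct)
  case (const c)
  show ?case
    by (induction P rule: cpoly_induct)
      (simp_all add: lookup_add ring_distribs cpair_add_right cpair_var_right lookup_var_mult_0)
next
  case (add Q Q')
  then show ?case by (simp add: cpair_add_left cpair_add_right)
next
  case (var i Q)
  then show ?case by (simp add: cpair_var_left cpair_var_right)
qed

lemma cpair_vec_poly_right: "cpair D P (vec_poly v * Q) = cpair D (dform D v P) Q"
proof -
  have "cpair D P (\<Sum>i\<in>A. const (v $ i) * (var i * Q)) =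
    cpair D (\<Sum>i\<in>A. const (v $ i) * dform D (axis i 1) P) Q" for A
    by (induction A rule: infinite_finite_induct)
      (simp_all add: cpair_add_left cpair_add_right cpair_const_mult_left cpair_const_mult_right cpair_var_right)
  from this[of UNIV] show ?thesis
    by (simp add: vec_poly_eq dform_eq[of D v] sum_distrib_right mult.assoc)
qed

end

section \<open>Conjugation of polynomials and the hermitian form\<close>

abbreviation conj_poly :: "'n cpoly \<Rightarrow> 'n cpoly" where "conj_poly \<equiv> Poly_Mapping.map cnj"

lemma lookup_conj_poly [simp]: "Poly_Mapping.lookup (conj_poly P) \<mu> = cnj (Poly_Mapping.lookup P \<mu>)"
  by transfer (simp add: when_def)

lemma conj_poly_add: "conj_poly (P + Q) = conj_poly P + conj_poly Q"
  by (rule poly_mapping_eqI) (simp add: lookup_add)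

lemma conj_poly_involution [simp]: "conj_poly (conj_poly P) = P"
  by (rule poly_mapping_eqI) simp

lemma conj_poly_const [simp]: "conj_poly (const c) = const (cnj c)"
  by simp

lemma conj_poly_0 [simp]: "conj_poly 0 = 0"
  by (rule poly_mapping_eqI) simp

lemma conj_poly_single_mult:
  "conj_poly (Poly_Mapping.single \<mu> c * P) = Poly_Mapping.single \<mu> (cnj c) * conj_poly P"
  by (induction P rule: poly_mapping_induct_single)
    (simp_all add: mult_single ring_distribs conj_poly_add)

lemma conj_poly_var_mult: "conj_poly (var i * P) = var i * conj_poly P"
  by (simp add: var_def conj_poly_single_mult)

lemma conj_poly_const_mult: "conj_poly (const c * P) = const (cnj c) * conj_poly P"
  by (rule conj_poly_single_mult)

lemma conj_poly_dform_axis: "conj_poly (dform D (axis i 1) P) = dform D (axis i 1) (conj_poly P)"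
  by (induction P rule: cpoly_induct)
    (simp_all add: deriv_fun_add conj_poly_add conj_poly_var_mult conj_poly_const_mult deriv_fun_var_mult cform_axis)

lemma conj_poly_sum: "conj_poly (\<Sum>i\<in>A. f i) = (\<Sum>i\<in>A. conj_poly (f i))"
  by (induction A rule: infinite_finite_induct) (auto simp: conj_poly_add)

text \<open>The coordinates of a real vector and the values of B on coordinate vectors survive
  conjugation. For complex v the derivation of the conjugate vector would appear; this is what
  confines the adjunction below to real vectors.\<close>

lemma conj_poly_dform: "conj_poly (dform D (cvec v) P) = dform D (cvec v) (conj_poly P)"
  by (subst (1 2) dform_eq) (simp add: conj_poly_sum conj_poly_const_mult conj_poly_dform_axis cvec_def)

lemma cpair_conj_poly: "cpair D (conj_poly P) (conj_poly Q) = cnj (cpair D P Q)"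
  by (induction Q arbitrary: P rule: cpoly_induct)
    (simp_all add: conj_poly_add cpair_add_right conj_poly_var_mult cpair_var_right
      flip: conj_poly_dform_axis)

lemma poly_form_eq: "poly_form D P Q = cpair D (conj_poly P) Q"
  by (simp add: poly_form_def cpair_def)

lemma poly_form_add_left: "poly_form D (P + P') Q = poly_form D P Q + poly_form D P' Q"
  by (simp add: poly_form_eq conj_poly_add cpair_add_left)

lemma poly_form_add_right: "poly_form D P (Q + Q') = poly_form D P Q + poly_form D P Q'"
  by (simp add: poly_form_eq cpair_add_right)

lemma poly_form_const_mult_left: "poly_form D (const c * P) Q = cnj c * poly_form D P Q"
  by (simp add: poly_form_eq conj_poly_const_mult cpair_const_mult_left)

lemma poly_form_const_mult_right: "poly_form D P (const c * Q) = c * poly_form D P Q"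
  by (simp add: poly_form_eq cpair_const_mult_right)

lemma poly_form_0_left [simp]: "poly_form D 0 Q = 0"
  by (simp add: poly_form_eq)

lemma poly_form_0_right [simp]: "poly_form D P 0 = 0"
  by (simp add: poly_form_eq)

context
  fixes D :: "('n::finite) hecke_datum"
  assumes form_sym: "\<And>u v. form D u v = form D v u"
begin

lemma poly_form_hermitian: "poly_form D P Q = cnj (poly_form D Q P)"
  using cpair_conj_poly[of D "conj_poly P" Q] cpair_commute[OF form_sym, of "conj_poly Q" P]
  by (simp add: poly_form_eq)

lemma poly_form_vec_poly_right:
  "poly_form D P (vec_poly (cvec v) * Q) = poly_form D (dform D (cvec v) P) Q"
  by (simp add: poly_form_eq cpair_vec_poly_right[OF form_sym] conj_poly_dform)

lemma poly_form_vec_poly_left: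
  "poly_form D (vec_poly (cvec v) * P) Q = poly_form D P (dform D (cvec v) Q)"
  using poly_form_vec_poly_right[of Q v P] poly_form_hermitian by metis

end

section \<open>Root data\<close>

lemma cvec_scaleR: "cvec (r *\<^sub>R v) = complex_of_real r *s cvec v"
  by (simp add: cvec_def vec_eq_iff)

lemma cvec_uminus: "cvec (- v) = - cvec v"
  by (simp add: cvec_def vec_eq_iff)

lemma cvec_diff: "cvec (u - v) = cvec u - cvec v"
  by (simp add: cvec_def vec_eq_iff)

lemma cvec_0 [simp]: "cvec 0 = 0"
  by (simp add: cvec_def vec_eq_iff)

lemma cvec_axis: "cvec (axis i 1) = axis i 1"
  by (simp add: cvec_def vec_eq_iff axis_def)

lemma cvec_Re_Im: "v = cvec (\<chi> i. Re (v $ i)) + \<i> *s cvec (\<chi> i. Im (v $ i))"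
  by (simp add: cvec_def vec_eq_iff complex_eq)

lemma cfun_add: "cfun \<alpha> (u + v) = cfun \<alpha> u + cfun \<alpha> v"
  by (simp add: cfun_def ring_distribs sum.distrib)

lemma cfun_scale: "cfun \<alpha> (c *s v) = c * cfun \<alpha> v"
  by (simp add: cfun_def sum_distrib_left mult.assoc)

lemma linear_cfun: "Vector_Spaces.linear (*s) (*) (cfun \<alpha>)"
  by unfold_locales (auto simp: cfun_add cfun_scale vector_space_over_itself.scale_right_distrib ring_distribs mult.assoc)

lemma cfun_cvec: "cfun \<alpha> (cvec v) = complex_of_real (blinfun_apply \<alpha> v)"
proof -
  have "blinfun_apply \<alpha> v = blinfun_apply \<alpha> (\<Sum>i\<in>UNIV. v $ i *\<^sub>R axis i 1)"
    using basis_expansion[of v] by (simp add: scalar_mult_eq_scaleR)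
  then show ?thesis by (simp add: cfun_def cvec_def blinfun.sum_right blinfun.scaleR_right)
qed

lemma linear_cform: "Vector_Spaces.linear (*s) (*) (cform D u)"
  by unfold_locales (auto simp: cform_add_right cform_scale_right ring_distribs mult.assoc)

lemma cfun_sum: "cfun \<alpha> (\<Sum>i\<in>A. f i) = (\<Sum>i\<in>A. cfun \<alpha> (f i))"
proof -
  interpret Vector_Spaces.linear "(*s)" "(*)" "cfun \<alpha>" by (rule linear_cfun)
  show ?thesis by (rule sum)
qed

lemma cform_sum_right: "cform D u (\<Sum>i\<in>A. f i) = (\<Sum>i\<in>A. cform D u (f i))"
proof -
  interpret Vector_Spaces.linear "(*s)" "(*)" "cform D u" by (rule linear_cform)
  show ?thesis by (rule sum)
qed

lemma cform_diff_right: "cform D u (v - w) = cform D u v - cform D u w"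
  using cform_add_right[of D u v "- 1 *s w"] by (simp only: cform_scale_right) simp

lemma cform_diff_left: "cform D (v - w) u = cform D v u - cform D w u"
  using cform_add_left[of D v "- 1 *s w" u] by (simp only: cform_scale_left) simp

locale root_datum =
  fixes D :: "('n::finite) hecke_datum"
  assumes valid: "valid_datum D"
begin

lemma bilinear_form: "bilinear (form D)"
  and form_sym: "form D u v = form D v u"
  and form_pos: "v \<noteq> 0 \<Longrightarrow> 0 < form D v v"
  and form_weyl: "w \<in> weyl D \<Longrightarrow> form D (w u) (w v) = form D u v"
  using valid by (auto simp: valid_datum_def invariant_form_def)

lemmas form_simps =
  bilinear_ladd[OF bilinear_form] bilinear_radd[OF bilinear_form] bilinear_lmul[OF bilinear_form]
  bilinear_rmul[OF bilinear_form] bilinear_lneg[OF bilinear_form] bilinear_rneg[OF bilinear_form]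
  bilinear_lsub[OF bilinear_form] bilinear_rsub[OF bilinear_form]
  bilinear_lzero[OF bilinear_form] bilinear_rzero[OF bilinear_form]

lemma form_nonneg: "0 \<le> form D v v"
  using form_pos[of v] by (cases "v = 0") (auto simp: form_simps)

lemma form_eqI:
  assumes "\<And>w. form D u w = form D v w"
  shows "u = v"
proof (rule ccontr)
  assume "u \<noteq> v"
  then have "0 < form D (u - v) (u - v)" by (intro form_pos) simp
  then show False using assms by (simp add: form_simps)
qed

lemma finite_roots: "finite (roots D)"
  and root_coroot: "\<alpha> \<in> roots D \<Longrightarrow> blinfun_apply \<alpha> (coroot D \<alpha>) = 2"
  and root_reflect: "\<alpha> \<in> roots D \<Longrightarrow> \<beta> \<in> roots D \<Longrightarrow> \<beta> - blinfun_apply \<beta> (coroot D \<alpha>) *\<^sub>R \<alpha> \<in> roots D"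
  and coroot_reflect: "\<alpha> \<in> roots D \<Longrightarrow> \<beta> \<in> roots D \<Longrightarrow> refl D \<alpha> (coroot D \<beta>) \<in> coroot D ` roots D"
  and roots_reduced: "\<alpha> \<in> roots D \<Longrightarrow> c *\<^sub>R \<alpha> \<in> roots D \<Longrightarrow> c = 1 \<or> c = -1"
  using valid by (auto simp: valid_datum_def root_system_def)

lemma roots_eq: "roots D = pos D \<union> uminus ` pos D"
  and pos_disjoint: "pos D \<inter> uminus ` pos D = {}"
  and simple_pos: "\<alpha> \<in> simple D \<Longrightarrow> \<alpha> \<in> pos D"
  and independent_simple: "independent (simple D)"
  and pos_combination:
    "\<alpha> \<in> pos D \<Longrightarrow> \<exists>c. (\<forall>\<beta>\<in>simple D. 0 \<le> c \<beta>) \<and> \<alpha> = (\<Sum>\<beta>\<in>simple D. c \<beta> *\<^sub>R \<beta>)"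
  using valid by (auto simp: valid_datum_def positive_system_def)

lemma pos_roots: "\<alpha> \<in> pos D \<Longrightarrow> \<alpha> \<in> roots D"
  by (simp add: roots_eq)

lemma finite_pos [simp]: "finite (pos D)"
  using finite_roots by (simp add: roots_eq)

lemma finite_simple [simp]: "finite (simple D)"
  by (rule finite_subset[OF _ finite_pos]) (auto intro: simple_pos)

lemma refl_weyl: "\<alpha> \<in> roots D \<Longrightarrow> refl D \<alpha> \<in> weyl D"
  using weyl_refl[OF weyl_id, of \<alpha> D] by simp

lemma refl_refl [simp]: "\<alpha> \<in> roots D \<Longrightarrow> refl D \<alpha> (refl D \<alpha> v) = v"
  by (simp add: refl_def blinfun.diff_right blinfun.scaleR_right root_coroot algebra_simps)

text \<open>The reflection is an isometry that negates its coroot, so B(coroot, v) = -B(coroot, s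
  v). Expanding s v shows that \<alpha> is proportional to B(coroot, .), which makes
  \<open>iota\<close> explicit.\<close>

lemma form_coroot:
  assumes "\<alpha> \<in> roots D"
  shows "2 * form D (coroot D \<alpha>) v = form D (coroot D \<alpha>) (coroot D \<alpha>) * blinfun_apply \<alpha> v"
proof -
  have "refl D \<alpha> (coroot D \<alpha>) = - coroot D \<alpha>"
    using assms by (simp add: refl_def root_coroot scaleR_2)
  then have "form D (coroot D \<alpha>) v = form D (- coroot D \<alpha>) (refl D \<alpha> v)"
    using form_weyl[OF refl_weyl[OF assms], of "coroot D \<alpha>" v] by simp
  then show ?thesis by (simp add: refl_def form_simps algebra_simps)
qed

lemma form_coroot_pos:
  assumes "\<alpha> \<in> roots D"
  shows "0 < form D (coroot D \<alpha>) (coroot D \<alpha>)"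
  using root_coroot[OF assms] by (intro form_pos) auto

lemma iota_eqI: "(\<And>v. form D u v = blinfun_apply \<alpha> v) \<Longrightarrow> iota D \<alpha> = u"
  unfolding iota_def by (rule the_equality) (auto intro: form_eqI)

lemma iota_coroot:
  assumes "\<alpha> \<in> roots D"
  shows "iota D \<alpha> = (2 / form D (coroot D \<alpha>) (coroot D \<alpha>)) *\<^sub>R coroot D \<alpha>"
  using form_coroot[OF assms] form_coroot_pos[OF assms]
  by (intro iota_eqI) (simp add: form_simps field_simps)

lemma form_iota: "\<alpha> \<in> roots D \<Longrightarrow> form D (iota D \<alpha>) v = blinfun_apply \<alpha> v"
  using form_coroot[of \<alpha> v] form_coroot_pos[of \<alpha>]
  by (simp add: iota_coroot form_simps field_simps)

lemma coroot_iota: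
  assumes "\<alpha> \<in> roots D"
  shows "coroot D \<alpha> = (2 / form D (iota D \<alpha>) (iota D \<alpha>)) *\<^sub>R iota D \<alpha>"
  using form_coroot_pos[OF assms]
  by (simp add: iota_coroot[OF assms] form_simps field_simps)

lemma coroot_eq_scaled_iota:
  assumes "\<alpha> \<in> roots D"
  obtains c where "c > 0" "coroot D \<alpha> = c *\<^sub>R iota D \<alpha>"
proof
  show "coroot D \<alpha> = (form D (coroot D \<alpha>) (coroot D \<alpha>) / 2) *\<^sub>R iota D \<alpha>"
    using form_coroot_pos[OF assms] by (simp add: iota_coroot[OF assms])
qed (use form_coroot_pos[OF assms] in simp)

section \<open>Reflections acting on roots, coroots and parameters\<close>

definition reflect :: "((real^'n) \<Rightarrow>\<^sub>L real) \<Rightarrow> ((real^'n) \<Rightarrow>\<^sub>L real) \<Rightarrow> (real^'n) \<Rightarrow>\<^sub>L real" where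
  "reflect \<alpha> \<beta> = \<beta> - blinfun_apply \<beta> (coroot D \<alpha>) *\<^sub>R \<alpha>"

lemma reflect_apply: "blinfun_apply (reflect \<alpha> \<beta>) v = blinfun_apply \<beta> (refl D \<alpha> v)"
  by (simp add: reflect_def refl_def blinfun.diff_left blinfun.scaleR_left blinfun.diff_right blinfun.scaleR_right)

lemma reflect_roots: "\<alpha> \<in> roots D \<Longrightarrow> \<beta> \<in> roots D \<Longrightarrow> reflect \<alpha> \<beta> \<in> roots D"
  unfolding reflect_def by (rule root_reflect)

lemma reflect_reflect [simp]: "\<alpha> \<in> roots D \<Longrightarrow> reflect \<alpha> (reflect \<alpha> \<beta>) = \<beta>"
  by (rule blinfun_eqI) (simp add: reflect_apply)

text \<open>\<open>root_system\<close> only says that reflections permute the set of coroots.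
  Compatibility with the map from roots to coroots comes from B: \<open>iota\<close> intertwines the
  reflections, and the coroot is \<open>iota\<close> rescaled by an invariant length.\<close>

lemma coroot_reflected:
  assumes "\<alpha> \<in> roots D" "\<beta> \<in> roots D"
  shows "coroot D (reflect \<alpha> \<beta>) = refl D \<alpha> (coroot D \<beta>)"
proof -
  have form: "form D (refl D \<alpha> u) v = form D u (refl D \<alpha> v)" for u v
    using form_weyl[OF refl_weyl[OF assms(1)], of u "refl D \<alpha> v"] assms(1) by simp
  have "iota D (reflect \<alpha> \<beta>) = refl D \<alpha> (iota D \<beta>)"
    by (rule iota_eqI) (simp add: form form_iota assms reflect_apply)
  moreover have "refl D \<alpha> (c *\<^sub>R u) = c *\<^sub>R refl D \<alpha> u" for c u
    by (simp add: refl_def blinfun.scaleR_right algebra_simps)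
  ultimately show ?thesis
    using assms by (simp add: coroot_iota reflect_roots form)
qed

lemma refl_reflected:
  assumes "\<alpha> \<in> roots D" "\<beta> \<in> roots D"
  shows "refl D (reflect \<alpha> \<beta>) = refl D \<alpha> \<circ> refl D \<beta> \<circ> refl D \<alpha>"
proof
  fix v
  have diff: "refl D \<alpha> (u - v) = refl D \<alpha> u - refl D \<alpha> v" "refl D \<alpha> (c *\<^sub>R u) = c *\<^sub>R refl D \<alpha> u" for u v c
    by (simp_all add: refl_def blinfun.diff_right blinfun.scaleR_right algebra_simps)
  have "(refl D \<alpha> \<circ> refl D \<beta> \<circ> refl D \<alpha>) v =
      refl D \<alpha> (refl D \<alpha> v - blinfun_apply \<beta> (refl D \<alpha> v) *\<^sub>R coroot D \<beta>)"
    by (simp add: refl_def[of D \<beta>])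
  also have "\<dots> = v - blinfun_apply (reflect \<alpha> \<beta>) v *\<^sub>R refl D \<alpha> (coroot D \<beta>)"
    using assms by (simp add: diff reflect_apply)
  finally show "refl D (reflect \<alpha> \<beta>) v = (refl D \<alpha> \<circ> refl D \<beta> \<circ> refl D \<alpha>) v"
    by (simp add: refl_def[of D "reflect \<alpha> \<beta>"] coroot_reflected[OF assms])
qed

lemma par_reflected:
  assumes "\<alpha> \<in> roots D" "\<beta> \<in> roots D"
  shows "par D (reflect \<alpha> \<beta>) = par D \<beta>"
proof -
  have "blinfun_apply (reflect \<alpha> \<beta>) (refl D \<alpha> v) = blinfun_apply \<beta> v" for v
    using assms by (simp add: reflect_apply)
  moreover have "invariant_parameter D" using valid by (simp add: valid_datum_def)
  ultimately show ?thesis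
    using assms refl_weyl reflect_roots unfolding invariant_parameter_def by blast
qed

lemma root_uminus:
  assumes "\<alpha> \<in> roots D"
  shows "- \<alpha> = reflect \<alpha> \<alpha>" and "refl D (- \<alpha>) = refl D \<alpha>"
proof -
  show *: "- \<alpha> = reflect \<alpha> \<alpha>" by (simp add: reflect_def root_coroot assms scaleR_2)
  show "refl D (- \<alpha>) = refl D \<alpha>"
    unfolding * refl_reflected[OF assms assms] by (simp add: fun_eq_iff assms)
qed

section \<open>Coordinates in simple roots and induction over positive roots\<close>

definition coeff :: "((real^'n) \<Rightarrow>\<^sub>L real) \<Rightarrow> ((real^'n) \<Rightarrow>\<^sub>L real) \<Rightarrow> real" where
  "coeff \<beta> \<gamma> = representation (simple D) \<beta> \<gamma>"

lemma pos_span: "\<beta> \<in> pos D \<Longrightarrow> \<beta> \<in> span (simple D)"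
  using pos_combination[of \<beta>] by (metis (no_types, lifting) span_sum span_scale span_base)

lemma coeff_combination:
  assumes "\<beta> \<in> span (simple D)"
  shows "\<beta> = (\<Sum>\<gamma>\<in>simple D. coeff \<beta> \<gamma> *\<^sub>R \<gamma>)"
  using sum_representation_eq[OF independent_simple assms finite_simple] by (simp add: coeff_def)

lemma coeff_unique:
  assumes "\<beta> = (\<Sum>\<gamma>\<in>simple D. c \<gamma> *\<^sub>R \<gamma>)" and "\<gamma> \<in> simple D"
  shows "coeff \<beta> \<gamma> = c \<gamma>"
proof -
  have "\<beta> \<in> span (simple D)"
    unfolding assms(1) by (intro span_sum span_scale span_base)
  from coeff_combination[OF this] have "(\<Sum>\<gamma>\<in>simple D. (coeff \<beta> \<gamma> - c \<gamma>) *\<^sub>R \<gamma>) = 0"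
    using assms(1) by (simp add: scaleR_diff_left sum_subtractf)
  then show ?thesis
    using independentD[OF independent_simple finite_simple order_refl _ assms(2), of "\<lambda>\<gamma>. coeff \<beta> \<gamma> - c \<gamma>"]
    by simp
qed

lemma coeff_nonneg:
  assumes "\<beta> \<in> pos D" "\<gamma> \<in> simple D"
  shows "0 \<le> coeff \<beta> \<gamma>"
proof -
  obtain c where "\<forall>\<beta>\<in>simple D. 0 \<le> c \<beta>" "\<beta> = (\<Sum>\<beta>\<in>simple D. c \<beta> *\<^sub>R \<beta>)"
    using pos_combination[OF assms(1)] by blast
  then show ?thesis using coeff_unique[OF _ assms(2)] assms(2) by simp
qed

lemma coeff_reflect:
  assumes "\<alpha> \<in> simple D" "\<beta> \<in> span (simple D)" "\<gamma> \<in> simple D"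
  shows "coeff (reflect \<alpha> \<beta>) \<gamma> = coeff \<beta> \<gamma> - (if \<gamma> = \<alpha> then blinfun_apply \<beta> (coroot D \<alpha>) else 0)"
proof (rule coeff_unique[OF _ assms(3)])
  have "(\<Sum>\<gamma>\<in>simple D. (coeff \<beta> \<gamma> - (if \<gamma> = \<alpha> then blinfun_apply \<beta> (coroot D \<alpha>) else 0)) *\<^sub>R \<gamma>) =
    (\<Sum>\<gamma>\<in>simple D. coeff \<beta> \<gamma> *\<^sub>R \<gamma>) - (\<Sum>\<gamma>\<in>simple D. if \<gamma> = \<alpha> then blinfun_apply \<beta> (coroot D \<alpha>) *\<^sub>R \<gamma> else 0)"
    by (simp add: scaleR_diff_left sum_subtractf if_distrib[of "\<lambda>c. c *\<^sub>R _"] cong: if_cong)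
  also have "\<dots> = reflect \<alpha> \<beta>"
    using assms(1) by (simp add: reflect_def flip: coeff_combination[OF assms(2)])
  finally show "reflect \<alpha> \<beta> =
    (\<Sum>\<gamma>\<in>simple D. (coeff \<beta> \<gamma> - (if \<gamma> = \<alpha> then blinfun_apply \<beta> (coroot D \<alpha>) else 0)) *\<^sub>R \<gamma>)" ..
qed

text \<open>A simple reflection changes only the coefficient at \<alpha>. If the image were
  negative, all other coefficients of \<beta> would be both nonnegative and nonpositive, so \<beta>
  would be a multiple of \<alpha>, which reducedness excludes.\<close>

lemma simple_reflect_pos:
  assumes "\<alpha> \<in> simple D" "\<beta> \<in> pos D" "\<beta> \<noteq> \<alpha>"
  shows "reflect \<alpha> \<beta> \<in> pos D"
proof (rule ccontr)
  assume "reflect \<alpha> \<beta> \<notin> pos D"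
  moreover have "reflect \<alpha> \<beta> \<in> roots D"
    using assms simple_pos pos_roots reflect_roots by blast
  ultimately obtain \<delta> where \<delta>: "\<delta> \<in> pos D" "reflect \<alpha> \<beta> = - \<delta>"
    by (auto simp: roots_eq)
  have neg: "coeff (reflect \<alpha> \<beta>) \<gamma> \<le> 0" if "\<gamma> \<in> simple D" for \<gamma>
  proof -
    have "reflect \<alpha> \<beta> = (\<Sum>\<gamma>\<in>simple D. (- coeff \<delta> \<gamma>) *\<^sub>R \<gamma>)"
      using coeff_combination[OF pos_span[OF \<delta>(1)]] \<delta>(2) by (simp add: sum_negf)
    from coeff_unique[OF this that] show ?thesis using coeff_nonneg[OF \<delta>(1) that] by simp
  qed
  have "coeff \<beta> \<gamma> = 0" if "\<gamma> \<in> simple D" "\<gamma> \<noteq> \<alpha>" for \<gamma>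
    using neg[OF that(1)] coeff_reflect[OF assms(1) pos_span[OF assms(2)] that(1)]
      coeff_nonneg[OF assms(2) that(1)] that(2) by simp
  then have "\<beta> = (\<Sum>\<gamma>\<in>simple D. if \<gamma> = \<alpha> then coeff \<beta> \<alpha> *\<^sub>R \<alpha> else 0)"
    by (subst coeff_combination[OF pos_span[OF assms(2)]], intro sum.cong) auto
  then have \<beta>: "\<beta> = coeff \<beta> \<alpha> *\<^sub>R \<alpha>" using assms(1) by simp
  then have "coeff \<beta> \<alpha> = 1 \<or> coeff \<beta> \<alpha> = -1"
    using roots_reduced[of \<alpha> "coeff \<beta> \<alpha>"] assms simple_pos pos_roots by metis
  then have "\<beta> = - \<alpha>" using \<beta> assms(3) by auto
  then show False using pos_disjoint assms(1,2) simple_pos by blast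
qed

text \<open>Expand one copy of \<beta> in B(\<beta>, \<beta>) > 0 into simple roots. Since the
  coefficients are nonnegative, some simple root pairs positively with \<beta>, and its coroot is a
  positive multiple of its \<open>iota\<close>.\<close>

lemma pos_nonsimple_descent:
  assumes "\<beta> \<in> pos D"
  obtains \<alpha> where "\<alpha> \<in> simple D" "0 < blinfun_apply \<beta> (coroot D \<alpha>)"
proof -
  have roots: "\<beta> \<in> roots D" using assms pos_roots by blast
  have "\<exists>\<alpha>\<in>simple D. 0 < blinfun_apply \<beta> (coroot D \<alpha>)"
  proof (rule ccontr)
    assume neg: "\<not> ?thesis"
    have "coeff \<beta> \<gamma> * blinfun_apply \<gamma> (iota D \<beta>) \<le> 0" if "\<gamma> \<in> simple D" for \<gamma>
    proof -
      have \<gamma>: "\<gamma> \<in> roots D" using that simple_pos pos_roots by blast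
      obtain c where c: "c > 0" "coroot D \<gamma> = c *\<^sub>R iota D \<gamma>"
        using coroot_eq_scaled_iota[OF \<gamma>] .
      have "c * blinfun_apply \<beta> (iota D \<gamma>) \<le> 0"
        using neg that c(2) by (auto simp: blinfun.scaleR_right not_less)
      then have "blinfun_apply \<beta> (iota D \<gamma>) \<le> 0"
        using c(1) by (simp add: mult_le_0_iff)
      moreover have "blinfun_apply \<gamma> (iota D \<beta>) = blinfun_apply \<beta> (iota D \<gamma>)"
        using form_iota[OF roots] form_iota[OF \<gamma>] form_sym by metis
      ultimately show ?thesis
        using coeff_nonneg[OF assms that] by (simp add: mult_nonneg_nonpos)
    qed
    then have "(\<Sum>\<gamma>\<in>simple D. coeff \<beta> \<gamma> * blinfun_apply \<gamma> (iota D \<beta>)) \<le> 0"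
      by (rule sum_nonpos)
    also have "(\<Sum>\<gamma>\<in>simple D. coeff \<beta> \<gamma> * blinfun_apply \<gamma> (iota D \<beta>)) = blinfun_apply \<beta> (iota D \<beta>)"
      by (subst (3) coeff_combination[OF pos_span[OF assms]])
        (simp add: blinfun.sum_left blinfun.scaleR_left)
    also have "\<dots> = form D (iota D \<beta>) (iota D \<beta>)"
      using form_iota[OF roots] by simp
    finally have "iota D \<beta> = 0" using form_pos[of "iota D \<beta>"] by force
    then have "coroot D \<beta> = 0" using coroot_iota[OF roots] by simp
    then show False using root_coroot[OF roots] by simp
  qed
  then show ?thesis using that by blast
qed

text \<open>Reflecting in a simple root that pairs positively lowers the height \<open>ht\<close>.
  Heights are arbitrary reals, so the measure is the number of positive roots of smaller
  height.\<close>

lemma pos_root_induct [consumes 1, case_names simple reflect]: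
  assumes "\<beta> \<in> pos D"
    and simple: "\<And>\<alpha>. \<alpha> \<in> simple D \<Longrightarrow> P \<alpha>"
    and reflect: "\<And>\<alpha> \<beta>. \<alpha> \<in> simple D \<Longrightarrow> \<beta> \<in> pos D \<Longrightarrow> P \<beta> \<Longrightarrow> P (reflect \<alpha> \<beta>)"
  shows "P \<beta>"
proof -
  define ht where "ht \<beta> = (\<Sum>\<gamma>\<in>simple D. coeff \<beta> \<gamma>)" for \<beta>
  show ?thesis using assms(1)
  proof (induction "card {\<delta> \<in> pos D. ht \<delta> < ht \<beta>}" arbitrary: \<beta> rule: less_induct)
    case less
    show ?case
    proof (cases "\<beta> \<in> simple D")
      case False
      obtain \<alpha> where \<alpha>: "\<alpha> \<in> simple D" "0 < blinfun_apply \<beta> (coroot D \<alpha>)"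
        using pos_nonsimple_descent[OF less.prems] .
      have pos: "reflect \<alpha> \<beta> \<in> pos D"
        using simple_reflect_pos[OF \<alpha>(1) less.prems] False \<alpha>(1) by auto
      have "ht (reflect \<alpha> \<beta>) = ht \<beta> - (\<Sum>\<gamma>\<in>simple D. if \<gamma> = \<alpha> then blinfun_apply \<beta> (coroot D \<alpha>) else 0)"
        unfolding ht_def using coeff_reflect[OF \<alpha>(1) pos_span[OF less.prems]]
        by (simp add: sum_subtractf)
      then have "ht (reflect \<alpha> \<beta>) < ht \<beta>" using \<alpha> by simp
      then have "{\<delta> \<in> pos D. ht \<delta> < ht (reflect \<alpha> \<beta>)} \<subset> {\<delta> \<in> pos D. ht \<delta> < ht \<beta>}"
        using pos by auto
      then have "P (reflect \<alpha> \<beta>)"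
        by (intro less.hyps pos psubset_card_mono) auto
      then have "P (reflect \<alpha> (reflect \<alpha> \<beta>))" by (rule reflect[OF \<alpha>(1) pos])
      then show ?thesis using \<alpha>(1) simple_pos pos_roots by simp
    qed (rule simple)
  qed
qed

section \<open>Generation by simple reflections and finiteness of the Weyl group\<close>

lemma weyl_comp: "w \<in> weyl D \<Longrightarrow> w' \<in> weyl D \<Longrightarrow> w \<circ> w' \<in> weyl D"
  by (induction w rule: weyl.induct) (auto simp: comp_assoc intro: weyl.intros)

text \<open>The group is defined through all reflections. Since
  \<open>refl D (reflect \<alpha> \<beta>)\<close> is a conjugate of \<open>refl D \<beta>\<close>
  by \<open>refl D \<alpha>\<close>, induction over positive roots reduces every reflection to
  simple ones.\<close>

lemma weyl_simple_induct [consumes 1, case_names id simple comp]: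
  assumes "w \<in> weyl D" and id: "P id" and simple: "\<And>\<alpha>. \<alpha> \<in> simple D \<Longrightarrow> P (refl D \<alpha>)"
    and comp: "\<And>w w'. w \<in> weyl D \<Longrightarrow> w' \<in> weyl D \<Longrightarrow> P w \<Longrightarrow> P w' \<Longrightarrow> P (w \<circ> w')"
  shows "P w"
proof -
  have pos: "P (refl D \<beta>)" if "\<beta> \<in> pos D" for \<beta>
    using that
  proof (induction rule: pos_root_induct)
    case (reflect \<alpha> \<beta>)
    then have "\<alpha> \<in> roots D" "\<beta> \<in> roots D" using simple_pos pos_roots by auto
    then show ?case using reflect.IH simple[OF reflect.hyps(1)]
      by (simp only: refl_reflected) (intro comp refl_weyl weyl_comp)
  qed (rule simple)
  have "P (refl D \<beta>)" if "\<beta> \<in> roots D" for \<beta>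
    using that pos root_uminus(2) by (auto simp: roots_eq)
  with assms(1) show ?thesis
    by (induction rule: weyl.induct) (auto intro: id comp refl_weyl)
qed

lemma linear_weyl: "w \<in> weyl D \<Longrightarrow> linear w"
proof (induction rule: weyl.induct)
  case (weyl_refl w \<alpha>)
  have "linear (refl D \<alpha>)"
    by (rule linearI) (simp_all add: refl_def blinfun.add_right blinfun.scaleR_right algebra_simps)
  then show ?case using weyl_refl linear_compose by blast
qed (rule linear_id)

lemma weyl_coroots: "w \<in> weyl D \<Longrightarrow> u \<in> coroot D ` roots D \<Longrightarrow> w u \<in> coroot D ` roots D"
proof (induction arbitrary: u rule: weyl.induct)
  case (weyl_refl w \<alpha>)
  then obtain \<beta> where "\<beta> \<in> roots D" "w u = coroot D \<beta>" by blast
  then show ?case using coroot_reflect[OF weyl_refl.hyps(2)] by simp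
qed simp

text \<open>The coroots need not span the space, so agreement of two elements on the coroots does
  not at once give equality. This lemma puts their difference at any v into the coroot span, while
  invariance of B makes it orthogonal to that span.\<close>

lemma weyl_diff_span: "w \<in> weyl D \<Longrightarrow> w v - v \<in> span (coroot D ` roots D)"
proof (induction rule: weyl.induct)
  case (weyl_refl w \<alpha>)
  have "(refl D \<alpha> \<circ> w) v - v = (w v - v) - blinfun_apply \<alpha> (w v) *\<^sub>R coroot D \<alpha>"
    by (simp add: refl_def)
  then show ?case
    using span_diff[OF weyl_refl.IH span_scale[OF span_base[OF imageI[OF weyl_refl.hyps(2)]]]] by metis
qed (simp add: span_zero)

text \<open>An element of the Weyl group is determined by its action on the coroots.\<close>

lemma finite_weyl: "finite (weyl D)"
proof -
  let ?C = "coroot D ` roots D"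
  have "inj_on (\<lambda>w. restrict w ?C) (weyl D)"
  proof (rule inj_onI, rule ext)
    fix w w' v
    assume w: "w \<in> weyl D" and w': "w' \<in> weyl D" and eq: "restrict w ?C = restrict w' ?C"
    have *: "w u = w' u" if "u \<in> ?C" for u using fun_cong[OF eq, of u] that by simp
    have inj: "inj w"
    proof -
      have "u = 0" if "w u = 0" for u
        using form_weyl[OF w, of u u] that form_pos[of u] by (force simp: form_simps)
      then show ?thesis using linear_injective_0[OF linear_weyl[OF w]] by blast
    qed
    have surj: "w ` ?C = ?C"
      by (rule endo_inj_surj) (use finite_roots weyl_coroots[OF w] inj in \<open>auto intro: inj_on_subset\<close>)
    let ?x = "w v - w' v"
    have "form D ?x u = 0" if u: "u \<in> ?C" for u
    proof -
      obtain u' where u': "u' \<in> ?C" "u = w u'" using surj u by blast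
      then have "form D ?x u = form D (w v) (w u') - form D (w' v) (w' u')"
        using * by (simp add: form_simps)
      then show ?thesis using form_weyl w w' by simp
    qed
    moreover have "?x \<in> span ?C"
      using span_diff[OF weyl_diff_span[OF w, of v] weyl_diff_span[OF w', of v]] by simp
    ultimately have "form D ?x ?x = 0"
    proof -
      assume orth: "\<And>u. u \<in> ?C \<Longrightarrow> form D ?x u = 0" and "?x \<in> span ?C"
      have "form D ?x y = 0" if "y \<in> span ?C" for y
        using that
      proof (induction rule: span_induct_alt)
        case (step c u y)
        then show ?case using orth[OF step(1)] by (simp only: form_simps) simp
      qed (simp add: bilinear_rzero[OF bilinear_form])
      then show ?thesis using \<open>?x \<in> span ?C\<close> by blast
    qed
    then show "w v = w' v" using form_pos[of ?x] by force
  qed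
  moreover have "(\<lambda>w. restrict w ?C) ` weyl D \<subseteq> ?C \<rightarrow>\<^sub>E ?C"
    using weyl_coroots by auto
  ultimately show ?thesis
    using finite_roots by (meson finite_PiE finite_imageI finite_subset inj_on_finite)
qed

section \<open>The complex-bilinear extension of the form\<close>

lemma cform_sym: "cform D u v = cform D v u"
  by (rule cform_commute) (rule form_sym)

lemma cform_cvec_axis: "cform D (cvec u) (axis j 1) = complex_of_real (form D u (axis j 1))"
proof -
  have "cform D (cvec u) (axis j 1) =
    (\<Sum>i\<in>UNIV. \<Sum>k\<in>UNIV. if k = j then complex_of_real (u $ i * form D (axis i 1) (axis k 1)) else 0)"
    unfolding cform_def by (intro sum.cong refl) (auto simp: cvec_def axis_def)
  also have "\<dots> = (\<Sum>i\<in>UNIV. complex_of_real (u $ i * form D (axis i 1) (axis j 1)))"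
    by simp
  also have "\<dots> = complex_of_real (form D (\<Sum>i\<in>UNIV. u $ i *\<^sub>R axis i 1) (axis j 1))"
    by (simp add: linear_sum[OF bilinear_form[unfolded bilinear_def, THEN conjunct2, rule_format]] form_simps)
  finally show ?thesis
    using basis_expansion[of u] by (simp add: scalar_mult_eq_scaleR)
qed

lemma cform_cvec_left: "cform D (cvec u) v = (\<Sum>j\<in>UNIV. v $ j * complex_of_real (form D u (axis j 1)))"
proof -
  have "cform D (cvec u) v = cform D (cvec u) (\<Sum>j\<in>UNIV. v $ j *s axis j 1)"
    by (simp add: basis_expansion)
  then show ?thesis by (simp only: cform_sum_right cform_scale_right cform_cvec_axis)
qed

lemma cform_cvec: "cform D (cvec u) (cvec v) = complex_of_real (form D u v)"
proof -
  have "form D u v = form D u (\<Sum>j\<in>UNIV. v $ j *\<^sub>R axis j 1)"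
    using basis_expansion[of v] by (simp add: scalar_mult_eq_scaleR)
  also have "\<dots> = (\<Sum>j\<in>UNIV. v $ j * form D u (axis j 1))"
    by (simp add: linear_sum[OF bilinear_form[unfolded bilinear_def, THEN conjunct1, rule_format]] form_simps)
  finally show ?thesis by (simp add: cform_cvec_left, simp add: cvec_def)
qed

lemma cform_iota: "\<alpha> \<in> roots D \<Longrightarrow> cform D (cvec (iota D \<alpha>)) v = cfun \<alpha> v"
  by (simp add: cform_cvec_left form_iota cfun_def)

text \<open>The extended form can have isotropic vectors. Pairing \<open>u - v\<close> with its
  complex conjugate avoids them: the mixed terms cancel by symmetry and a sum of two real
  nonnegative numbers remains.\<close>

lemma cform_eqI:
  assumes "\<And>w. cform D u w = cform D v w"
  shows "u = v"
proof -
  define p q where "p = (\<chi> i. Re ((u - v) $ i))" and "q = (\<chi> i. Im ((u - v) $ i))"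
  have uv: "u - v = cvec p + \<i> *s cvec q" unfolding p_def q_def by (rule cvec_Re_Im)
  have "cform D (u - v) (cvec p - \<i> *s cvec q) = 0"
    using assms by (simp add: cform_diff_left)
  then have "complex_of_real (form D p p + form D q q) = 0"
    unfolding uv by (simp add: cform_add_left cform_diff_right cform_scale_left cform_scale_right cform_cvec
        form_sym[of q p] algebra_simps)
  then have "form D p p + form D q q = 0" by (simp only: of_real_eq_0_iff)
  then have "p = 0" "q = 0"
    using form_pos[of p] form_pos[of q] form_nonneg[of p] form_nonneg[of q] by (fastforce, fastforce)
  then show ?thesis using uv by simp
qed

lemma cfun_coroot: "\<alpha> \<in> roots D \<Longrightarrow> cfun \<alpha> (cvec (coroot D \<alpha>)) = 2"
  by (simp add: cfun_cvec root_coroot)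

lemma crefl_add: "crefl D \<alpha> (u + v) = crefl D \<alpha> u + crefl D \<alpha> v"
  by (simp add: crefl_def cfun_add vec_eq_iff algebra_simps)

lemma crefl_scale: "crefl D \<alpha> (c *s v) = c *s crefl D \<alpha> v"
  by (simp add: crefl_def cfun_scale vec_eq_iff algebra_simps)

lemma crefl_cvec: "crefl D \<alpha> (cvec v) = cvec (refl D \<alpha> v)"
  by (simp add: crefl_def refl_def cfun_cvec cvec_diff cvec_scaleR)

lemma crefl_sum: "crefl D \<alpha> (\<Sum>i\<in>A. f i) = (\<Sum>i\<in>A. crefl D \<alpha> (f i))"
  by (induction A rule: infinite_finite_induct)
    (use crefl_scale[of \<alpha> 0 0] in \<open>auto simp: crefl_add\<close>)

lemma clinear_real_eqI:
  assumes "\<And>v. f (cvec v) = g (cvec v)" and "\<And>u v. f (u + v) = f u + f v" "\<And>u v. g (u + v) = g u + g v"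
    and "\<And>c v. f (c *s v) = c *s f v" "\<And>c v. g (c *s v) = c *s g v"
  shows "f v = g v"
  by (subst (1 2) cvec_Re_Im) (simp add: assms)

lemma crefl_crefl [simp]: "\<alpha> \<in> roots D \<Longrightarrow> crefl D \<alpha> (crefl D \<alpha> v) = v"
  by (rule clinear_real_eqI[where g = "\<lambda>v. v"]) (simp_all add: crefl_cvec crefl_add crefl_scale)

lemma crefl_reflected:
  "\<alpha> \<in> roots D \<Longrightarrow> \<beta> \<in> roots D \<Longrightarrow>
    crefl D (reflect \<alpha> \<beta>) v = crefl D \<alpha> (crefl D \<beta> (crefl D \<alpha> v))"
  by (rule clinear_real_eqI) (simp_all add: crefl_cvec crefl_add crefl_scale refl_reflected)

lemma cfun_reflect: "cfun (reflect \<alpha> \<beta>) v = cfun \<beta> (crefl D \<alpha> v)"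
  by (subst (1 2) cvec_Re_Im)
    (simp add: cfun_add cfun_scale crefl_add crefl_scale crefl_cvec cfun_cvec reflect_apply)

lemma cfun_crefl_self: "\<alpha> \<in> roots D \<Longrightarrow> cfun \<alpha> (crefl D \<alpha> v) = - cfun \<alpha> v"
  using cfun_add[of \<alpha> "crefl D \<alpha> v" "cfun \<alpha> v *s cvec (coroot D \<alpha>)"]
  by (simp add: cfun_scale cfun_coroot crefl_def eq_neg_iff_add_eq_0 add.commute)

lemma crefl_iota: "\<alpha> \<in> roots D \<Longrightarrow> crefl D \<alpha> (cvec (iota D \<alpha>)) = - cvec (iota D \<alpha>)"
  by (simp add: crefl_cvec refl_def iota_coroot blinfun.scaleR_right root_coroot flip: cvec_uminus)
    (simp flip: scaleR_diff_left scaleR_minus_left)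

lemma cform_crefl:
  assumes "\<alpha> \<in> roots D"
  shows "cform D (crefl D \<alpha> u) (crefl D \<alpha> v) = cform D u v"
proof -
  let ?c = "cvec (coroot D \<alpha>)"
  have c: "2 * cform D ?c w = cform D ?c ?c * cfun \<alpha> w" for w
  proof -
    obtain r where r: "r > 0" "coroot D \<alpha> = r *\<^sub>R iota D \<alpha>"
      using coroot_eq_scaled_iota[OF assms] .
    have "cform D ?c w = r * cfun \<alpha> w" for w
      by (simp add: r(2) cvec_scaleR cform_scale_left cform_iota assms)
    then show ?thesis using cfun_coroot[OF assms] by simp
  qed
  have "2 * cform D (crefl D \<alpha> u) (crefl D \<alpha> v) = 2 * cform D u v - cfun \<alpha> v * (2 * cform D ?c u)
      - cfun \<alpha> u * (2 * cform D ?c v) + 2 * cfun \<alpha> u * cfun \<alpha> v * cform D ?c ?c"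
    unfolding crefl_def
    by (simp add: cform_diff_left cform_diff_right cform_scale_left cform_scale_right cform_sym[of u] algebra_simps)
  then show ?thesis unfolding c by (simp add: algebra_simps)
qed

text \<open>B-dual bases, encoded by their two expansion formulas: these are what gets substituted
  under sums, and they pass directly to the reflected bases.\<close>

definition dual_pair :: "('n \<Rightarrow> complex^'n) \<Rightarrow> ('n \<Rightarrow> complex^'n) \<Rightarrow> bool" where
  "dual_pair b b' \<longleftrightarrow> (\<forall>v. (\<Sum>i\<in>UNIV. cform D v (b' i) *s b i) = v) \<and>
    (\<forall>v. (\<Sum>i\<in>UNIV. cform D v (b i) *s b' i) = v)"

lemma dual_pairI:
  assumes "\<And>v. \<exists>c. v = (\<Sum>i\<in>UNIV. c i *s b i)"
    and "\<And>i j. cform D (b i) (b' j) = (if i = j then 1 else 0)"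
  shows "dual_pair b b'"
proof -
  have first: "(\<Sum>i\<in>UNIV. cform D v (b' i) *s b i) = v" for v
  proof -
    obtain c where c: "v = (\<Sum>i\<in>UNIV. c i *s b i)" using assms(1) by blast
    have "cform D v (b' j) = c j" for j
      unfolding c cform_sym[of _ "b' j"] cform_sum_right cform_scale_right
      by (simp add: cform_sym[of "b' j"] assms(2) if_distrib cong: if_cong)
    then show ?thesis using c by simp
  qed
  moreover have "(\<Sum>i\<in>UNIV. cform D v (b i) *s b' i) = v" for v
  proof (rule cform_eqI)
    fix w
    have "cform D (\<Sum>i\<in>UNIV. cform D v (b i) *s b' i) w = (\<Sum>i\<in>UNIV. cform D v (b i) * cform D w (b' i))"
      unfolding cform_sym[of _ w] cform_sum_right cform_scale_right ..
    also have "\<dots> = cform D v (\<Sum>i\<in>UNIV. cform D w (b' i) *s b i)"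
      unfolding cform_sum_right cform_scale_right by (simp add: mult.commute)
    finally show "cform D (\<Sum>i\<in>UNIV. cform D v (b i) *s b' i) w = cform D v w"
      by (simp add: first)
  qed
  ultimately show ?thesis by (simp add: dual_pair_def)
qed

lemma dual_bases_pair:
  assumes "dual_bases D b b' bs"
  shows "dual_pair b b'"
proof (rule dual_pairI)
  show "cform D (b i) (b' j) = (if i = j then 1 else 0)" for i j
    using assms by (simp add: dual_bases_def)
  fix v
  have "v \<in> vec.span (range b)" and "inj b" using assms by (auto simp: dual_bases_def)
  then obtain u where "v = (\<Sum>w\<in>range b. u w *s w)"
    using vec.span_finite[of "range b"] by auto
  then have "v = (\<Sum>i\<in>UNIV. u (b i) *s b i)" using \<open>inj b\<close> by (simp add: sum.reindex)
  then show "\<exists>c. v = (\<Sum>i\<in>UNIV. c i *s b i)"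
    by (rule exI[of _ "\<lambda>i. u (b i)"])
qed

text \<open>This turns the derivations in \<open>D_minus\<close> into \<open>dform D (b' i)\<close>,
  so that both operators depend on the pair \<open>b\<close>, \<open>b'\<close> alone.\<close>

lemma dual_bases_functional:
  assumes "dual_bases D b b' bs"
  shows "bs i = cform D (b' i)"
proof
  fix v
  interpret Vector_Spaces.linear "(*s)" "(*)" "bs i" using assms by (simp add: dual_bases_def)
  have "bs i v = bs i (\<Sum>j\<in>UNIV. cform D v (b' j) *s b j)"
    using dual_bases_pair[OF assms] by (simp add: dual_pair_def)
  also have "\<dots> = (\<Sum>j\<in>UNIV. cform D v (b' j) * bs i (b j))"
    by (simp add: sum scale)
  also have "\<dots> = (\<Sum>j\<in>UNIV. if j = i then cform D v (b' i) else 0)"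
    using assms by (intro sum.cong) (auto simp: dual_bases_def)
  also have "\<dots> = cform D v (b' i)" by simp
  finally show "bs i v = cform D (b' i) v" by (simp add: cform_sym)
qed

lemma dual_pair_sym: "dual_pair b b' \<Longrightarrow> dual_pair b' b"
  by (simp add: dual_pair_def)

lemma dual_pair_crefl:
  assumes "dual_pair b b'" "\<alpha> \<in> roots D"
  shows "dual_pair (\<lambda>i. crefl D \<alpha> (b i)) (\<lambda>i. crefl D \<alpha> (b' i))"
proof -
  have *: "cform D v (crefl D \<alpha> u) = cform D (crefl D \<alpha> v) u" for u v
    using cform_crefl[OF assms(2), of "crefl D \<alpha> v" u] assms(2) by simp
  show ?thesis
    using assms unfolding dual_pair_def * by (simp flip: crefl_scale crefl_sum)
qed

text \<open>Expand each \<open>b i\<close> in the basis \<open>c\<close> and collect the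
  coefficients in the other argument, where they rebuild \<open>c'\<close>. The scalar action
  \<open>sc\<close> is left open because the lemma serves the free algebra, the module and also
  conjugate scalar multiplication on the complex numbers.\<close>

lemma dual_pair_sum:
  assumes "dual_pair b b'" "dual_pair c c'" "vector_space sc"
    and add: "\<And>u v w. F (u + v) w = F u w + F v w" "\<And>u v w. F w (u + v) = F w u + F w v"
    and scale: "\<And>a u v. F (a *s u) v = sc a (F u v)" "\<And>a u v. F u (a *s v) = sc a (F u v)"
  shows "(\<Sum>i\<in>UNIV. F (b i) (b' i)) = (\<Sum>i\<in>UNIV. F (c i) (c' i))"
proof -
  interpret vector_space sc by fact
  have F0: "F 0 v = 0" "F v 0 = 0" for v using add(1)[of 0 0 v] add(2)[of v 0 0] by auto
  have suml: "F (\<Sum>i\<in>A. f i) v = (\<Sum>i\<in>A. F (f i) v)" for A v and f :: "'n \<Rightarrow> complex^'n"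
    by (induction A rule: infinite_finite_induct) (auto simp: F0 add)
  have sumr: "F v (\<Sum>i\<in>A. f i) = (\<Sum>i\<in>A. F v (f i))" for A v and f :: "'n \<Rightarrow> complex^'n"
    by (induction A rule: infinite_finite_induct) (auto simp: F0 add)
  have "(\<Sum>i\<in>UNIV. F (b i) (b' i)) = (\<Sum>i\<in>UNIV. F (\<Sum>j\<in>UNIV. cform D (b i) (c' j) *s c j) (b' i))"
    using assms(2) by (simp add: dual_pair_def)
  also have "\<dots> = (\<Sum>j\<in>UNIV. F (c j) (\<Sum>i\<in>UNIV. cform D (c' j) (b i) *s b' i))"
    unfolding suml sumr scale by (subst sum.swap) (simp add: cform_sym)
  also have "\<dots> = (\<Sum>i\<in>UNIV. F (c i) (c' i))"
    using assms(1) by (simp add: dual_pair_def)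
  finally show ?thesis .
qed

lemma dual_pair_iota:
  assumes "dual_pair b b'" "\<alpha> \<in> roots D"
  shows "(\<Sum>i\<in>UNIV. cfun \<alpha> (b' i) *s b i) = cvec (iota D \<alpha>)"
  using assms by (simp add: dual_pair_def flip: cform_iota)

text \<open>Supplies vectors to which the adjunctions apply. The dual basis comes from inverting the
  Gram map \<open>L\<close>, which is injective because B is nondegenerate.\<close>

lemma real_dual_pair:
  obtains e' :: "'n \<Rightarrow> real^'n" where "dual_pair (\<lambda>i. cvec (axis i 1)) (\<lambda>i. cvec (e' i))"
proof -
  define L where "L u = (\<chi> j. form D u (axis j 1))" for u :: "real^'n"
  have lin: "linear L" by (rule linearI) (auto simp: L_def vec_eq_iff form_simps)
  have "inj L"
  proof -
    have "u = 0" if "L u = 0" for u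
    proof (rule form_eqI)
      fix w
      have "complex_of_real (form D u w) = 0"
        using that unfolding cform_cvec[symmetric] by (subst cform_cvec_left) (simp add: L_def vec_eq_iff)
      then show "form D u w = form D 0 w" by (simp add: form_simps)
    qed
    then show ?thesis using linear_injective_0[OF lin] by blast
  qed
  then have "surj L" using linear_injective_imp_surjective[OF lin] by blast
  define e' where "e' i = inv_into UNIV L (axis i 1)" for i
  have e': "L (e' i) = axis i 1" for i
    unfolding e'_def by (rule f_inv_into_f) (use \<open>surj L\<close> in simp)
  have "dual_pair (\<lambda>i. cvec (axis i 1)) (\<lambda>i. cvec (e' i))"
  proof (rule dual_pairI)
    show "\<exists>c. v = (\<Sum>i\<in>UNIV. c i *s cvec (axis i 1))" for v :: "complex^'n"
      by (rule exI[of _ "\<lambda>i. v $ i"]) (simp add: cvec_axis basis_expansion)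
    fix i j
    have "form D (e' j) (axis i 1) = (if i = j then 1 else 0)"
      using e'[of j] by (auto simp: L_def vec_eq_iff axis_def)
    then show "cform D (cvec (axis i 1)) (cvec (e' j)) = (if i = j then 1 else 0)"
      by (simp add: cform_cvec form_sym[of "axis i 1"])
  qed
  then show ?thesis using that by blast
qed

end

section \<open>Representations of the Weyl group and of the Hecke algebra\<close>

text \<open>Only W acts here, so the results on \<open>T\<close> and \<open>Omega_W\<close> are
  available both for \<sigma> and for the module M.\<close>

locale weyl_rep = root_datum D + vector_space s
  for D :: "('n::finite) hecke_datum" and s :: "complex \<Rightarrow> 'm \<Rightarrow> 'm::ab_group_add" +
  fixes S :: "(real^'n \<Rightarrow> real^'n) \<Rightarrow> 'm \<Rightarrow> 'm"
  assumes S_add: "w \<in> weyl D \<Longrightarrow> S w (x + y) = S w x + S w y"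
    and S_scale: "w \<in> weyl D \<Longrightarrow> S w (s c x) = s c (S w x)"
    and S_id: "S id x = x"
    and S_comp: "w \<in> weyl D \<Longrightarrow> w' \<in> weyl D \<Longrightarrow> S (w \<circ> w') x = S w (S w' x)"
begin

lemma S_0: "w \<in> weyl D \<Longrightarrow> S w 0 = 0"
  using S_add[of w 0 0] by simp

lemma S_sum: "w \<in> weyl D \<Longrightarrow> S w (\<Sum>i\<in>A. f i) = (\<Sum>i\<in>A. S w (f i))"
  by (induction A rule: infinite_finite_induct) (auto simp: S_0 S_add)

lemma S_refl_refl: "\<alpha> \<in> roots D \<Longrightarrow> S (refl D \<alpha>) (S (refl D \<alpha>) x) = x"
  using S_comp[of "refl D \<alpha>" "refl D \<alpha>" x] refl_weyl[of \<alpha>] S_id[of x]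
  by (simp add: comp_def flip: id_def)

definition T :: "complex^'n \<Rightarrow> 'm \<Rightarrow> 'm" where
  "T v x = (\<Sum>\<alpha>\<in>pos D. s (1/2 * par D \<alpha> * cfun \<alpha> v) (S (refl D \<alpha>) x))"

lemma pos_weyl: "\<alpha> \<in> pos D \<Longrightarrow> refl D \<alpha> \<in> weyl D"
  using pos_roots refl_weyl by blast

lemma T_add: "T v (x + y) = T v x + T v y"
  by (simp add: T_def S_add pos_weyl scale_right_distrib sum.distrib)

lemma T_scale: "T v (s c x) = s c (T v x)"
  by (simp add: T_def S_scale pos_weyl scale_sum_right mult_ac)

lemma T_add_vec: "T (u + v) x = T u x + T v x"
  by (simp add: T_def cfun_add ring_distribs scale_left_distrib sum.distrib)

lemma T_scale_vec: "T (c *s v) x = s c (T v x)"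
  by (simp add: T_def cfun_scale scale_sum_right mult_ac)

lemma T_0: "T v 0 = 0"
  using T_add[of v 0 0] by simp

lemma T_uminus_vec: "T (- v) x = - T v x"
  using T_scale_vec[of "-1" v x] by simp

lemma T_0_vec: "T 0 x = 0"
  using T_add_vec[of 0 0 x] by simp

lemma T_sum_vec: "T (\<Sum>i\<in>A. f i) x = (\<Sum>i\<in>A. T (f i) x)"
  by (induction A rule: infinite_finite_induct) (auto simp: T_0_vec T_add_vec)

text \<open>Conjugation carries the summand of \<beta> to that of
  \<open>reflect \<alpha> \<beta>\<close>, a permutation of the positive roots other than \<alpha>.
  The \<alpha>-summand stays fixed, whereas in \<open>T (crefl D \<alpha> v)\<close> it has the
  opposite sign; the difference is twice 1/2, hence the constant without a fraction.\<close>

lemma T_conj_simple: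
  assumes "\<alpha> \<in> simple D"
  shows "S (refl D \<alpha>) (T v (S (refl D \<alpha>) x)) =
    T (crefl D \<alpha> v) x + s (par D \<alpha> * cfun \<alpha> v) (S (refl D \<alpha>) x)"
proof -
  have pos: "\<alpha> \<in> pos D" and root: "\<alpha> \<in> roots D" using assms simple_pos pos_roots by auto
  have w: "refl D \<alpha> \<in> weyl D" using refl_weyl root by blast
  let ?P = "pos D - {\<alpha>}"
  have bij: "bij_betw (reflect \<alpha>) ?P ?P"
  proof (rule bij_betw_byWitness[of _ "reflect \<alpha>"])
    have "reflect \<alpha> \<beta> \<in> ?P" if "\<beta> \<in> ?P" for \<beta>
    proof -
      have "reflect \<alpha> \<beta> \<noteq> \<alpha>"
      proof
        assume "reflect \<alpha> \<beta> = \<alpha>"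
        then have "\<beta> = reflect \<alpha> \<alpha>" using root by (metis reflect_reflect)
        then have "\<beta> = - \<alpha>" using root_uminus(1)[OF root] by simp
        then show False using that pos pos_disjoint by blast
      qed
      then show ?thesis using simple_reflect_pos[OF assms, of \<beta>] that by blast
    qed
    then show "reflect \<alpha> ` ?P \<subseteq> ?P" "reflect \<alpha> ` ?P \<subseteq> ?P" by auto
  qed (use root in auto)
  have conj: "S (refl D \<alpha>) (S (refl D \<beta>) (S (refl D \<alpha>) x)) = S (refl D (reflect \<alpha> \<beta>)) x"
    if "\<beta> \<in> pos D" for \<beta> x
    using that root pos_roots w by (simp add: refl_reflected S_comp weyl_comp refl_weyl)
  let ?g = "\<lambda>v \<beta>. s (1/2 * par D \<beta> * cfun \<beta> v) (S (refl D \<beta>) x)"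
  have "S (refl D \<alpha>) (T v (S (refl D \<alpha>) x)) =
    (\<Sum>\<beta>\<in>pos D. s (1/2 * par D \<beta> * cfun \<beta> v) (S (refl D (reflect \<alpha> \<beta>)) x))"
    by (simp add: T_def S_sum S_scale w conj)
  also have "\<dots> = ?g v \<alpha> + (\<Sum>\<beta>\<in>?P. s (1/2 * par D \<beta> * cfun \<beta> v) (S (refl D (reflect \<alpha> \<beta>)) x))"
    using pos root root_uminus[OF root] by (subst sum.remove[of _ \<alpha>]) auto
  also have "(\<Sum>\<beta>\<in>?P. s (1/2 * par D \<beta> * cfun \<beta> v) (S (refl D (reflect \<alpha> \<beta>)) x)) =
    (\<Sum>\<beta>\<in>?P. ?g (crefl D \<alpha> v) (reflect \<alpha> \<beta>))"
    using root pos_roots by (intro sum.cong refl) (simp add: par_reflected cfun_reflect)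
  also have "\<dots> = (\<Sum>\<beta>\<in>?P. ?g (crefl D \<alpha> v) \<beta>)"
    using bij by (rule sum.reindex_bij_betw)
  also have "\<dots> = T (crefl D \<alpha> v) x - ?g (crefl D \<alpha> v) \<alpha>"
    unfolding T_def using pos by (subst sum.remove[of "pos D" \<alpha>]) auto
  also have "?g v \<alpha> + (T (crefl D \<alpha> v) x - ?g (crefl D \<alpha> v) \<alpha>) =
    T (crefl D \<alpha> v) x + s (par D \<alpha> * cfun \<alpha> v) (S (refl D \<alpha>) x)"
    by (simp add: cfun_crefl_self root algebra_simps flip: scale_left_distrib)
  finally show ?thesis .
qed

text \<open>Over a dual pair, \<alpha>(b_i) \<beta>(b'_i) sums to the dual form of \<alpha> and
  \<beta>, and the two factors 1/2 in \<open>T\<close> give the 1/4 in \<open>Omega_W\<close>.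
  Through this formula \<open>Omega_W\<close> can be handled via \<open>T\<close> and any convenient
  basis.\<close>

lemma T_Casimir:
  assumes "dual_pair b b'"
  shows "(\<Sum>i\<in>UNIV. T (b i) (T (b' i) x)) = Omega_W D s S x"
proof -
  have "(\<Sum>i\<in>UNIV. cfun \<alpha> (b i) * cfun \<beta> (b' i)) = complex_of_real (dual_form D \<alpha> \<beta>)"
    if "\<alpha> \<in> pos D" "\<beta> \<in> pos D" for \<alpha> \<beta>
  proof -
    have roots: "\<alpha> \<in> roots D" "\<beta> \<in> roots D" using that pos_roots by auto
    have "complex_of_real (dual_form D \<alpha> \<beta>) = cfun \<alpha> (cvec (iota D \<beta>))"
      by (simp add: dual_form_def cform_iota[symmetric] cform_cvec roots)
    also have "\<dots> = cfun \<alpha> (\<Sum>i\<in>UNIV. cfun \<beta> (b' i) *s b i)"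
      using dual_pair_iota[OF assms roots(2)] by simp
    also have "\<dots> = (\<Sum>i\<in>UNIV. cfun \<alpha> (b i) * cfun \<beta> (b' i))"
      by (simp add: cfun_sum cfun_scale mult.commute)
    finally show ?thesis ..
  qed
  note * = this
  have "(\<Sum>i\<in>UNIV. T (b i) (T (b' i) x)) = (\<Sum>i\<in>UNIV. \<Sum>\<alpha>\<in>pos D. \<Sum>\<beta>\<in>pos D.
     s ((1/4 * par D \<alpha> * par D \<beta>) * (cfun \<alpha> (b i) * cfun \<beta> (b' i))) (S (refl D \<alpha> \<circ> refl D \<beta>) x))"
    by (simp add: T_def S_sum S_scale S_comp pos_weyl scale_sum_right mult_ac)
  also have "\<dots> = (\<Sum>\<alpha>\<in>pos D. \<Sum>\<beta>\<in>pos D. \<Sum>i\<in>UNIV.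
     s ((1/4 * par D \<alpha> * par D \<beta>) * (cfun \<alpha> (b i) * cfun \<beta> (b' i))) (S (refl D \<alpha> \<circ> refl D \<beta>) x))"
    by (subst sum.swap) (intro sum.cong refl sum.swap)
  also have "\<dots> = Omega_W D s S x"
    unfolding Omega_W_def
    by (intro sum.cong refl) (simp only: scale_sum_left[symmetric] sum_distrib_left[symmetric] *)
  finally show ?thesis .
qed

text \<open>The reflection negates \<iota>(\<alpha>), so at this vector the conjugation formula
  becomes an anticommutator. It evaluates the first-order corrections in
  \<open>Omega_W_simple\<close>.\<close>

lemma T_iota_anticommute:
  assumes "\<alpha> \<in> simple D"
  shows "S (refl D \<alpha>) (T (cvec (iota D \<alpha>)) x) + T (cvec (iota D \<alpha>)) (S (refl D \<alpha>) x) =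
    s (par D \<alpha> * cfun \<alpha> (cvec (iota D \<alpha>))) x"
proof -
  have root: "\<alpha> \<in> roots D" using assms simple_pos pos_roots by auto
  have "S (refl D \<alpha>) (T (cvec (iota D \<alpha>)) x) =
    - T (cvec (iota D \<alpha>)) (S (refl D \<alpha>) x) + s (par D \<alpha> * cfun \<alpha> (cvec (iota D \<alpha>))) x"
    using T_conj_simple[OF assms, of "cvec (iota D \<alpha>)" "S (refl D \<alpha>) x"] root
    by (simp add: S_refl_refl crefl_iota T_uminus_vec)
  then show ?thesis by simp
qed

text \<open>Conjugation by a simple reflection permutes the positive roots up to one sign; the
  corrections coming from that sign cancel.\<close>

lemma Omega_W_simple:
  assumes "\<alpha> \<in> simple D"
  shows "S (refl D \<alpha>) (Omega_W D s S (S (refl D \<alpha>) x)) = Omega_W D s S x"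
proof -
  have root: "\<alpha> \<in> roots D" using assms simple_pos pos_roots by auto
  then have w: "refl D \<alpha> \<in> weyl D" by (rule refl_weyl)
  obtain e' :: "'n \<Rightarrow> real^'n" where b: "dual_pair (\<lambda>i. cvec (axis i 1)) (\<lambda>i. cvec (e' i))"
    by (rule real_dual_pair)
  define b b' where "b = (\<lambda>i::'n. cvec (axis i (1::real)))" and "b' = (\<lambda>i. cvec (e' i))"
  have bb: "dual_pair b b'" using b by (simp add: b_def b'_def)
  let ?r = "crefl D \<alpha>" and ?S = "S (refl D \<alpha>)" and ?\<iota> = "cvec (iota D \<alpha>)"
  let ?k = "par D \<alpha>"
  have split: "?S (T v (T v' (?S x))) = T (?r v) (T (?r v') x) + s ?k (T (s0 *s ?r v) (?S x)
      + ?S (T (s1 *s ?r v') x)) + s (?k * ?k * s1 * s0) x"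
    if "s0 = cfun \<alpha> v'" "s1 = cfun \<alpha> v" for v v' s0 s1
  proof -
    have "?S (T v (T v' (?S x))) = ?S (T v (?S (?S (T v' (?S x)))))"
      using root by (simp only: S_refl_refl)
    also have "\<dots> = T (?r v) (?S (T v' (?S x))) + s (?k * cfun \<alpha> v) (?S (?S (T v' (?S x))))"
      by (rule T_conj_simple[OF assms])
    also have "\<dots> = T (?r v) (T (?r v') x + s (?k * cfun \<alpha> v') (?S x))
        + s (?k * cfun \<alpha> v) (?S (T (?r v') x + s (?k * cfun \<alpha> v') (?S x)))"
      by (simp only: T_conj_simple[OF assms])
    finally show ?thesis
      using root by (simp add: that T_add T_scale T_scale_vec S_add S_scale w S_refl_refl
          scale_right_distrib mult_ac)
  qed
  have sum1: "(\<Sum>i\<in>UNIV. cfun \<alpha> (b' i) *s ?r (b i)) = - ?\<iota>"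
    using dual_pair_iota[OF bb root] root by (simp add: crefl_iota flip: crefl_scale crefl_sum)
  have sum2: "(\<Sum>i\<in>UNIV. cfun \<alpha> (b i) *s ?r (b' i)) = - ?\<iota>"
    using dual_pair_iota[OF dual_pair_sym[OF bb] root] root by (simp add: crefl_iota flip: crefl_scale crefl_sum)
  have sum3: "(\<Sum>i\<in>UNIV. cfun \<alpha> (b i) * cfun \<alpha> (b' i)) = cfun \<alpha> ?\<iota>"
    using arg_cong[OF dual_pair_iota[OF bb root], of "cfun \<alpha>"]
    by (simp add: cfun_sum cfun_scale mult.commute)
  have "?S (Omega_W D s S (?S x)) = (\<Sum>i\<in>UNIV. ?S (T (b i) (T (b' i) (?S x))))"
    by (simp add: T_Casimir[OF bb, symmetric] S_sum w)
  also have "\<dots> = (\<Sum>i\<in>UNIV. T (?r (b i)) (T (?r (b' i)) x)) +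
      s ?k (T (\<Sum>i\<in>UNIV. cfun \<alpha> (b' i) *s ?r (b i)) (?S x)
      + ?S (T (\<Sum>i\<in>UNIV. cfun \<alpha> (b i) *s ?r (b' i)) x))
      + s (?k * ?k * (\<Sum>i\<in>UNIV. cfun \<alpha> (b i) * cfun \<alpha> (b' i))) x"
    by (simp only: split[OF refl refl] sum.distrib T_sum_vec S_sum[OF w] scale_sum_right[symmetric]
        scale_sum_left sum_distrib_left mult.assoc)
  also have "\<dots> = Omega_W D s S x + s ?k (- (?S (T ?\<iota> x) + T ?\<iota> (?S x))) + s (?k * ?k * cfun \<alpha> ?\<iota>) x"
    using S_scale[OF w, of "-1" "T ?\<iota> x"]
    by (simp add: T_Casimir[OF dual_pair_crefl[OF bb root]] sum1 sum2 sum3 T_uminus_vec)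
  \<comment> \<open>With k = \<open>par D \<alpha>\<close>, the anticommutator turns the corrections
    linear in \<open>T\<close> into -k k \<alpha>(\<iota>(\<alpha>)), which cancels the purely
    scalar one.\<close>
  also have "\<dots> = Omega_W D s S x"
    by (simp only: T_iota_anticommute[OF assms]) (simp add: mult.assoc)
  finally show ?thesis .
qed

lemma Omega_W_commute:
  assumes "w \<in> weyl D"
  shows "Omega_W D s S (S w x) = S w (Omega_W D s S x)"
  using assms
proof (induction arbitrary: x rule: weyl_simple_induct)
  case (simple \<alpha>)
  then have root: "\<alpha> \<in> roots D" using simple_pos pos_roots by auto
  show ?case
    using arg_cong[OF Omega_W_simple[OF simple, of x], of "S (refl D \<alpha>)"] by (simp add: S_refl_refl root)
next
  case (comp w w')
  then show ?case by (simp only: S_comp)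
qed (simp only: S_id)

lemma Omega_W_add: "Omega_W D s S (x + y) = Omega_W D s S x + Omega_W D s S y"
  by (rule real_dual_pair) (simp add: T_add sum.distrib flip: T_Casimir)

lemma Omega_W_scale: "Omega_W D s S (s c x) = s c (Omega_W D s S x)"
  by (rule real_dual_pair) (simp add: T_scale scale_sum_right flip: T_Casimir)

end

text \<open>The relations of the Hecke algebra as operator identities on a module. This keeps the
  computations below free of cosets; \<open>hecke_module_rep\<close> supplies the instance.\<close>

locale hecke_rep = weyl_rep D s S
  for D :: "('n::finite) hecke_datum" and s :: "complex \<Rightarrow> 'm \<Rightarrow> 'm::ab_group_add" and S +
  fixes X :: "complex^'n \<Rightarrow> 'm \<Rightarrow> 'm"
  assumes X_add: "X v (x + y) = X v x + X v y"
    and X_scale: "X v (s c x) = s c (X v x)"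
    and X_add_vec: "X (u + v) x = X u x + X v x"
    and X_scale_vec: "X (c *s v) x = s c (X v x)"
    and X_commute: "X u (X v x) = X v (X u x)"
    and X_simple: "\<alpha> \<in> simple D \<Longrightarrow> X v (S (refl D \<alpha>) x) =
      S (refl D \<alpha>) (X (crefl D \<alpha> v) x) + s (par D \<alpha> * cfun \<alpha> v) x"
begin

text \<open>The action of v~, as \<open>htilde_Xt\<close> confirms.\<close>

definition Xt :: "complex^'n \<Rightarrow> 'm \<Rightarrow> 'm" where
  "Xt v x = X v x - T v x"

lemma Xt_add: "Xt v (x + y) = Xt v x + Xt v y"
  by (simp add: Xt_def X_add T_add)

lemma Xt_scale: "Xt v (s c x) = s c (Xt v x)"
  by (simp add: Xt_def X_scale T_scale scale_right_diff_distrib)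

lemma Xt_add_vec: "Xt (u + v) x = Xt u x + Xt v x"
  by (simp add: Xt_def X_add_vec T_add_vec)

lemma Xt_scale_vec: "Xt (c *s v) x = s c (Xt v x)"
  by (simp add: Xt_def X_scale_vec T_scale_vec scale_right_diff_distrib)

lemma Xt_0: "Xt v 0 = 0"
  using Xt_add[of v 0 0] by simp

lemma Xt_0_vec: "Xt 0 x = 0"
  using Xt_add_vec[of 0 0 x] by simp

lemma Xt_sum: "Xt v (\<Sum>i\<in>A. f i) = (\<Sum>i\<in>A. Xt v (f i))"
  by (induction A rule: infinite_finite_induct) (auto simp: Xt_0 Xt_add)

lemma Xt_sum_vec: "Xt (\<Sum>i\<in>A. f i) x = (\<Sum>i\<in>A. Xt (f i) x)"
  by (induction A rule: infinite_finite_induct) (auto simp: Xt_0_vec Xt_add_vec)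

text \<open>The correction in \<open>T_conj_simple\<close> is exactly the constant of the cross
  relation \<open>X_simple\<close>, so the two cancel in the difference.\<close>

lemma Xt_simple:
  assumes "\<alpha> \<in> simple D"
  shows "Xt v (S (refl D \<alpha>) x) = S (refl D \<alpha>) (Xt (crefl D \<alpha> v) x)"
proof -
  have root: "\<alpha> \<in> roots D" using assms simple_pos pos_roots by auto
  then have w: "refl D \<alpha> \<in> weyl D" by (rule refl_weyl)
  have "S (refl D \<alpha>) (T (crefl D \<alpha> v) x) = T v (S (refl D \<alpha>) x) - s (par D \<alpha> * cfun \<alpha> v) x"
    using T_conj_simple[OF assms, of "crefl D \<alpha> v" "S (refl D \<alpha>) x"] root
    by (simp add: S_refl_refl cfun_crefl_self)
  moreover have "S (refl D \<alpha>) (y - z) = S (refl D \<alpha>) y - S (refl D \<alpha>) z" for y z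
    using S_add[OF w, of "y - z" z] by (simp add: algebra_simps)
  ultimately show ?thesis by (simp add: Xt_def X_simple[OF assms])
qed

lemma Xt_pos:
  assumes "\<beta> \<in> pos D"
  shows "Xt v (S (refl D \<beta>) x) = S (refl D \<beta>) (Xt (crefl D \<beta> v) x)"
  using assms
proof (induction arbitrary: v x rule: pos_root_induct)
  case (simple \<alpha>)
  then show ?case by (rule Xt_simple)
next
  case (reflect \<alpha> \<beta>)
  then have "\<alpha> \<in> roots D" "\<beta> \<in> roots D" using simple_pos pos_roots by auto
  then show ?case
    by (simp only: refl_reflected crefl_reflected S_comp weyl_comp refl_weyl
        Xt_simple[OF reflect.hyps(1)] reflect.IH)
qed

text \<open>Splitting v into its reflection and \<beta>(v) times the coroot leaves the scalar
  \<beta>(v) as the only dependence on v. Multiplied by the factor \<beta>(u) from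
  \<open>T u\<close>, it becomes symmetric in u and v.\<close>

lemma Xt_commutator_pos:
  assumes "\<beta> \<in> pos D"
  shows "Xt v (S (refl D \<beta>) x) - S (refl D \<beta>) (Xt v x) =
    - s (cfun \<beta> v) (S (refl D \<beta>) (Xt (cvec (coroot D \<beta>)) x))"
proof -
  have w: "refl D \<beta> \<in> weyl D" using assms by (rule pos_weyl)
  have "Xt v x = Xt (crefl D \<beta> v) x + s (cfun \<beta> v) (Xt (cvec (coroot D \<beta>)) x)"
    by (simp add: crefl_def flip: Xt_add_vec Xt_scale_vec)
  then show ?thesis by (simp add: Xt_pos[OF assms] S_add S_scale w)
qed

text \<open>The commutator \<open>[Xt v, T u]\<close> is symmetric in \<open>u\<close> and \<open>v\<close>, so the mixed terms in
  \<open>0 = [Xt u + T u, Xt v + T v]\<close> cancel.\<close>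

lemma Xt_commutator:
  "Xt u (Xt v x) - Xt v (Xt u x) = - (T u (T v x) - T v (T u x))"
proof -
  have mixed: "Xt v (T u x) - T u (Xt v x) = - (\<Sum>\<beta>\<in>pos D. s (1/2 * par D \<beta> * cfun \<beta> u * cfun \<beta> v)
      (S (refl D \<beta>) (Xt (cvec (coroot D \<beta>)) x)))" for u v
  proof -
    have "Xt v (T u x) - T u (Xt v x) = (\<Sum>\<beta>\<in>pos D. s (1/2 * par D \<beta> * cfun \<beta> u)
        (Xt v (S (refl D \<beta>) x) - S (refl D \<beta>) (Xt v x)))"
      by (simp add: T_def Xt_sum Xt_scale scale_right_diff_distrib sum_subtractf)
    then show ?thesis by (simp add: Xt_commutator_pos sum_negf)
  qed
  have X: "X v x = Xt v x + T v x" for v x by (simp add: Xt_def)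
  have "Xt v (T u x) - T u (Xt v x) = Xt u (T v x) - T v (Xt u x)"
    unfolding mixed by (simp add: mult_ac)
  moreover have "Xt u (Xt v x) + T u (Xt v x) + (Xt u (T v x) + T u (T v x)) =
    Xt v (Xt u x) + T v (Xt u x) + (Xt v (T u x) + T v (T u x))"
    using X_commute[of u v x] by (simp only: X Xt_add T_add) (simp add: algebra_simps)
  moreover have "a - a' = - (d - d')"
    if "c' - b = c - b'" "a + b + (c + d) = a' + b' + (c' + d')" for a a' b b' c c' d d' :: 'm
  proof -
    have *: "b' + c' = b + c" using that(1) by (simp add: algebra_simps)
    have "(a + d) + (b + c) = (a' + d') + (b' + c')" using that(2) by (simp only: ac_simps)
    then have "a + d = a' + d'" by (simp add: *)
    then show ?thesis by (simp add: algebra_simps)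
  qed
  ultimately show ?thesis by blast
qed

text \<open>In the mixed terms the sum over the dual pair contracts each root \<beta> to
  \<iota>(\<beta>). Moving the reflection past \<open>Xt\<close> at this vector changes the sign, so
  the two orders of \<open>Xt\<close> and \<open>T\<close> cancel root by root.\<close>

lemma Xt_Casimir:
  assumes "dual_pair b b'"
  shows "(\<Sum>i\<in>UNIV. Xt (b i) (Xt (b' i) x)) = (\<Sum>i\<in>UNIV. X (b i) (X (b' i) x)) - Omega_W D s S x"
proof -
  have X: "X v x = Xt v x + T v x" for v x by (simp add: Xt_def)
  have "(\<Sum>i\<in>UNIV. Xt (b i) (T (b' i) x)) + (\<Sum>i\<in>UNIV. T (b i) (Xt (b' i) x)) =
    (\<Sum>\<beta>\<in>pos D. s (1/2 * par D \<beta>) (Xt (\<Sum>i\<in>UNIV. cfun \<beta> (b' i) *s b i) (S (refl D \<beta>) x)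
      + S (refl D \<beta>) (Xt (\<Sum>i\<in>UNIV. cfun \<beta> (b i) *s b' i) x)))"
    unfolding T_def
    by (simp add: Xt_sum Xt_scale Xt_sum_vec Xt_scale_vec S_sum S_scale pos_weyl scale_right_distrib
        scale_sum_right sum.distrib mult_ac)
      (intro arg_cong2[where f = "(+)"] sum.swap)
  also have "\<dots> = 0"
  proof (intro sum.neutral ballI)
    fix \<beta> assume \<beta>: "\<beta> \<in> pos D"
    then have root: "\<beta> \<in> roots D" by (rule pos_roots)
    have neg: "Xt (- cvec (iota D \<beta>)) x = s (-1) (Xt (cvec (iota D \<beta>)) x)"
      using Xt_scale_vec[of "-1" "cvec (iota D \<beta>)" x] by simp
    show "s (1/2 * par D \<beta>) (Xt (\<Sum>i\<in>UNIV. cfun \<beta> (b' i) *s b i) (S (refl D \<beta>) x)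
      + S (refl D \<beta>) (Xt (\<Sum>i\<in>UNIV. cfun \<beta> (b i) *s b' i) x)) = 0"
      using root unfolding dual_pair_iota[OF assms root] dual_pair_iota[OF dual_pair_sym[OF assms] root]
      by (simp add: Xt_pos[OF \<beta>] crefl_iota neg S_scale refl_weyl del: scale_minus_left) simp
  qed
  finally have "(\<Sum>i\<in>UNIV. Xt (b i) (T (b' i) x)) + (\<Sum>i\<in>UNIV. T (b i) (Xt (b' i) x)) = 0" .
  then show ?thesis
    by (simp only: X Xt_add T_add sum.distrib T_Casimir[OF assms]) (simp add: algebra_simps)
qed

end

section \<open>Centrality of the Casimir element\<close>

lemma ring_free_ring: "ring (free_ring :: 'g free_algebra ring)"
proof (rule ringI)
  have "\<exists>y. y + x = 0" for x :: "'g free_algebra" by (rule exI[of _ "- x"]) simp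
  then show "abelian_group (free_ring :: 'g free_algebra ring)"
    by (intro abelian_groupI) (auto simp: free_ring_def add_ac)
  show "Group.monoid (free_ring :: 'g free_algebra ring)"
    by (rule monoidI) (auto simp: free_ring_def mult.assoc)
qed (auto simp: free_ring_def ring_distribs)

lemma free_ring_minus: "x \<ominus>\<^bsub>free_ring\<^esub> y = x - (y :: 'g free_algebra)"
proof -
  interpret ring "free_ring :: 'g free_algebra ring" by (rule ring_free_ring)
  have "\<ominus>\<^bsub>free_ring\<^esub> y = - y"
    by (rule minus_equality) (auto simp: free_ring_def)
  then show ?thesis by (simp add: a_minus_def) (simp add: free_ring_def)
qed

lemma hecke_ideal: "ideal (hecke_ideal D) free_ring"
proof -
  interpret ring "free_ring :: 'n hecke_free ring" by (rule ring_free_ring)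
  show ?thesis unfolding hecke_ideal_def by (rule genideal_ideal) (simp add: free_ring_def)
qed

lemma hcls_eq_iff: "hcls D x = hcls D y \<longleftrightarrow> x - y \<in> hecke_ideal D"
proof -
  interpret ring "free_ring :: 'n hecke_free ring" by (rule ring_free_ring)
  show ?thesis
    unfolding hcls_def
    using quotient_eq_iff_same_a_r_cos[OF hecke_ideal, of x y D]
    by (simp add: free_ring_minus) (simp add: free_ring_def)
qed

lemma hcls_relation: "x - y \<in> hecke_relations D \<Longrightarrow> hcls D x = hcls D y"
proof -
  interpret ring "free_ring :: 'n hecke_free ring" by (rule ring_free_ring)
  assume "x - y \<in> hecke_relations D"
  then show ?thesis
    unfolding hcls_eq_iff hecke_ideal_def using genideal_self[of "hecke_relations D"]
    by (auto simp: free_ring_def)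
qed

lemma hcls_carrier: "hcls D x \<in> carrier (hecke D)"
  and hcls_mult: "hcls D x \<otimes>\<^bsub>hecke D\<^esub> hcls D y = hcls D (x * y)"
  and hcls_add: "hcls D x \<oplus>\<^bsub>hecke D\<^esub> hcls D y = hcls D (x + y)"
  and ring_hecke: "ring (hecke D)"
proof -
  interpret ideal "hecke_ideal D" free_ring by (rule hecke_ideal)
  show "hcls D x \<in> carrier (hecke D)"
    using ring_hom_closed[OF rcos_ring_hom, of x] by (simp add: hcls_def hecke_def free_ring_def)
  show "hcls D x \<otimes>\<^bsub>hecke D\<^esub> hcls D y = hcls D (x * y)"
    using ring_hom_mult[OF rcos_ring_hom, of x y] by (simp add: hcls_def hecke_def free_ring_def)
  show "hcls D x \<oplus>\<^bsub>hecke D\<^esub> hcls D y = hcls D (x + y)"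
    using ring_hom_add[OF rcos_ring_hom, of x y] by (simp add: hcls_def hecke_def free_ring_def)
  show "ring (hecke D)"
    unfolding hecke_def by (rule quotient_is_ring)
qed

lemma hecke_carrierE:
  assumes "h \<in> carrier (hecke D)"
  obtains x where "h = hcls D x"
  using assms by (auto simp: hecke_def FactRing_def A_RCOSETS_def' hcls_def)

lemma hcls_cong_mult: "hcls D x = hcls D x' \<Longrightarrow> hcls D y = hcls D y' \<Longrightarrow> hcls D (x * y) = hcls D (x' * y')"
  by (metis hcls_mult)

lemma hcls_cong_add: "hcls D x = hcls D x' \<Longrightarrow> hcls D y = hcls D y' \<Longrightarrow> hcls D (x + y) = hcls D (x' + y')"
  by (metis hcls_add)

lemma hcls_cong_sum: "(\<And>i. i \<in> A \<Longrightarrow> hcls D (f i) = hcls D (g i)) \<Longrightarrow> hcls D (\<Sum>i\<in>A. f i) = hcls D (\<Sum>i\<in>A. g i)"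
proof (induction A rule: infinite_finite_induct)
  case (insert i A)
  then show ?case using hcls_cong_add[of D "f i" "g i" "sum f A" "sum g A"] by simp
qed simp_all

abbreviation gW :: "(real^'n \<Rightarrow> real^'n) \<Rightarrow> ('n::finite) hecke_free" where "gW w \<equiv> gen (GW w)"
abbreviation gV :: "complex^'n \<Rightarrow> ('n::finite) hecke_free" where "gV v \<equiv> gen (GV v)"

lemma hcls_gW_outside: "w \<notin> weyl D \<Longrightarrow> hcls D (gW w) = hcls D 0"
  by (rule hcls_relation) (auto simp: hecke_relations_def)

lemma hcls_gW_id: "hcls D (gW id) = hcls D 1"
  by (rule hcls_relation) (simp add: hecke_relations_def)

lemma hcls_gW_comp: "w \<in> weyl D \<Longrightarrow> w' \<in> weyl D \<Longrightarrow> hcls D (gW w * gW w') = hcls D (gW (w \<circ> w'))"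
  by (rule hcls_relation, unfold hecke_relations_def) blast

lemma hcls_gV_add: "hcls D (gV (u + v)) = hcls D (gV u + gV v)"
  by (rule hcls_relation, unfold hecke_relations_def) blast

lemma hcls_gV_scale: "hcls D (gV (c *s v)) = hcls D (scal c * gV v)"
  by (rule hcls_relation, unfold hecke_relations_def) blast

lemma hcls_gV_commute: "hcls D (gV u * gV v) = hcls D (gV v * gV u)"
  by (rule hcls_relation, unfold hecke_relations_def) blast

lemma hcls_gV_simple:
  assumes "\<alpha> \<in> simple D"
  shows "hcls D (gV v * gW (refl D \<alpha>)) =
    hcls D (gW (refl D \<alpha>) * gV (crefl D \<alpha> v) + scal (par D \<alpha> * cfun \<alpha> v))"
  by (rule hcls_relation, unfold hecke_relations_def) (use assms in \<open>auto simp: algebra_simps\<close>)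

lemma scal_add: "scal (a + b) = scal a + scal b"
  by (simp add: scal_def single_add)

lemma scal_mult: "scal (a * b) = scal a * scal b"
  by (simp add: scal_def mult_single)

lemma scal_0 [simp]: "scal 0 = 0" and scal_1 [simp]: "scal 1 = 1"
  by (simp_all add: scal_def)

lemma scal_commute: "x * scal c = scal c * x"
proof (induction x rule: poly_mapping_induct_single)
  case (2 k d)
  then show ?case by (simp add: scal_def mult_single mult.commute)
qed (auto simp: ring_distribs)

lemma scal_left_commute: "x * (scal c * y) = scal c * (x * y)"
  by (metis mult.assoc scal_commute)

lemma vector_space_free_algebra: "vector_space (\<lambda>c (x :: 'g free_algebra). scal c * x)"
  by unfold_locales (auto simp: ring_distribs scal_add scal_mult mult.assoc)

lemma free_algebra_induct [case_names scal gen add mult]: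
  fixes x :: "'g free_algebra"
  assumes scal: "\<And>c. P (scal c)" and gen: "\<And>g. P (gen g)"
    and add: "\<And>x y. P x \<Longrightarrow> P y \<Longrightarrow> P (x + y)" and mult: "\<And>x y. P x \<Longrightarrow> P y \<Longrightarrow> P (x * y)"
  shows "P x"
proof (induction x rule: poly_mapping_induct_single)
  case 1 show ?case using scal[of 0] by simp
next
  case (2 k c)
  obtain xs where k: "k = Word xs" by (cases k)
  have "P (Poly_Mapping.single (Word xs) c)"
  proof (induction xs)
    case Nil
    show ?case using scal[of c] by (simp add: scal_def zero_word_def)
  next
    case (Cons g xs)
    then show ?case using mult[OF gen[of g] Cons] by (simp add: gen_def mult_single)
  qed
  then show ?case by (simp add: k)
qed (rule add)

context root_datum begin

text \<open>A representative of v that is linear already in the free algebra, whereas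
  \<open>gV\<close> is linear only modulo the ideal. Basis-change arguments such as
  \<open>dual_pair_sum\<close> can thus run in the free algebra itself.\<close>

definition gL :: "complex^'n \<Rightarrow> 'n hecke_free" where
  "gL v = (\<Sum>j\<in>UNIV. scal (v $ j) * gV (axis j 1))"

lemma gL_add: "gL (u + v) = gL u + gL v"
  by (simp add: gL_def scal_add ring_distribs sum.distrib)

lemma gL_scale: "gL (c *s v) = scal c * gL v"
  by (simp add: gL_def scal_mult sum_distrib_left mult.assoc)

lemma hcls_gL: "hcls D (gL v) = hcls D (gV v)"
proof -
  have "hcls D (gV (\<Sum>j\<in>A. v $ j *s axis j 1)) = hcls D (\<Sum>j\<in>A. scal (v $ j) * gV (axis j 1))" for A :: "'n set"
  proof (induction A rule: infinite_finite_induct)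
    case (insert j A)
    have "hcls D (gV (\<Sum>j\<in>insert j A. v $ j *s axis j 1)) =
      hcls D (gV (v $ j *s axis j 1) + gV (\<Sum>j\<in>A. v $ j *s axis j 1))"
      using insert by (simp add: hcls_gV_add)
    also have "\<dots> = hcls D (scal (v $ j) * gV (axis j 1) + (\<Sum>j\<in>A. scal (v $ j) * gV (axis j 1)))"
      by (intro hcls_cong_add hcls_gV_scale insert.IH)
    finally show ?case using insert by simp
  qed (use hcls_gV_scale[of D 0 0] in auto)
  from this[of UNIV] show ?thesis by (simp add: basis_expansion gL_def)
qed

lemma gL_sum: "gL (\<Sum>i\<in>A. f i) = (\<Sum>i\<in>A. gL (f i))"
  by (induction A rule: infinite_finite_induct) (auto simp: gL_add, simp_all add: gL_def)

lemma hcls_Omega_eq: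
  "hcls D (\<Sum>i\<in>UNIV. gV (b i) * gV (b' i)) = hcls D (\<Sum>i\<in>UNIV. gL (b i) * gL (b' i))"
  by (intro hcls_cong_sum hcls_cong_mult) (simp_all add: hcls_gL)

lemma hcls_gL_simple:
  assumes "\<alpha> \<in> simple D"
  shows "hcls D (gL v * gW (refl D \<alpha>)) =
    hcls D (gW (refl D \<alpha>) * gL (crefl D \<alpha> v) + scal (par D \<alpha> * cfun \<alpha> v))"
proof -
  have "hcls D (gL v * gW (refl D \<alpha>)) = hcls D (gV v * gW (refl D \<alpha>))"
    by (intro hcls_cong_mult hcls_gL refl)
  also have "\<dots> = hcls D (gW (refl D \<alpha>) * gV (crefl D \<alpha> v) + scal (par D \<alpha> * cfun \<alpha> v))"
    by (rule hcls_gV_simple[OF assms])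
  also have "\<dots> = hcls D (gW (refl D \<alpha>) * gL (crefl D \<alpha> v) + scal (par D \<alpha> * cfun \<alpha> v))"
    by (intro hcls_cong_add hcls_cong_mult hcls_gL[symmetric] refl)
  finally show ?thesis .
qed

text \<open>Moving the reflection to the left past both factors leaves first-order corrections that
  sum to a multiple of s_\<alpha>(\<iota>(\<alpha>)) + \<iota>(\<alpha>) = 0. The quadratic part is
  the same element written in the reflected dual pair.\<close>

lemma hcls_Omega_simple:
  assumes "dual_pair b b'" "\<alpha> \<in> simple D"
  shows "hcls D ((\<Sum>i\<in>UNIV. gL (b i) * gL (b' i)) * gW (refl D \<alpha>)) =
    hcls D (gW (refl D \<alpha>) * (\<Sum>i\<in>UNIV. gL (b i) * gL (b' i)))"
proof -
  let ?s = "gW (refl D \<alpha>)" and ?r = "crefl D \<alpha>" and ?k = "par D \<alpha>"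
  have root: "\<alpha> \<in> roots D" using assms(2) simple_pos pos_roots by auto
  have "hcls D (gL u * gL v * ?s) = hcls D (?s * (gL (?r u) * gL (?r v)) +
      scal ?k * (gL (cfun \<alpha> u *s ?r v) + gL (cfun \<alpha> v *s u)))" for u v
  proof -
    have "hcls D (gL u * (gL v * ?s)) = hcls D (gL u * (?s * gL (?r v) + scal (?k * cfun \<alpha> v)))"
      by (rule hcls_cong_mult[OF refl hcls_gL_simple[OF assms(2)]])
    also have "\<dots> = hcls D (gL u * ?s * gL (?r v) + scal (?k * cfun \<alpha> v) * gL u)"
      by (simp add: ring_distribs mult.assoc scal_commute)
    also have "\<dots> = hcls D ((?s * gL (?r u) + scal (?k * cfun \<alpha> u)) * gL (?r v) + scal (?k * cfun \<alpha> v) * gL u)"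
      by (intro hcls_cong_add hcls_cong_mult hcls_gL_simple[OF assms(2)] refl)
    finally show ?thesis by (simp add: ring_distribs mult.assoc gL_scale scal_mult add_ac)
  qed
  then have "hcls D (\<Sum>i\<in>UNIV. gL (b i) * gL (b' i) * ?s) =
    hcls D (\<Sum>i\<in>UNIV. ?s * (gL (?r (b i)) * gL (?r (b' i))) +
      scal ?k * (gL (cfun \<alpha> (b i) *s ?r (b' i)) + gL (cfun \<alpha> (b' i) *s b i)))"
    by (intro hcls_cong_sum) auto
  also have "(\<Sum>i\<in>UNIV. ?s * (gL (?r (b i)) * gL (?r (b' i))) +
      scal ?k * (gL (cfun \<alpha> (b i) *s ?r (b' i)) + gL (cfun \<alpha> (b' i) *s b i))) =
    ?s * (\<Sum>i\<in>UNIV. gL (?r (b i)) * gL (?r (b' i))) +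
      scal ?k * (gL (?r (\<Sum>i\<in>UNIV. cfun \<alpha> (b i) *s b' i)) + gL (\<Sum>i\<in>UNIV. cfun \<alpha> (b' i) *s b i))"
    by (simp only: sum.distrib sum_distrib_left gL_sum crefl_sum crefl_scale ring_distribs)
  also have "gL (?r (\<Sum>i\<in>UNIV. cfun \<alpha> (b i) *s b' i)) + gL (\<Sum>i\<in>UNIV. cfun \<alpha> (b' i) *s b i) = 0"
    unfolding dual_pair_iota[OF assms(1) root] dual_pair_iota[OF dual_pair_sym[OF assms(1)] root]
    using gL_scale[of 0 0] by (simp add: crefl_iota root flip: gL_add)
  also have "(\<Sum>i\<in>UNIV. gL (?r (b i)) * gL (?r (b' i))) = (\<Sum>i\<in>UNIV. gL (b i) * gL (b' i))"
    by (rule dual_pair_sum[OF dual_pair_crefl[OF assms(1) root] assms(1) vector_space_free_algebra])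
      (simp_all add: gL_add gL_scale ring_distribs mult.assoc scal_left_commute)
  finally show ?thesis by (simp add: sum_distrib_right)
qed

text \<open>Commuting with this element modulo the ideal is stable under sums and products, so
  generators decide, and among the group elements the simple reflections.\<close>

lemma hOmega_central:
  assumes "dual_pair b b'"
  shows "hOmega D b b' \<in> hecke_center D"
proof -
  let ?O = "\<Sum>i\<in>UNIV. gL (b i) * gL (b' i)"
  have mult: "hcls D (?O * (x * y)) = hcls D ((x * y) * ?O)"
    if "hcls D (?O * x) = hcls D (x * ?O)" "hcls D (?O * y) = hcls D (y * ?O)" for x y
  proof -
    have "hcls D ((?O * x) * y) = hcls D ((x * ?O) * y)"
      by (rule hcls_cong_mult[OF that(1) refl])
    also have "\<dots> = hcls D (x * (y * ?O))"
      unfolding mult.assoc by (rule hcls_cong_mult[OF refl that(2)])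
    finally show ?thesis by (simp add: mult.assoc)
  qed
  have cong: "hcls D (?O * x) = hcls D (x * ?O)"
    if "hcls D (?O * y) = hcls D (y * ?O)" "hcls D x = hcls D y" for x y
    using hcls_cong_mult[OF refl that(2), of ?O] hcls_cong_mult[OF that(2) refl, of ?O] that(1) by simp
  have commute: "hcls D (?O * x) = hcls D (x * ?O)" for x
  proof (induction x rule: free_algebra_induct)
    case (scal c)
    show ?case by (simp add: scal_commute)
  next
    case (gen g)
    show ?case
    proof (cases g)
      case (GV v)
      have comm: "hcls D (gL u * gL v) = hcls D (gL v * gL u)" for u v
        using hcls_cong_mult[OF hcls_gL hcls_gL, of u v] hcls_cong_mult[OF hcls_gL hcls_gL, of v u]
          hcls_gV_commute[of D u v] by simp
      have "hcls D (gL (b i) * (gL (b' i) * gL v)) = hcls D (gL v * (gL (b i) * gL (b' i)))" for i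
      proof -
        have "hcls D (gL (b i) * (gL (b' i) * gL v)) = hcls D (gL (b i) * (gL v * gL (b' i)))"
          by (rule hcls_cong_mult[OF refl comm])
        also have "\<dots> = hcls D ((gL v * gL (b i)) * gL (b' i))"
          unfolding mult.assoc[symmetric] by (rule hcls_cong_mult[OF comm refl])
        finally show ?thesis by (simp add: mult.assoc)
      qed
      then have "hcls D (?O * gL v) = hcls D (gL v * ?O)"
        unfolding sum_distrib_left sum_distrib_right mult.assoc by (intro hcls_cong_sum)
      then show ?thesis using cong[OF _ hcls_gL[symmetric]] GV by simp
    next
      case (GW w)
      have "hcls D (?O * gW w) = hcls D (gW w * ?O)"
      proof (cases "w \<in> weyl D")
        case False
        then show ?thesis by (intro cong[OF _ hcls_gW_outside]) simp_all
      next
        case True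
        then show ?thesis
        proof (induction rule: weyl_simple_induct)
          case id
          show ?case by (rule cong[OF _ hcls_gW_id]) simp
        next
          case (simple \<alpha>)
          show ?case by (rule hcls_Omega_simple[OF assms simple])
        next
          case (comp w w')
          show ?case
            by (rule cong[OF mult[OF comp(3,4)]]) (rule hcls_gW_comp[OF comp(1,2), symmetric])
        qed
      qed
      then show ?thesis using GW by simp
    qed
  next
    case (add x y)
    then show ?case unfolding ring_distribs by (rule hcls_cong_add)
  qed (rule mult)
  have O: "hOmega D b b' = hcls D ?O"
    unfolding hOmega_def by (rule hcls_Omega_eq)
  show ?thesis
    unfolding hecke_center_def O
  proof (intro CollectI conjI ballI hcls_carrier)
    fix h assume "h \<in> carrier (hecke D)"
    then obtain x where "h = hcls D x" by (rule hecke_carrierE)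
    then show "hcls D ?O \<otimes>\<^bsub>hecke D\<^esub> h = h \<otimes>\<^bsub>hecke D\<^esub> hcls D ?O"
      by (simp add: hcls_mult commute)
  qed
qed

end

section \<open>Schur's lemma\<close>

text \<open>The vector p(f) u. Keeping u explicit allows a polynomial that annihilates a single
  vector, without a minimal polynomial of f.\<close>

definition poly_op :: "(complex \<Rightarrow> 'u \<Rightarrow> 'u) \<Rightarrow> ('u \<Rightarrow> 'u) \<Rightarrow> complex poly \<Rightarrow> 'u \<Rightarrow> 'u::ab_group_add" where
  "poly_op s f p u = (\<Sum>k\<le>degree p. s (poly.coeff p k) ((f ^^ k) u))"

lemma poly_op_bound:
  assumes "vector_space s" and "degree p \<le> n"
  shows "poly_op s f p u = (\<Sum>k\<le>n. s (poly.coeff p k) ((f ^^ k) u))"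
proof -
  interpret vector_space s by fact
  show ?thesis
    unfolding poly_op_def using assms(2)
    by (intro sum.mono_neutral_left) (auto simp: coeff_eq_0)
qed

lemma poly_op_diff:
  assumes "vector_space s"
  shows "poly_op s f (p - q) u = poly_op s f p u - poly_op s f q u"
proof -
  interpret vector_space s by fact
  show ?thesis
    unfolding poly_op_bound[OF assms degree_diff_le_max]
      poly_op_bound[OF assms max.cobounded1[of "degree p" "degree q"]]
      poly_op_bound[OF assms max.cobounded2[of "degree q" "degree p"]]
    by (simp add: scale_left_diff_distrib sum_subtractf)
qed

lemma poly_op_pCons_0:
  assumes "vector_space s"
  shows "poly_op s f (pCons 0 p) u = poly_op s f p (f u)"
proof -
  interpret vector_space s by fact
  have "poly_op s f (pCons 0 p) u = (\<Sum>k\<le>Suc (degree p). s (poly.coeff (pCons 0 p) k) ((f ^^ k) u))"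
    by (rule poly_op_bound[OF assms]) (rule degree_pCons_le)
  then show ?thesis
    by (subst (asm) sum.atMost_Suc_shift) (simp add: poly_op_def funpow_swap1)
qed

lemma poly_op_smult:
  assumes "Vector_Spaces.linear s s f"
  shows "poly_op s f (smult c p) u = poly_op s f p (s c u)"
proof -
  interpret Vector_Spaces.linear s s f by fact
  have "(f ^^ k) (s c u) = s c ((f ^^ k) u)" for k by (induction k) (simp_all add: scale)
  moreover have "poly_op s f (smult c p) u = (\<Sum>k\<le>degree p. s (poly.coeff (smult c p) k) ((f ^^ k) u))"
    by (rule poly_op_bound) (simp_all add: vs1.vector_space_axioms degree_smult_le)
  ultimately show ?thesis
    by (simp add: poly_op_def mult.commute)
qed

lemma poly_op_sub:
  assumes "Vector_Spaces.linear s s f"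
  shows "poly_op s f p (u - v) = poly_op s f p u - poly_op s f p v"
proof -
  interpret Vector_Spaces.linear s s f by fact
  have "(f ^^ k) (u - v) = (f ^^ k) u - (f ^^ k) v" for k
    by (induction k) (simp_all add: diff)
  then show ?thesis by (simp add: poly_op_def vs1.scale_right_diff_distrib sum_subtractf)
qed

text \<open>Split off a root a of p. Either u is already an eigenvector for a, or f u - a u is a
  nonzero vector annihilated by the cofactor of smaller degree.\<close>

lemma eigenvector_of_annihilating_poly:
  fixes s :: "complex \<Rightarrow> 'u \<Rightarrow> 'u::ab_group_add"
  assumes lin: "Vector_Spaces.linear s s f"
    and "p \<noteq> 0" "u \<noteq> 0" "poly_op s f p u = 0"
  shows "\<exists>c v. v \<noteq> 0 \<and> f v = s c v"
  using assms(2-)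
proof (induction "degree p" arbitrary: p u)
  case 0
  interpret Vector_Spaces.linear s s f by fact
  have "s (poly.coeff p 0) u = 0" using 0 by (simp add: poly_op_def)
  then have "poly.coeff p 0 = 0" using 0 by simp
  then have "p = 0" using 0 by (metis leading_coeff_0_iff)
  then show ?case using 0 by simp
next
  case (Suc n)
  interpret Vector_Spaces.linear s s f by fact
  have "\<not> constant (poly p)" using Suc(2) by (simp add: constant_degree)
  then obtain a where "poly p a = 0" using fundamental_theorem_of_algebra by blast
  then obtain q where q: "p = [:- a, 1:] * q" by (auto simp: poly_eq_0_iff_dvd elim: dvdE)
  then have "q \<noteq> 0" using Suc(3) by auto
  then have deg: "n = degree q"
    using Suc(2) unfolding q by (subst (asm) degree_mult_eq) auto
  have "p = pCons 0 q - smult a q" by (simp add: q)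
  then have "poly_op s f p u = poly_op s f q (f u - s a u)"
    by (simp add: poly_op_diff poly_op_pCons_0 poly_op_smult poly_op_sub lin vs1.vector_space_axioms)
  then show ?case using Suc(1)[OF deg \<open>q \<noteq> 0\<close>, of "f u - s a u"] Suc(4,5)
    by (cases "f u - s a u = 0") auto
qed

text \<open>One more iterate of u than \<open>B\<close> has elements forces a linear relation, that
  is, an annihilating polynomial for u. Dependence is a notion for sets, hence the separate case of
  repeated iterates.\<close>

lemma eigenvector_in_finite_span:
  fixes s :: "complex \<Rightarrow> 'u \<Rightarrow> 'u::ab_group_add"
  assumes lin: "Vector_Spaces.linear s s f"
    and B: "finite B" "\<And>k. (f ^^ k) u \<in> module.span s B" and u: "u \<noteq> 0"
  shows "\<exists>c v. v \<noteq> 0 \<and> f v = s c v"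
proof -
  interpret Vector_Spaces.linear s s f by fact
  let ?g = "\<lambda>k. (f ^^ k) u" and ?n = "card B"
  have "\<exists>c. (\<exists>k\<le>?n. c k \<noteq> 0) \<and> (\<Sum>k\<le>?n. s (c k) (?g k)) = 0"
  proof (cases "inj_on ?g {..?n}")
    case True
    have "vs1.dependent (?g ` {..?n})"
    proof (rule ccontr)
      assume "vs1.independent (?g ` {..?n})"
      then have "card (?g ` {..?n}) \<le> card B"
        using vs1.independent_span_bound[OF B(1)] B(2) by blast
      then show False by (simp add: card_image[OF True])
    qed
    then obtain c where "\<exists>v\<in>?g ` {..?n}. c v \<noteq> 0" "(\<Sum>v\<in>?g ` {..?n}. s (c v) v) = 0"
      unfolding vs1.dependent_finite[OF finite_imageI[OF finite_atMost]] by blast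
    then show ?thesis
      by (intro exI[of _ "c \<circ> ?g"]) (auto simp: sum.reindex[OF True])
  next
    case False
    then obtain i j where ij: "i \<le> ?n" "j \<le> ?n" "i \<noteq> j" "?g i = ?g j"
      by (auto simp: inj_on_def)
    \<comment> \<open>Two equal iterates correspond to the polynomial X^i - X^j.\<close>
    let ?c = "\<lambda>k. (if k = i then 1 else 0) - (if k = j then 1 else 0 :: complex)"
    have "(\<Sum>k\<le>?n. s (?c k) (?g k)) = (\<Sum>k\<le>?n. if k = i then ?g i else 0) - (\<Sum>k\<le>?n. if k = j then ?g j else 0)"
      unfolding sum_subtractf[symmetric] by (intro sum.cong refl) (auto simp: vs1.scale_left_diff_distrib)
    then have "(\<Sum>k\<le>?n. s (?c k) (?g k)) = 0" using ij by simp
    then show ?thesis using ij by (intro exI[of _ ?c]) auto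
  qed
  then obtain c where c: "\<exists>k\<le>?n. c k \<noteq> 0" "(\<Sum>k\<le>?n. s (c k) (?g k)) = 0" by blast
  define p where "p = (\<Sum>k\<le>?n. monom (c k) k)"
  have coeff: "poly.coeff p k = (if k \<le> ?n then c k else 0)" for k
    by (simp add: p_def coeff_sum)
  have "p \<noteq> 0" using c(1) coeff by (metis coeff_0)
  moreover have "degree p \<le> ?n" by (rule degree_le) (simp add: coeff)
  then have "poly_op s f p u = 0"
    using c(2) by (simp add: poly_op_bound[OF vs1.vector_space_axioms] coeff)
  ultimately show ?thesis using eigenvector_of_annihilating_poly[OF lin _ u] by blast
qed

text \<open>In the zero space every scalar qualifies and the description has no unique value; the
  nonzero witness excludes this.\<close>

lemma scalar_of_eqI:
  fixes s :: "complex \<Rightarrow> 'u \<Rightarrow> 'u::ab_group_add" and x :: 'u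
  assumes "vector_space s" and "x \<noteq> 0" and "\<And>x. f x = s c x"
  shows "scalar_of s f = c"
proof -
  interpret vector_space s by fact
  show ?thesis
    unfolding scalar_of_def
  proof (rule the_equality)
    fix c' assume "\<forall>m. f m = s c' m"
    then have "s c' x = s c x" using assms(3)[of x] by simp
    then show "c' = c" using assms(2) by simp
  qed (use assms(3) in blast)
qed

context root_datum begin

lemma irreducible_weyl_rep:
  fixes sU :: "complex \<Rightarrow> 'u \<Rightarrow> 'u::ab_group_add"
  assumes "irreducible_rep D sU \<sigma>"
  shows "weyl_rep D sU \<sigma>"
proof -
  interpret vector_space sU using assms by (simp add: irreducible_rep_def)
  have "Vector_Spaces.linear sU sU (\<sigma> w)" if "w \<in> weyl D" for w
    using assms that by (simp add: irreducible_rep_def)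
  note lin = this[unfolded Vector_Spaces.linear_iff]
  show ?thesis
  proof unfold_locales
    show "\<sigma> id x = x" for x using assms by (simp add: irreducible_rep_def)
    show "\<sigma> (w \<circ> w') x = \<sigma> w (\<sigma> w' x)" if "w \<in> weyl D" "w' \<in> weyl D" for w w' x
      using assms that by (simp add: irreducible_rep_def)
  qed (use lin in auto)
qed

text \<open>Since W is finite, the orbit of a nonzero vector has a finite-dimensional span, stable
  under \<open>Omega_W\<close>, so an eigenvector exists there. Its eigenspace in the whole of
  \<sigma> is W-stable, hence everything by irreducibility.\<close>

lemma Omega_W_scalar:
  fixes sU :: "complex \<Rightarrow> 'u \<Rightarrow> 'u::ab_group_add"
  assumes irr: "irreducible_rep D sU \<sigma>"
  shows "Omega_W D sU \<sigma> u = sU (scalar_of sU (Omega_W D sU \<sigma>)) u"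
proof -
  interpret weyl_rep D sU \<sigma> by (rule irreducible_weyl_rep[OF irr])
  let ?O = "Omega_W D sU \<sigma>"
  obtain u0 :: 'u where u0: "u0 \<noteq> 0" using irr by (auto simp: irreducible_rep_def)
  have lin: "Vector_Spaces.linear sU sU ?O"
    unfolding Vector_Spaces.linear_iff
    by (simp add: vector_space_axioms Omega_W_add Omega_W_scale)
  interpret O: Vector_Spaces.linear sU sU ?O by (rule lin)
  let ?B = "(\<lambda>w. \<sigma> w u0) ` weyl D"
  have O_span: "?O v \<in> span ?B" if "v \<in> span ?B" for v
  proof -
    have "?O ` span ?B = span (?O ` ?B)" by (simp add: O.span_image)
    also have "?O ` ?B \<subseteq> span ?B"
    proof clarify
      fix w assume w: "w \<in> weyl D"
      have "\<sigma> (refl D \<alpha> \<circ> refl D \<beta>) (\<sigma> w u0) \<in> span ?B" if "\<alpha> \<in> pos D" "\<beta> \<in> pos D" for \<alpha> \<beta>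
      proof -
        have "refl D \<alpha> \<circ> refl D \<beta> \<in> weyl D" using that pos_weyl weyl_comp by blast
        then have "\<sigma> (refl D \<alpha> \<circ> refl D \<beta>) (\<sigma> w u0) = \<sigma> (refl D \<alpha> \<circ> refl D \<beta> \<circ> w) u0"
            "refl D \<alpha> \<circ> refl D \<beta> \<circ> w \<in> weyl D"
          using w by (simp_all only: S_comp weyl_comp)
        then show ?thesis by (metis (no_types, lifting) imageI span_base)
      qed
      then show "?O (\<sigma> w u0) \<in> span ?B"
        unfolding Omega_W_def by (intro span_sum span_scale)
    qed
    then have "span (?O ` ?B) \<subseteq> span ?B" by (metis span_mono span_span)
    finally show ?thesis using that by blast
  qed
  have "u0 \<in> ?B" using S_id[of u0] weyl_id by (metis imageI)
  then have "(?O ^^ k) u0 \<in> span ?B" for k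
    by (induction k) (auto intro: O_span span_base)
  then obtain c v where cv: "v \<noteq> 0" "?O v = sU c v"
    using eigenvector_in_finite_span[OF lin finite_imageI[OF finite_weyl] _ u0] by blast
  let ?E = "{v. ?O v = sU c v}"
  have "subspace ?E"
    by (rule subspaceI) (auto simp: O.add O.scale scale_right_distrib O.zero mult.commute)
  moreover have "\<forall>w\<in>weyl D. \<forall>u\<in>?E. \<sigma> w u \<in> ?E"
    by (auto simp: Omega_W_commute S_scale)
  ultimately have "?E = {0} \<or> ?E = UNIV"
    using irr unfolding irreducible_rep_def by blast
  then have E: "?O u = sU c u" for u using cv by blast
  then show ?thesis using scalar_of_eqI[OF vector_space_axioms u0, of ?O c] by simp
qed

section \<open>Hecke modules as families of operators\<close>

lemma hecke_module_rep:
  assumes mod: "hecke_module D sM \<pi>"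
  shows "hecke_rep D sM (\<lambda>w. \<pi> (hW D w)) (\<lambda>v. \<pi> (hcls D (gV v)))"
    and "\<pi> (hcls D (x * y)) m = \<pi> (hcls D x) (\<pi> (hcls D y) m)"
    and "\<pi> (hcls D (x + y)) m = \<pi> (hcls D x) m + \<pi> (hcls D y) m"
    and "\<pi> (hcls D (scal c)) m = sM c m"
    and "\<pi> (hcls D x) (m + m') = \<pi> (hcls D x) m + \<pi> (hcls D x) m'"
    and "\<pi> (hcls D x) (sM c m) = sM c (\<pi> (hcls D x) m)"
proof -
  interpret vector_space sM using mod by (simp add: hecke_module_def)
  have mult: "\<pi> (hcls D (x * y)) m = \<pi> (hcls D x) (\<pi> (hcls D y) m)" for x y m
    using mod hcls_carrier[of D] unfolding hecke_module_def by (metis hcls_mult)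
  have add: "\<pi> (hcls D (x + y)) m = \<pi> (hcls D x) m + \<pi> (hcls D y) m" for x y m
    using mod hcls_carrier[of D] unfolding hecke_module_def by (metis hcls_add)
  have scal: "\<pi> (hcls D (scal c)) m = sM c m" for c m
    using mod by (simp add: hecke_module_def)
  have "Vector_Spaces.linear sM sM (\<pi> (hcls D x))" for x
    using mod hcls_carrier[of D] by (simp add: hecke_module_def)
  note lin = this[unfolded Vector_Spaces.linear_iff]
  have comp: "\<pi> (hW D (w \<circ> w')) m = \<pi> (hW D w) (\<pi> (hW D w') m)" if "w \<in> weyl D" "w' \<in> weyl D" for w w' m
    using hcls_gW_comp[OF that] by (simp add: hW_def flip: mult)
  have id: "\<pi> (hW D id) m = m" for m
    using scal[of 1 m] by (simp add: hW_def hcls_gW_id)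
  show "hecke_rep D sM (\<lambda>w. \<pi> (hW D w)) (\<lambda>v. \<pi> (hcls D (gV v)))"
  proof unfold_locales
    show "\<pi> (hcls D (gV u)) (\<pi> (hcls D (gV v)) m) = \<pi> (hcls D (gV v)) (\<pi> (hcls D (gV u)) m)" for u v m
      using hcls_gV_commute[of D u v] by (simp flip: mult)
    show "\<pi> (hcls D (gV v)) (\<pi> (hW D (refl D \<alpha>)) m) =
      \<pi> (hW D (refl D \<alpha>)) (\<pi> (hcls D (gV (crefl D \<alpha> v))) m) + sM (par D \<alpha> * cfun \<alpha> v) m"
      if "\<alpha> \<in> simple D" for \<alpha> v m
      using hcls_gV_simple[OF that, of v] by (simp add: hW_def flip: mult scal add)
  qed (use lin comp id in \<open>auto simp: hW_def hcls_gV_add hcls_gV_scale add mult scal\<close>)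
  show "\<pi> (hcls D (x * y)) m = \<pi> (hcls D x) (\<pi> (hcls D y) m)"
    "\<pi> (hcls D (x + y)) m = \<pi> (hcls D x) m + \<pi> (hcls D y) m"
    "\<pi> (hcls D (scal c)) m = sM c m"
    by (fact mult add scal)+
  show "\<pi> (hcls D x) (m + m') = \<pi> (hcls D x) m + \<pi> (hcls D x) m'"
    "\<pi> (hcls D x) (sM c m) = sM c (\<pi> (hcls D x) m)"
    using lin by auto
qed

end

section \<open>The form on the tensor product\<close>

locale sesquilinear_form = vector_space s
  for s :: "complex \<Rightarrow> 'm \<Rightarrow> 'm::ab_group_add" +
  fixes f :: "'m \<Rightarrow> 'm \<Rightarrow> complex"
  assumes f_add_left: "f (x + y) z = f x z + f y z"
    and f_add_right: "f z (x + y) = f z x + f z y"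
    and f_scale_left: "f (s c x) z = cnj c * f x z"
    and f_scale_right: "f z (s c x) = c * f z x"
begin

lemma f_0_left [simp]: "f 0 z = 0" and f_0_right [simp]: "f z 0 = 0"
  using f_add_left[of 0 0 z] f_add_right[of z 0 0] by simp_all

lemma f_uminus_left: "f (- x) z = - f x z" and f_uminus_right: "f z (- x) = - f z x"
  using f_scale_left[of "-1" x z] f_scale_right[of z "-1" x] by simp_all

lemma f_diff_left: "f (x - y) z = f x z - f y z" and f_diff_right: "f z (x - y) = f z x - f z y"
  using f_add_left[of x "- y" z] f_add_right[of z x "- y"] by (simp_all add: f_uminus_left f_uminus_right)

lemma f_sum_left: "f (\<Sum>i\<in>A. g i) z = (\<Sum>i\<in>A. f (g i) z)"
  by (induction A rule: infinite_finite_induct) (auto simp: f_add_left)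

lemma f_sum_right: "f z (\<Sum>i\<in>A. g i) = (\<Sum>i\<in>A. f z (g i))"
  by (induction A rule: infinite_finite_induct) (auto simp: f_add_right)

lemma tensor_form_add_left: "tensor_form D f (x + x') y = tensor_form D f x y + tensor_form D f x' y"
  unfolding tensor_form_def
  by (rule poly_mapping_sum_keys_add) (auto simp: f_add_left ring_distribs sum.distrib)

lemma tensor_form_add_right: "tensor_form D f x (y + y') = tensor_form D f x y + tensor_form D f x y'"
  unfolding tensor_form_def sum.distrib[symmetric]
  by (intro sum.cong refl poly_mapping_sum_keys_add) (auto simp: f_add_right ring_distribs)

lemma tensor_form_0_left [simp]: "tensor_form D f 0 y = 0"
  and tensor_form_0_right [simp]: "tensor_form D f x 0 = 0"
  by (simp_all add: tensor_form_def)

lemma tensor_form_sum_left: "tensor_form D f (\<Sum>i\<in>A. g i) y = (\<Sum>i\<in>A. tensor_form D f (g i) y)"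
  by (induction A rule: infinite_finite_induct) (auto simp: tensor_form_add_left)

lemma tensor_form_sum_right: "tensor_form D f y (\<Sum>i\<in>A. g i) = (\<Sum>i\<in>A. tensor_form D f y (g i))"
  by (induction A rule: infinite_finite_induct) (auto simp: tensor_form_add_right)

lemma lookup_pure_tensor [simp]:
  "Poly_Mapping.lookup (pure_tensor s m P) \<mu> = s (Poly_Mapping.lookup P \<mu>) m"
  by (simp add: pure_tensor_def map.rep_eq when_def)

lemma pure_tensor_add: "pure_tensor s m (P + Q) = pure_tensor s m P + pure_tensor s m Q"
  by (rule poly_mapping_eqI) (simp add: lookup_add scale_left_distrib)

lemma pure_tensor_0: "pure_tensor s m 0 = 0"
  by (rule poly_mapping_eqI) simp

lemma pure_tensor_single: "pure_tensor s m (Poly_Mapping.single \<mu> c) = Poly_Mapping.single \<mu> (s c m)"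
  by (rule poly_mapping_eqI) (simp add: lookup_single when_def)

lemma tensor_form_single:
  "tensor_form D f (Poly_Mapping.single \<mu> a) (Poly_Mapping.single \<nu> b) =
    f a b * poly_form D (monom_poly \<mu>) (monom_poly \<nu>)"
  by (cases "a = 0"; cases "b = 0") (simp_all add: tensor_form_def)

lemma tensor_form_pure:
  "tensor_form D f (pure_tensor s m P) (pure_tensor s m' Q) = f m m' * poly_form D P Q"
proof (induction P rule: poly_mapping_induct_single)
  case (2 \<mu> c)
  show ?case
  proof (induction Q rule: poly_mapping_induct_single)
    case (2 \<nu> d)
    have *: "Poly_Mapping.single \<mu> c = const c * monom_poly \<mu>" for \<mu> and c :: complex
      by (simp add: monom_poly_def mult_single)
    have "poly_form D (Poly_Mapping.single \<mu> c) (Poly_Mapping.single \<nu> d) =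
      cnj c * d * poly_form D (monom_poly \<mu>) (monom_poly \<nu>)"
      unfolding *[of \<mu>] *[of \<nu>] poly_form_const_mult_left poly_form_const_mult_right by simp
    then show ?case
      by (simp add: pure_tensor_single tensor_form_single f_scale_left f_scale_right)
  qed (auto simp: pure_tensor_0 pure_tensor_add tensor_form_add_right poly_form_add_right ring_distribs)
qed (auto simp: pure_tensor_0 pure_tensor_add tensor_form_add_left poly_form_add_left ring_distribs)

text \<open>The monomial sums are brought to the outside, so that identities between such forms can
  be checked for one pair of pure tensors at a time.\<close>

lemma tensor_form_ops:
  "tensor_form D f (\<Sum>i\<in>I. tensor_op s (A i) (L i) x) (\<Sum>j\<in>J. tensor_op s (A' j) (L' j) y) =
    (\<Sum>\<mu>\<in>Poly_Mapping.keys x. \<Sum>\<nu>\<in>Poly_Mapping.keys y. \<Sum>i\<in>I. \<Sum>j\<in>J.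
      f (A i (Poly_Mapping.lookup x \<mu>)) (A' j (Poly_Mapping.lookup y \<nu>)) *
      poly_form D (L i (monom_poly \<mu>)) (L' j (monom_poly \<nu>)))"
proof -
  have "tensor_form D f (\<Sum>i\<in>I. tensor_op s (A i) (L i) x) (\<Sum>j\<in>J. tensor_op s (A' j) (L' j) y) =
    (\<Sum>i\<in>I. \<Sum>\<mu>\<in>Poly_Mapping.keys x. \<Sum>j\<in>J. \<Sum>\<nu>\<in>Poly_Mapping.keys y.
      f (A i (Poly_Mapping.lookup x \<mu>)) (A' j (Poly_Mapping.lookup y \<nu>)) *
      poly_form D (L i (monom_poly \<mu>)) (L' j (monom_poly \<nu>)))"
    unfolding tensor_op_def tensor_form_sum_left unfolding tensor_form_sum_right tensor_form_pure ..
  also have "\<dots> = (\<Sum>\<mu>\<in>Poly_Mapping.keys x. \<Sum>i\<in>I. \<Sum>\<nu>\<in>Poly_Mapping.keys y. \<Sum>j\<in>J.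
      f (A i (Poly_Mapping.lookup x \<mu>)) (A' j (Poly_Mapping.lookup y \<nu>)) *
      poly_form D (L i (monom_poly \<mu>)) (L' j (monom_poly \<nu>)))"
    by (subst sum.swap) (intro sum.cong refl sum.swap)
  also have "\<dots> = (\<Sum>\<mu>\<in>Poly_Mapping.keys x. \<Sum>\<nu>\<in>Poly_Mapping.keys y. \<Sum>i\<in>I. \<Sum>j\<in>J.
      f (A i (Poly_Mapping.lookup x \<mu>)) (A' j (Poly_Mapping.lookup y \<nu>)) *
      poly_form D (L i (monom_poly \<mu>)) (L' j (monom_poly \<nu>)))"
    by (intro sum.cong refl sum.swap)
  finally show ?thesis .
qed

lemma tensor_op_ident: "tensor_op s (\<lambda>m. m) (\<lambda>P. P) x = x"
  unfolding tensor_op_def monom_poly_def pure_tensor_single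
  using poly_mapping_sum_singles[of x] by simp

lemma tensor_form_op_left:
  "tensor_form D f (\<Sum>i\<in>I. tensor_op s (A i) (L i) x) y =
    (\<Sum>\<mu>\<in>Poly_Mapping.keys x. \<Sum>\<nu>\<in>Poly_Mapping.keys y. \<Sum>i\<in>I.
      f (A i (Poly_Mapping.lookup x \<mu>)) (Poly_Mapping.lookup y \<nu>) *
      poly_form D (L i (monom_poly \<mu>)) (monom_poly \<nu>))"
  \<comment> \<open>The missing operator on the right is supplied as the identity, summed over a
    one-element index set.\<close>
  using tensor_form_ops[of D A L x I "\<lambda>_. \<lambda>m. m" "\<lambda>_. \<lambda>P. P" y "{()}"]
  by (simp add: tensor_op_ident)

end

lemma poly_form_sum_left: "poly_form D (\<Sum>i\<in>A. g i) Q = (\<Sum>i\<in>A. poly_form D (g i) Q)"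
  by (induction A rule: infinite_finite_induct) (auto simp: poly_form_add_left)

lemma dform_add: "dform D (u + v) P = dform D u P + dform D v P"
  by (simp add: deriv_fun_def cform_add_left single_add ring_distribs sum.distrib)

lemma dform_scale: "dform D (c *s v) P = const c * dform D v P"
  by (simp add: deriv_fun_def cform_scale_left sum_distrib_left mult.assoc flip: const_mult_const)

lemma dform_0_vec: "dform D 0 P = 0"
  using dform_add[of D 0 0 P] by simp

lemma dform_sum: "dform D (\<Sum>i\<in>A. g i) P = (\<Sum>i\<in>A. dform D (g i) P)"
  by (induction A rule: infinite_finite_induct) (auto simp: dform_add dform_0_vec)

lemma vec_poly_0 [simp]: "vec_poly 0 = 0"
  by (simp add: vec_poly_def)

lemma vec_poly_sum: "vec_poly (\<Sum>i\<in>A. g i) = (\<Sum>i\<in>A. vec_poly (g i))"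
  by (induction A rule: infinite_finite_induct) (auto simp: vec_poly_add)

section \<open>Hermitian Hecke modules and the commutator identity\<close>

locale hermitian_hecke_rep = hecke_rep D s S X + sesquilinear_form s f
  for D :: "('n::finite) hecke_datum" and s :: "complex \<Rightarrow> 'm \<Rightarrow> 'm::ab_group_add" and S X f +
  assumes Xt_adjoint: "f (Xt (cvec v) x) y = - f x (Xt (cvec v) y)"
begin

text \<open>Here complex bases are traded for real ones. For fixed i the sum over j is linear in the
  basis vectors; the sum over i is conjugate-linear, which \<open>dual_pair_sum\<close> covers with
  the scalar action of \<open>cnj a\<close>.\<close>

lemma dual_pair_sesquilinear_sum:
  assumes "dual_pair b b'" "dual_pair c c'"
    and K_add: "\<And>u v P. K (u + v) P = K u P + K v P"
    and K_scale: "\<And>a v P. K (a *s v) P = const a * K v P"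
  shows "(\<Sum>i\<in>UNIV. \<Sum>j\<in>UNIV. f (Xt (b i) x) (Xt (b j) y) * poly_form D (K (b' i) P) (K (b' j) Q)) =
    (\<Sum>i\<in>UNIV. \<Sum>j\<in>UNIV. f (Xt (c i) x) (Xt (c j) y) * poly_form D (K (c' i) P) (K (c' j) Q))"
proof -
  have vs: "vector_space ((*) :: complex \<Rightarrow> _)" "vector_space (\<lambda>a z :: complex. cnj a * z)"
    by unfold_locales (auto simp: ring_distribs mult.assoc)
  have "(\<Sum>i\<in>UNIV. \<Sum>j\<in>UNIV. f (Xt (b i) x) (Xt (b j) y) * poly_form D (K (b' i) P) (K (b' j) Q)) =
    (\<Sum>i\<in>UNIV. \<Sum>j\<in>UNIV. f (Xt (b i) x) (Xt (c j) y) * poly_form D (K (b' i) P) (K (c' j) Q))"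
    by (rule sum.cong[OF refl], rule dual_pair_sum[OF assms(1,2) vs(1)])
      (simp_all add: Xt_add_vec Xt_scale_vec f_add_right f_scale_right K_add K_scale
        poly_form_add_right poly_form_const_mult_right ring_distribs)
  also have "\<dots> = (\<Sum>i\<in>UNIV. \<Sum>j\<in>UNIV. f (Xt (c i) x) (Xt (c j) y) * poly_form D (K (c' i) P) (K (c' j) Q))"
    by (rule dual_pair_sum[OF assms(1,2) vs(2)])
      (simp_all add: Xt_add_vec Xt_scale_vec f_add_left f_scale_left K_add K_scale
        poly_form_add_left poly_form_const_mult_left ring_distribs sum.distrib sum_distrib_left,
        simp_all add: mult_ac)
  finally show ?thesis .
qed

abbreviation bracket :: "((real^'n) \<Rightarrow>\<^sub>L real) \<Rightarrow> ((real^'n) \<Rightarrow>\<^sub>L real) \<Rightarrow> 'm \<Rightarrow> 'm" where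
  "bracket \<alpha> \<beta> x \<equiv> S (refl D \<alpha> \<circ> refl D \<beta>) x - S (refl D \<beta> \<circ> refl D \<alpha>) x"

lemma T_commutator:
  "T u (T v x) - T v (T u x) = (\<Sum>\<alpha>\<in>pos D. \<Sum>\<beta>\<in>pos D.
    s (cfun \<alpha> u * cfun \<beta> v) (s (1/4 * par D \<alpha> * par D \<beta>) (bracket \<alpha> \<beta> x)))"
proof -
  have T2: "T u (T v x) = (\<Sum>\<alpha>\<in>pos D. \<Sum>\<beta>\<in>pos D.
    s (cfun \<alpha> u * cfun \<beta> v * (1/4 * par D \<alpha> * par D \<beta>)) (S (refl D \<alpha> \<circ> refl D \<beta>) x))" for u v
    by (simp add: T_def S_sum S_scale S_comp pos_weyl scale_sum_right mult_ac)
  have "T v (T u x) = (\<Sum>\<alpha>\<in>pos D. \<Sum>\<beta>\<in>pos D.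
    s (cfun \<alpha> u * cfun \<beta> v * (1/4 * par D \<alpha> * par D \<beta>)) (S (refl D \<beta> \<circ> refl D \<alpha>) x))"
    unfolding T2 by (subst sum.swap) (simp add: mult_ac)
  then show ?thesis
    by (simp add: T2 sum_subtractf scale_right_diff_distrib)
qed

text \<open>The values \<alpha>(e_j) \<beta>(e_i) leave the first slot of \<open>f\<close>
  conjugated. The first slot of \<open>poly_form\<close> is conjugate-linear as well, so they can be
  absorbed there and contract the basis vectors to \<iota>(\<beta>) and the derivation along
  \<alpha>.\<close>

lemma commutator_term:
  assumes "dual_pair e e'"
  shows "(\<Sum>i\<in>UNIV. \<Sum>j\<in>UNIV. f (T (e j) (T (e i) x) - T (e i) (T (e j) x)) y *
      poly_form D (vec_poly (e' i) * dform D (e' j) P) Q) =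
    (\<Sum>\<alpha>\<in>pos D. \<Sum>\<beta>\<in>pos D. f (s (1/4 * par D \<alpha> * par D \<beta>) (bracket \<alpha> \<beta> x)) y *
      poly_form D (vec_poly (cvec (iota D \<beta>)) * deriv_fun (cfun \<alpha>) P) Q)"
proof -
  let ?h = "\<lambda>\<alpha> \<beta>. f (s (1/4 * par D \<alpha> * par D \<beta>) (bracket \<alpha> \<beta> x)) y"
  have inner: "(\<Sum>i\<in>UNIV. \<Sum>j\<in>UNIV. cnj (cfun \<alpha> (e j) * cfun \<beta> (e i)) *
      poly_form D (vec_poly (e' i) * dform D (e' j) P) Q) =
      poly_form D (vec_poly (cvec (iota D \<beta>)) * deriv_fun (cfun \<alpha>) P) Q"
    if "\<alpha> \<in> pos D" "\<beta> \<in> pos D" for \<alpha> \<beta>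
  proof -
    have roots: "\<alpha> \<in> roots D" "\<beta> \<in> roots D" using that pos_roots by auto
    have \<alpha>: "cfun \<alpha> = cform D (\<Sum>j\<in>UNIV. cfun \<alpha> (e j) *s e' j)"
      unfolding dual_pair_iota[OF dual_pair_sym[OF assms] roots(1)] by (rule ext) (simp add: cform_iota roots)
    have "vec_poly (cvec (iota D \<beta>)) * deriv_fun (cfun \<alpha>) P =
      (\<Sum>i\<in>UNIV. \<Sum>j\<in>UNIV. const (cfun \<alpha> (e j) * cfun \<beta> (e i)) * (vec_poly (e' i) * dform D (e' j) P))"
      unfolding dual_pair_iota[OF dual_pair_sym[OF assms] roots(2), symmetric]
      by (subst \<alpha>) (simp add: dform_sum dform_scale vec_poly_sum vec_poly_scale sum_distrib_left sum_distrib_right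
          mult_ac flip: const_mult_const, rule sum.swap)
    then show ?thesis by (simp only: poly_form_sum_left poly_form_const_mult_left)
  qed
  have "(\<Sum>i\<in>UNIV. \<Sum>j\<in>UNIV. f (T (e j) (T (e i) x) - T (e i) (T (e j) x)) y *
      poly_form D (vec_poly (e' i) * dform D (e' j) P) Q) =
    (\<Sum>i\<in>UNIV. \<Sum>j\<in>UNIV. \<Sum>\<alpha>\<in>pos D. \<Sum>\<beta>\<in>pos D. ?h \<alpha> \<beta> * (cnj (cfun \<alpha> (e j) * cfun \<beta> (e i)) *
      poly_form D (vec_poly (e' i) * dform D (e' j) P) Q))"
    unfolding T_commutator f_sum_left f_scale_left[of "cfun _ _ * cfun _ _"] sum_distrib_right
    by (intro sum.cong refl) (simp only: mult_ac)
  also have "\<dots> = (\<Sum>i\<in>UNIV. \<Sum>\<alpha>\<in>pos D. \<Sum>j\<in>UNIV. \<Sum>\<beta>\<in>pos D. ?h \<alpha> \<beta> * (cnj (cfun \<alpha> (e j) * cfun \<beta> (e i)) *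
      poly_form D (vec_poly (e' i) * dform D (e' j) P) Q))"
    by (intro sum.cong refl sum.swap)
  also have "\<dots> = (\<Sum>\<alpha>\<in>pos D. \<Sum>i\<in>UNIV. \<Sum>\<beta>\<in>pos D. \<Sum>j\<in>UNIV. ?h \<alpha> \<beta> * (cnj (cfun \<alpha> (e j) * cfun \<beta> (e i)) *
      poly_form D (vec_poly (e' i) * dform D (e' j) P) Q))"
    by (subst sum.swap) (intro sum.cong refl sum.swap)
  also have "\<dots> = (\<Sum>\<alpha>\<in>pos D. \<Sum>\<beta>\<in>pos D. \<Sum>i\<in>UNIV. \<Sum>j\<in>UNIV. ?h \<alpha> \<beta> * (cnj (cfun \<alpha> (e j) * cfun \<beta> (e i)) *
      poly_form D (vec_poly (e' i) * dform D (e' j) P) Q))"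
    by (intro sum.cong refl sum.swap)
  also have "\<dots> = (\<Sum>\<alpha>\<in>pos D. \<Sum>\<beta>\<in>pos D. ?h \<alpha> \<beta> *
      poly_form D (vec_poly (cvec (iota D \<beta>)) * deriv_fun (cfun \<alpha>) P) Q)"
    by (intro sum.cong refl) (simp only: sum_distrib_left[symmetric] inner)
  finally show ?thesis .
qed

text \<open>The bracket changes sign under exchange of the two roots. Averaging with the exchanged
  sum turns 1/4 into 1/8 and drops the diagonal; the overall minus arises because the left side
  carries \<iota>(\<beta>) with \<alpha>, the opposite of the leading term on the right.\<close>

lemma antisymmetrize:
  "(\<Sum>\<alpha>\<in>pos D. \<Sum>\<beta>\<in>pos D. f (s (1/4 * par D \<alpha> * par D \<beta>) (bracket \<alpha> \<beta> x)) y *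
      poly_form D (vec_poly (cvec (iota D \<beta>)) * deriv_fun (cfun \<alpha>) P) Q) =
    - (\<Sum>(\<alpha>, \<beta>)\<in>{(\<alpha>, \<beta>). \<alpha> \<in> pos D \<and> \<beta> \<in> pos D \<and> \<alpha> \<noteq> \<beta>}.
      f (s (1/8 * par D \<alpha> * par D \<beta>) (bracket \<alpha> \<beta> x)) y *
      poly_form D (vec_poly (cvec (iota D \<alpha>)) * deriv_fun (cfun \<beta>) P
        - vec_poly (cvec (iota D \<beta>)) * deriv_fun (cfun \<alpha>) P) Q)"
proof -
  define h where "h \<alpha> \<beta> = f (s (1/4 * par D \<alpha> * par D \<beta>) (bracket \<alpha> \<beta> x)) y" for \<alpha> \<beta>
  define z where "z \<alpha> \<beta> = poly_form D (vec_poly (cvec (iota D \<beta>)) * deriv_fun (cfun \<alpha>) P) Q" for \<alpha> \<beta>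
  have h: "f (s (1/8 * par D \<alpha> * par D \<beta>) (bracket \<alpha> \<beta> x)) y = h \<alpha> \<beta> / 2" for \<alpha> \<beta>
    by (simp add: h_def f_scale_left)
  have h_swap: "h \<beta> \<alpha> = - h \<alpha> \<beta>" for \<alpha> \<beta>
    by (simp add: h_def f_scale_left f_diff_left algebra_simps)
  then have h_diag: "h \<alpha> \<alpha> = 0" for \<alpha> by (simp add: h_def)
  have z: "poly_form D (vec_poly (cvec (iota D \<alpha>)) * deriv_fun (cfun \<beta>) P
        - vec_poly (cvec (iota D \<beta>)) * deriv_fun (cfun \<alpha>) P) Q = z \<beta> \<alpha> - z \<alpha> \<beta>" for \<alpha> \<beta>
    using poly_form_add_left[of D "vec_poly (cvec (iota D \<alpha>)) * deriv_fun (cfun \<beta>) P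
        - vec_poly (cvec (iota D \<beta>)) * deriv_fun (cfun \<alpha>) P" "vec_poly (cvec (iota D \<beta>)) * deriv_fun (cfun \<alpha>) P" Q]
    by (simp add: z_def algebra_simps)
  let ?C = "{(\<alpha>, \<beta>). \<alpha> \<in> pos D \<and> \<beta> \<in> pos D \<and> \<alpha> \<noteq> \<beta>}"
  have "(\<Sum>(\<alpha>, \<beta>)\<in>?C. h \<alpha> \<beta> / 2 * (z \<beta> \<alpha> - z \<alpha> \<beta>)) = (\<Sum>(\<alpha>, \<beta>)\<in>pos D \<times> pos D. h \<alpha> \<beta> / 2 * (z \<beta> \<alpha> - z \<alpha> \<beta>))"
    by (rule sum.mono_neutral_left) (auto simp: h_diag)
  also have "\<dots> = (\<Sum>\<alpha>\<in>pos D. \<Sum>\<beta>\<in>pos D. h \<alpha> \<beta> / 2 * z \<beta> \<alpha>) - (\<Sum>\<alpha>\<in>pos D. \<Sum>\<beta>\<in>pos D. h \<alpha> \<beta> / 2 * z \<alpha> \<beta>)"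
    by (simp add: sum.cartesian_product[symmetric] right_diff_distrib sum_subtractf)
  also have "(\<Sum>\<alpha>\<in>pos D. \<Sum>\<beta>\<in>pos D. h \<alpha> \<beta> / 2 * z \<beta> \<alpha>) = - (\<Sum>\<alpha>\<in>pos D. \<Sum>\<beta>\<in>pos D. h \<alpha> \<beta> / 2 * z \<alpha> \<beta>)"
  proof -
    have *: "h \<beta> \<alpha> / 2 * z \<alpha> \<beta> = - (h \<alpha> \<beta> / 2 * z \<alpha> \<beta>)" for \<alpha> \<beta>
      using h_swap[of \<beta> \<alpha>] by simp
    show ?thesis
      unfolding sum_negf[symmetric] *[symmetric] by (rule sum.swap)
  qed
  finally show ?thesis
    unfolding h z h_def[symmetric] z_def[symmetric]
    by (simp add: sum_divide_distrib[symmetric] flip: sum_distrib_left)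
qed

text \<open>The polarized identity, for different pure tensors in the two slots, since the form of
  one general tensor with itself contains all pairs of its monomials. The scalars c and d are
  required on y only, the vector of the linear slot.\<close>

lemma pure_tensor_identity:
  assumes pair: "dual_pair b b'"
    and \<Omega>: "(\<Sum>i\<in>UNIV. X (b i) (X (b' i) y)) = s c y" and \<Omega>W: "Omega_W D s S y = s d y"
  shows "(\<Sum>i\<in>UNIV. \<Sum>j\<in>UNIV. f (Xt (b i) x) (Xt (b j) y) *
        poly_form D (vec_poly (b' i) * P) (vec_poly (b' j) * Q))
    - (\<Sum>i\<in>UNIV. \<Sum>j\<in>UNIV. f (Xt (b i) x) (Xt (b j) y) * poly_form D (dform D (b' i) P) (dform D (b' j) Q)) =
    (- c + d) * (f x y * poly_form D P Q)
    - (\<Sum>(\<alpha>, \<beta>)\<in>{(\<alpha>, \<beta>). \<alpha> \<in> pos D \<and> \<beta> \<in> pos D \<and> \<alpha> \<noteq> \<beta>}.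
      f (s (1/8 * par D \<alpha> * par D \<beta>) (bracket \<alpha> \<beta> x)) y *
      poly_form D (vec_poly (cvec (iota D \<alpha>)) * deriv_fun (cfun \<beta>) P
        - vec_poly (cvec (iota D \<beta>)) * deriv_fun (cfun \<alpha>) P) Q)"
proof -
  obtain r' :: "'n \<Rightarrow> real^'n" where "dual_pair (\<lambda>i. cvec (axis i 1)) (\<lambda>i. cvec (r' i))"
    by (rule real_dual_pair)
  moreover define r where "r i = (axis i 1 :: real^'n)" for i
  moreover define e e' where "e = (\<lambda>i. cvec (r i))" and "e' = (\<lambda>i. cvec (r' i))"
  ultimately have e: "dual_pair e e'" by simp
  have pf1: "poly_form D (vec_poly (e' i) * P) (vec_poly (e' j) * Q) =
      cform D (e' i) (e' j) * poly_form D P Q + poly_form D P (vec_poly (e' j) * dform D (e' i) Q)" for i j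
    by (simp only: e'_def poly_form_vec_poly_left[OF form_sym] deriv_fun_vec_poly_mult[OF linear_cform]
        poly_form_add_right poly_form_const_mult_right)
  have pf2: "poly_form D (dform D (e' i) P) (dform D (e' j) Q) = poly_form D P (vec_poly (e' i) * dform D (e' j) Q)" for i j
    by (simp only: e'_def poly_form_vec_poly_right[OF form_sym])
  have pf3: "poly_form D P (vec_poly (e' j) * dform D (e' i) Q) = poly_form D (vec_poly (e' i) * dform D (e' j) P) Q" for i j
    by (simp only: e'_def poly_form_vec_poly_right[OF form_sym] poly_form_vec_poly_left[OF form_sym])
  have adj: "f (Xt (e i) x) (Xt (e j) y) = - f x (Xt (e i) (Xt (e j) y))" for i j
    by (simp only: e_def Xt_adjoint)
  have adj2: "f x (Xt (e i) (Xt (e j) y)) = f (Xt (e j) (Xt (e i) x)) y" for i j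
    using Xt_adjoint[of "r i" x "Xt (e j) y"] Xt_adjoint[of "r j" "Xt (e i) x" y] by (simp add: e_def)
  have plus: "(\<Sum>i\<in>UNIV. \<Sum>j\<in>UNIV. f (Xt (b i) x) (Xt (b j) y) *
        poly_form D (vec_poly (b' i) * P) (vec_poly (b' j) * Q)) =
    - (\<Sum>i\<in>UNIV. \<Sum>j\<in>UNIV. f x (Xt (e i) (Xt (e j) y)) * (cform D (e' i) (e' j) * poly_form D P Q))
    - (\<Sum>i\<in>UNIV. \<Sum>j\<in>UNIV. f x (Xt (e i) (Xt (e j) y)) * poly_form D P (vec_poly (e' j) * dform D (e' i) Q))"
    by (subst dual_pair_sesquilinear_sum[OF pair e, of "\<lambda>v P. vec_poly v * P"])
      (simp_all add: vec_poly_add vec_poly_scale ring_distribs mult.assoc pf1 adj sum.distrib sum_negf sum_subtractf)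
  \<comment> \<open>The indices are exchanged at the end so that the polynomial factor is the one in
    \<open>plus\<close>; the difference of the two then contains a commutator on the module
    side.\<close>
  have minus: "(\<Sum>i\<in>UNIV. \<Sum>j\<in>UNIV. f (Xt (b i) x) (Xt (b j) y) *
        poly_form D (dform D (b' i) P) (dform D (b' j) Q)) =
    - (\<Sum>i\<in>UNIV. \<Sum>j\<in>UNIV. f x (Xt (e j) (Xt (e i) y)) * poly_form D P (vec_poly (e' j) * dform D (e' i) Q))"
    by (subst dual_pair_sesquilinear_sum[OF pair e, of "dform D"])
      (simp_all add: dform_add dform_scale pf2 adj sum_negf, rule sum.swap)
  \<comment> \<open>For fixed i, the vectors e_j weighted by B(e'_i, e'_j) sum to e'_i, so this term
    is the Casimir sum of the operators \<open>Xt\<close>.\<close>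
  have "(\<Sum>i\<in>UNIV. \<Sum>j\<in>UNIV. f x (Xt (e i) (Xt (e j) y)) * (cform D (e' i) (e' j) * poly_form D P Q)) =
      f x (\<Sum>i\<in>UNIV. Xt (e i) (Xt (\<Sum>j\<in>UNIV. cform D (e' i) (e' j) *s e j) y)) * poly_form D P Q"
    by (simp add: Xt_sum_vec Xt_sum Xt_scale_vec Xt_scale f_sum_right f_scale_right sum_distrib_left mult_ac)
  also have "\<dots> = f x (\<Sum>i\<in>UNIV. Xt (e i) (Xt (e' i) y)) * poly_form D P Q"
    using e by (simp add: dual_pair_def)
  also have "(\<Sum>i\<in>UNIV. Xt (e i) (Xt (e' i) y)) = (\<Sum>i\<in>UNIV. Xt (b i) (Xt (b' i) y))"
    by (rule dual_pair_sum[OF e pair, where sc = s])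
      (simp_all add: Xt_add_vec Xt_scale_vec Xt_add Xt_scale vector_space_axioms)
  also have "\<dots> = s (c - d) y"
    by (simp add: Xt_Casimir[OF pair] \<Omega> \<Omega>W scale_left_diff_distrib)
  finally have cas: "(\<Sum>i\<in>UNIV. \<Sum>j\<in>UNIV. f x (Xt (e i) (Xt (e j) y)) * (cform D (e' i) (e' j) * poly_form D P Q)) =
      (c - d) * (f x y * poly_form D P Q)"
    by (simp add: f_scale_right)
  \<comment> \<open>Moving both factors to the first slot costs two signs and reverses their order;
    the commutator is then evaluated on x, where \<open>E_op\<close> has to appear.\<close>
  have comm: "f x (Xt (e i) (Xt (e j) y)) - f x (Xt (e j) (Xt (e i) y)) =
    - f (T (e j) (T (e i) x) - T (e i) (T (e j) x)) y" for i j
    unfolding adj2 f_diff_left[symmetric] by (simp only: Xt_commutator f_uminus_left)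
  have "(\<Sum>i\<in>UNIV. \<Sum>j\<in>UNIV. f x (Xt (e i) (Xt (e j) y)) * poly_form D P (vec_poly (e' j) * dform D (e' i) Q))
      - (\<Sum>i\<in>UNIV. \<Sum>j\<in>UNIV. f x (Xt (e j) (Xt (e i) y)) * poly_form D P (vec_poly (e' j) * dform D (e' i) Q)) =
      - (\<Sum>i\<in>UNIV. \<Sum>j\<in>UNIV. f (T (e j) (T (e i) x) - T (e i) (T (e j) x)) y *
        poly_form D (vec_poly (e' i) * dform D (e' j) P) Q)"
    unfolding sum_subtractf[symmetric] left_diff_distrib[symmetric] comm pf3 by (simp add: sum_negf)
  also have "\<dots> = (\<Sum>(\<alpha>, \<beta>)\<in>{(\<alpha>, \<beta>). \<alpha> \<in> pos D \<and> \<beta> \<in> pos D \<and> \<alpha> \<noteq> \<beta>}.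
      f (s (1/8 * par D \<alpha> * par D \<beta>) (bracket \<alpha> \<beta> x)) y *
      poly_form D (vec_poly (cvec (iota D \<alpha>)) * deriv_fun (cfun \<beta>) P
        - vec_poly (cvec (iota D \<beta>)) * deriv_fun (cfun \<alpha>) P) Q)"
    unfolding commutator_term[OF e] antisymmetrize by simp
  finally show ?thesis
    unfolding plus minus cas by (simp add: algebra_simps)
qed

end

section \<open>The main identity\<close>

context root_datum begin

lemma hermitian_sesquilinear:
  assumes "vector_space sM" "nondegenerate_hermitian sM f"
  shows "sesquilinear_form sM f"
proof -
  interpret vector_space sM by fact
  have "Vector_Spaces.linear sM (*) (f m)" for m
    using assms(2) unfolding nondegenerate_hermitian_def by blast
  note lin = this[unfolded Vector_Spaces.linear_iff]
  have herm: "f m' m = cnj (f m m')" for m m'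
    using assms(2) unfolding nondegenerate_hermitian_def by blast
  show ?thesis
  proof unfold_locales
    show add: "f z (x + y) = f z x + f z y" and scale: "f z (sM c x) = c * f z x" for x y z c
      using lin[of z] by blast+
    show "f (x + y) z = f x z + f y z" for x y z
      unfolding herm[of _ z] by (simp only: add complex_cnj_add)
    show "f (sM c x) z = cnj c * f x z" for x z c
      unfolding herm[of _ z] by (simp only: scale complex_cnj_mult)
  qed
qed

text \<open>\<open>Omega_W\<close> is a combination of group elements and so commutes with every
  intertwiner. It therefore acts by the scalar of \<sigma> on each embedded copy, hence on their
  span.\<close>

lemma isotypic_Omega_W:
  assumes M: "hecke_module D sM \<pi>" and irr: "irreducible_rep D sU \<sigma>"
    and x: "x \<in> isotypic D sM \<pi> sU \<sigma>"
  shows "Omega_W D sM (\<lambda>w. \<pi> (hW D w)) x = sM (scalar_of sU (Omega_W D sU \<sigma>)) x"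
proof -
  interpret hecke_rep D sM "\<lambda>w. \<pi> (hW D w)" "\<lambda>v. \<pi> (hcls D (gV v))"
    by (rule hecke_module_rep(1)[OF M])
  interpret U: weyl_rep D sU \<sigma> by (rule irreducible_weyl_rep[OF irr])
  let ?c = "scalar_of sU (Omega_W D sU \<sigma>)" and ?O = "Omega_W D sM (\<lambda>w. \<pi> (hW D w))"
  have "subspace {x. ?O x = sM ?c x}"
    using Omega_W_scale[of 0 0]
    by (intro subspaceI) (auto simp: Omega_W_add Omega_W_scale scale_right_distrib mult.commute)
  moreover have "?O (g u) = sM ?c (g u)"
    if g: "Vector_Spaces.linear sU sM g" "\<forall>w\<in>weyl D. \<forall>u. g (\<sigma> w u) = \<pi> (hW D w) (g u)" for g u
  proof -
    interpret g: Vector_Spaces.linear sU sM g by (rule g(1))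
    have "?O (g u) = g (Omega_W D sU \<sigma> u)"
      unfolding Omega_W_def g.sum g.scale using g(2) pos_weyl weyl_comp
      by (intro sum.cong refl) (metis (no_types, lifting))
    then show ?thesis by (simp add: Omega_W_scalar[OF irr, of u] g.scale)
  qed
  ultimately have "isotypic D sM \<pi> sU \<sigma> \<subseteq> {x. ?O x = sM ?c x}"
    unfolding isotypic_def by (intro span_minimal) auto
  then show ?thesis using x by blast
qed

lemma hOmega_scalar:
  assumes M: "hecke_module D sM \<pi>" and cc: "has_central_character D sM \<pi>"
    and pair: "dual_pair b b'" and "x \<noteq> 0"
  shows "(\<Sum>i\<in>UNIV. \<pi> (hcls D (gV (b i))) (\<pi> (hcls D (gV (b' i))) x)) =
    sM (scalar_of sM (\<pi> (hOmega D b b'))) x"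
proof -
  interpret hecke_rep D sM "\<lambda>w. \<pi> (hW D w)" "\<lambda>v. \<pi> (hcls D (gV v))"
    by (rule hecke_module_rep(1)[OF M])
  note [simp] = hecke_module_rep(2-6)[OF M]
  have zero: "\<pi> (hcls D 0) m = 0" for m
    using hecke_module_rep(3)[OF M, of 0 0 m] by simp
  have sum: "\<pi> (hcls D (\<Sum>i\<in>A. g i)) m = (\<Sum>i\<in>A. \<pi> (hcls D (g i)) m)" for A m and g :: "'n \<Rightarrow> 'n hecke_free"
    by (induction A rule: infinite_finite_induct) (auto simp: zero)
  obtain ch where ch: "\<pi> (hOmega D b b') m = sM (ch (hOmega D b b')) m" for m
    using cc hOmega_central[OF pair] unfolding has_central_character_def by blast
  then have "scalar_of sM (\<pi> (hOmega D b b')) = ch (hOmega D b b')"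
    by (rule scalar_of_eqI[OF vector_space_axioms \<open>x \<noteq> 0\<close>])
  then show ?thesis
    using ch[of x] by (simp add: hOmega_def sum)
qed

lemma htilde_Xt:
  assumes M: "hecke_module D sM \<pi>"
  shows "\<pi> (htilde D v) m = hecke_rep.Xt D sM (\<lambda>w. \<pi> (hW D w)) (\<lambda>v. \<pi> (hcls D (gV v))) v m"
proof -
  interpret hecke_rep D sM "\<lambda>w. \<pi> (hW D w)" "\<lambda>v. \<pi> (hcls D (gV v))"
    by (rule hecke_module_rep(1)[OF M])
  note [simp] = hecke_module_rep(2-6)[OF M]
  have zero: "\<pi> (hcls D 0) m = 0" for m
    using hecke_module_rep(3)[OF M, of 0 0 m] by simp
  have diff: "\<pi> (hcls D (x - y)) m = \<pi> (hcls D x) m - \<pi> (hcls D y) m" for x y m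
    using hecke_module_rep(3)[OF M, of "x - y" y m] by (simp add: algebra_simps)
  have sum: "\<pi> (hcls D (\<Sum>i\<in>A. g i)) m = (\<Sum>i\<in>A. \<pi> (hcls D (g i)) m)"
    for A m and g :: "((real^'n) \<Rightarrow>\<^sub>L real) \<Rightarrow> 'n hecke_free"
    by (induction A rule: infinite_finite_induct) (auto simp: zero)
  show ?thesis
    by (simp add: htilde_def diff sum Xt_def T_def scale_sum_right mult.assoc flip: hW_def)
qed

text \<open>The value of the star operation on v~ is prescribed for real v; its conjugate-linearity
  would bring in the conjugate of a complex vector.\<close>

lemma htilde_adjoint:
  assumes M: "hecke_module D sM \<pi>" and st: "hecke_star D st" and inv: "star_invariant D st \<pi> f"
    and herm: "nondegenerate_hermitian sM f"
  shows "f (\<pi> (htilde D (cvec v)) x) y = - f x (\<pi> (htilde D (cvec v)) y)"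
proof -
  interpret hecke_rep D sM "\<lambda>w. \<pi> (hW D w)" "\<lambda>v. \<pi> (hcls D (gV v))"
    by (rule hecke_module_rep(1)[OF M])
  interpret sesquilinear_form sM f by (rule hermitian_sesquilinear[OF vector_space_axioms herm])
  interpret H: ring "hecke D" by (rule ring_hecke)
  let ?h = "htilde D (cvec v)"
  have h: "?h \<in> carrier (hecke D)" by (simp add: htilde_def hcls_carrier)
  have add: "\<pi> (h \<oplus>\<^bsub>hecke D\<^esub> h') m = \<pi> h m + \<pi> h' m" if "h \<in> carrier (hecke D)" "h' \<in> carrier (hecke D)" for h h' m
    using M that by (simp add: hecke_module_def)
  have "\<pi> \<zero>\<^bsub>hecke D\<^esub> y = 0"
    using add[of "\<zero>\<^bsub>hecke D\<^esub>" "\<zero>\<^bsub>hecke D\<^esub>" y] by simp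
  then have neg: "\<pi> (\<ominus>\<^bsub>hecke D\<^esub> ?h) y = - \<pi> ?h y"
    using add[OF h H.a_inv_closed[OF h], of y] by (simp add: H.r_neg h eq_neg_iff_add_eq_0 add.commute)
  have "f (\<pi> ?h x) y = f x (\<pi> (st ?h) y)"
    using inv h by (simp add: star_invariant_def)
  also have "st ?h = \<ominus>\<^bsub>hecke D\<^esub> ?h"
    using st by (simp add: hecke_star_def)
  finally show ?thesis by (simp add: neg f_uminus_right)
qed

end

text \<open>The term of \<open>E_op\<close> is subtracted, whereas the English formula adds it. The
  minus comes from [u~, v~] = - [T u, T v], with \<open>E_op\<close> built from the positive
  brackets of reflections.\<close>

theorem lemma4p20:
  fixes D :: "('n::finite) hecke_datum"
    and sM :: "complex \<Rightarrow> 'm \<Rightarrow> 'm::ab_group_add"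
    and \<pi> :: "'n hecke_free set \<Rightarrow> 'm \<Rightarrow> 'm"
    and st :: "'n hecke_free set \<Rightarrow> 'n hecke_free set"
    and f :: "'m \<Rightarrow> 'm \<Rightarrow> complex"
    and sU :: "complex \<Rightarrow> 'u \<Rightarrow> 'u::ab_group_add"
    and \<sigma> :: "(real^'n \<Rightarrow> real^'n) \<Rightarrow> 'u \<Rightarrow> 'u"
    and b b' :: "'n \<Rightarrow> complex^'n"
    and bs :: "'n \<Rightarrow> complex^'n \<Rightarrow> complex"
    and x :: "('n, 'm) tens"
  assumes "valid_datum D"
    and "hecke_module D sM \<pi>"
    and "has_central_character D sM \<pi>"
    and "hecke_star D st"
    and "nondegenerate_hermitian sM f"
    and "star_invariant D st \<pi> f"
    and "irreducible_rep D sU \<sigma>"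
    and "dual_bases D b b' bs"
    and "x \<in> tensor_sub (isotypic D sM \<pi> sU \<sigma>)"
  shows "tensor_form D f (D_plus D sM \<pi> b b' x) (D_plus D sM \<pi> b b' x)
       - tensor_form D f (D_minus D sM \<pi> b bs x) (D_minus D sM \<pi> b bs x)
     = (- scalar_of sM (\<pi> (hOmega D b b')) + scalar_of sU (Omega_W D sU \<sigma>)) * tensor_form D f x x
       - tensor_form D f (E_op D sM \<pi> x) x"
proof -
  interpret root_datum D by unfold_locales fact
  interpret hecke_rep D sM "\<lambda>w. \<pi> (hW D w)" "\<lambda>v. \<pi> (hcls D (gV v))"
    by (rule hecke_module_rep(1)) fact
  interpret sesquilinear_form sM f
    by (rule hermitian_sesquilinear[OF vector_space_axioms]) fact
  have htilde: "\<pi> (htilde D v) = Xt v" for v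
    by (rule ext) (rule htilde_Xt[OF assms(2)])
  interpret hermitian_hecke_rep D sM "\<lambda>w. \<pi> (hW D w)" "\<lambda>v. \<pi> (hcls D (gV v))" f
    by unfold_locales
      (use htilde_adjoint[OF assms(2,4,6,5)] in \<open>simp add: htilde\<close>)
  have pair: "dual_pair b b'" and bs: "bs = (\<lambda>i. cform D (b' i))"
    using dual_bases_pair dual_bases_functional assms(8) by (blast, blast)
  let ?l = "Poly_Mapping.lookup x" and ?K = "Poly_Mapping.keys x"
  let ?C = "{(\<alpha>, \<beta>). \<alpha> \<in> pos D \<and> \<beta> \<in> pos D \<and> \<alpha> \<noteq> \<beta>}"
  let ?c = "scalar_of sM (\<pi> (hOmega D b b'))" and ?d = "scalar_of sU (Omega_W D sU \<sigma>)"
  let ?m = "monom_poly :: _ \<Rightarrow> 'n cpoly"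
  have D_plus: "D_plus D sM \<pi> b b' x = (\<Sum>i\<in>UNIV. tensor_op sM (Xt (b i)) (\<lambda>P. vec_poly (b' i) * P) x)"
    by (simp add: D_plus_def htilde)
  have D_minus: "D_minus D sM \<pi> b bs x = (\<Sum>i\<in>UNIV. tensor_op sM (Xt (b i)) (dform D (b' i)) x)"
    by (simp add: D_minus_def htilde bs)
  have E: "tensor_form D f (E_op D sM \<pi> x) x = (\<Sum>\<mu>\<in>?K. \<Sum>\<nu>\<in>?K. \<Sum>(\<alpha>, \<beta>)\<in>?C.
      f (sM (1/8 * par D \<alpha> * par D \<beta>) (bracket \<alpha> \<beta> (?l \<mu>))) (?l \<nu>) *
      poly_form D (vec_poly (cvec (iota D \<alpha>)) * deriv_fun (cfun \<beta>) (?m \<mu>)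
        - vec_poly (cvec (iota D \<beta>)) * deriv_fun (cfun \<alpha>) (?m \<mu>)) (?m \<nu>))"
    unfolding E_op_def split_def by (rule tensor_form_op_left)
  \<comment> \<open>Restricting \<nu> to the support gives a nonzero coefficient
    \<open>?l \<nu>\<close>, so M is not the zero module and \<open>scalar_of\<close> is
    determined.\<close>
  have id: "(\<Sum>i\<in>UNIV. \<Sum>j\<in>UNIV. f (Xt (b i) (?l \<mu>)) (Xt (b j) (?l \<nu>)) *
        poly_form D (vec_poly (b' i) * ?m \<mu>) (vec_poly (b' j) * ?m \<nu>))
    - (\<Sum>i\<in>UNIV. \<Sum>j\<in>UNIV. f (Xt (b i) (?l \<mu>)) (Xt (b j) (?l \<nu>)) *
        poly_form D (dform D (b' i) (?m \<mu>)) (dform D (b' j) (?m \<nu>))) =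
    (- ?c + ?d) * (f (?l \<mu>) (?l \<nu>) * poly_form D (?m \<mu>) (?m \<nu>))
    - (\<Sum>(\<alpha>, \<beta>)\<in>?C. f (sM (1/8 * par D \<alpha> * par D \<beta>) (bracket \<alpha> \<beta> (?l \<mu>))) (?l \<nu>) *
      poly_form D (vec_poly (cvec (iota D \<alpha>)) * deriv_fun (cfun \<beta>) (?m \<mu>)
        - vec_poly (cvec (iota D \<beta>)) * deriv_fun (cfun \<alpha>) (?m \<mu>)) (?m \<nu>))"
    if "\<nu> \<in> ?K" for \<mu> \<nu>
  proof (rule pure_tensor_identity[OF pair])
    show "(\<Sum>i\<in>UNIV. \<pi> (hcls D (gV (b i))) (\<pi> (hcls D (gV (b' i))) (?l \<nu>))) = sM ?c (?l \<nu>)"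
      by (rule hOmega_scalar[OF assms(2,3) pair]) (use that in \<open>simp add: in_keys_iff\<close>)
    show "Omega_W D sM (\<lambda>w. \<pi> (hW D w)) (?l \<nu>) = sM ?d (?l \<nu>)"
      by (rule isotypic_Omega_W[OF assms(2,7)]) (use assms(9) in \<open>simp add: tensor_sub_def\<close>)
  qed
  show ?thesis
    unfolding D_plus D_minus tensor_form_ops E
    unfolding tensor_form_def sum_distrib_left sum_subtractf[symmetric]
    by (rule sum.cong[OF refl], rule sum.cong[OF refl], rule id[unfolded sum_subtractf[symmetric]])
qed

end
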